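(* Let $G=\mathrm{SL}_{d+1}(\mathbb{R})$, let $\Gamma\le G$ be a discrete subgroup that is Zariski dense in $G$, and let $\Omega\subset\mathbb{P}(\mathbb{R}^{d+1})$ be a properly convex domain with $\Gamma\cdot\Omega=\Omega$. Let $\Lambda_\Gamma\subset\mathbb{P}(\mathbb{R}^{d+1})$ be the proximal limit set of $\Gamma$. Suppose there exist $a',b'\in\Lambda_\Gamma\cap\partial\Omega$ such that $(a',b')\subset\Omega$ is a rank one geodesic. Then: (1) there exist rank one isometries $g_n\in\Gamma$ such that $\lim_{n\to\infty}g_n^+=a'$ and $\lim_{n\to\infty}g_n^-=b'$; (2) $(\Omega,\Gamma)$ is a rank one Hilbert geometry, i.e. $\Gamma$ contains a rank one isometry; (3) the set of rank one isometries in $\Gamma$ is Zariski dense in $G$; (4) $\Lambda_\Gamma=\overline{\{\gamma^+:\gamma\in\Gamma\text{ is a rank one isometry}\}}$.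
   Context: A properly convex domain is a nonempty open set $\Omega\subset\mathbb{P}(\mathbb{R}^{d+1})$ such that some affine chart contains $\overline\Omega$ and in it $\Omega$ is a bounded convex set. For $x,y\in\overline\Omega$, $[x,y]\subset\overline\Omega$ is the closed projective line segment joining them, and $(x,y)=[x,y]\setminus\{x,y\}$. The Hilbert metric is $d_\Omega(x,y)=\frac12\log\frac{|b-x||y-a|}{|b-y||x-a|}$, where $a,b\in\partial\Omega$ are the endpoints of the intersection of $\overline\Omega$ with the projective line through $x\ne y$, ordered $a,x,y,b$ (computed in an affine chart containing $\overline{\Omega}$). $\mathrm{Aut}(\Omega)=\{g\in\mathrm{PGL}_{d+1}(\mathbb{R}): g\Omega=\Omega\}$. Elements of $\mathrm{SL}_{d+1}(\mathbb{R})$ preserving $\Omega$ are viewed as automorphisms of $\Omega$. Rank one geodesic: for $a,b\in\partial\Omega$ with $(a,b)\subset\Omega$, the projective geodesic $(a,b)$ is a rank one geodesic if it is not contained in a half triangle in $\Omega$, i.e. for every $z\in\partial\Omega$ either $(a,z)\subset\Omega$ or $(z,b)\subset\Omega$. Rank one isometry: $\gamma\in\mathrm{Aut}(\Omega)$ is a rank one isometry if (a) $\tau_\Omega(\gamma):=\inf_{x\in\Omega}d_\Omega(x,\gamma x)>0$; (b) $\gamma$ has an axis, i.e. a non-trivial (open) projective line segment of the form $\mathbb{P}(V)\cap\Omega$ with $V\le\mathbb{R}^{d+1}$ a two-dimensional $\gamma$-invariant linear subspace; (c) no axis $(a,b)$ of $\gamma$ ($a,b\in\partial\Omega$) is contained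 in a half triangle in $\Omega$, i.e. there is no $z\in\partial\Omega$ with $[a,z]\cup[z,b]\subset\partial\Omega$. A rank one isometry has a unique eigenvalue of maximal modulus and a unique one of minimal modulus, both of multiplicity one; $\gamma^+$ (resp. $\gamma^-$) $\in\partial\Omega$ denotes the corresponding eigenline for the maximal (resp. minimal) modulus. Proximal limit set: write $g\in G$ as $g=k_1\,\mathrm{diag}(a_1(g),\dots,a_{d+1}(g))\,k_2$ with $k_1,k_2\in\mathrm{SO}(d+1)$ and $a_1(g)\ge\dots\ge a_{d+1}(g)>0$, and put $E(g)=k_1\cdot[e_1]\in\mathbb{P}(\mathbb{R}^{d+1})$, well defined when $a_1(g)>a_2(g)$. $\Lambda_\Gamma$ is the set of all accumulation points of sequences $\{E(\gamma_n)\}$ where $\{\gamma_n\}$ is a sequence in $\Gamma$ with $\log\frac{a_1(\gamma_n)}{a_2(\gamma_n)}\to\infty$. *)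

theory Defs
  imports "HOL-Analysis.Analysis" "HOL-Algebra.Group"
begin

text \<open>Throughout, \<^typ>\<open>real^'n\<close> with \<open>CARD('n) = d + 1\<close> plays the role of $\mathbb{R}^{d+1}$.\<close>

section \<open>Real projective space\<close>

typedef ('n::finite) proj = "{L :: (real^'n) set. subspace L \<and> dim L = 1}"
proof
  show "span {axis undefined 1 :: real^'n} \<in> {L. subspace L \<and> dim L = 1}"
    by (simp add: axis_eq_0_iff dim_span_eq_card_independent)
qed

definition pline :: "real^'n \<Rightarrow> 'n proj" where
  "pline v = Abs_proj (span {v})"

lemma Rep_pline: "v \<noteq> 0 \<Longrightarrow> Rep_proj (pline v) = span {v}"
  unfolding pline_def by (rule Abs_proj_inverse) (simp add: dim_span_eq_card_independent)

text \<open>The quotient topology under \<open>v \<mapsto> pline v\<close> on nonzero vectors.\<close>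

instantiation proj :: (finite) topological_space
begin

definition open_proj :: "'a proj set \<Rightarrow> bool" where
  "open_proj U \<longleftrightarrow> open {v :: real^'a. v \<noteq> 0 \<and> pline v \<in> U}"

instance
proof
  have "{v :: real^'a. v \<noteq> 0 \<and> pline v \<in> UNIV} = UNIV - {0}" by auto
  then show "open (UNIV :: 'a proj set)"
    by (simp add: open_proj_def open_delete)
next
  fix S T :: "'a proj set"
  assume "open S" "open T"
  moreover have "{v :: real^'a. v \<noteq> 0 \<and> pline v \<in> S \<inter> T} =
      {v. v \<noteq> 0 \<and> pline v \<in> S} \<inter> {v. v \<noteq> 0 \<and> pline v \<in> T}" by auto
  ultimately show "open (S \<inter> T)" by (simp add: open_proj_def open_Int)
next
  fix K :: "'a proj set set"
  assume "\<forall>S\<in>K. open S"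
  moreover have "{v :: real^'a. v \<noteq> 0 \<and> pline v \<in> \<Union>K} =
      (\<Union>S\<in>K. {v. v \<noteq> 0 \<and> pline v \<in> S})" by auto
  ultimately show "open (\<Union>K)" by (simp add: open_proj_def open_UN)
qed

end

text \<open>Only meaningful for invertible matrices.\<close>

definition pact :: "real^'n^'n \<Rightarrow> 'n proj \<Rightarrow> 'n proj" where
  "pact g p = Abs_proj ((*v) g ` Rep_proj p)"

lemma pact_pline:
  assumes "invertible g" "v \<noteq> 0"
  shows "pact g (pline v) = pline (g *v v)"
proof -
  have "(*v) g ` span {v} = span {g *v v}"
    using linear_span_image[OF matrix_vector_mul_linear, of g "{v}"] by simp
  then show ?thesis using assms by (simp add: pact_def Rep_pline) (simp add: pline_def)
qed

definition proj_sub :: "(real^'n) set \<Rightarrow> 'n proj set" where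
  "proj_sub V = {p. Rep_proj p \<subseteq> V}"

definition proj_line :: "'n::finite proj \<Rightarrow> 'n proj \<Rightarrow> 'n proj set" where
  "proj_line x y = proj_sub (span (Rep_proj x \<union> Rep_proj y))"


section \<open>Properly convex domains\<close>

text \<open>A vector \<open>u \<noteq> 0\<close> determines the affine chart \<open>affine_chart u\<close>, the complement of
  the projective hyperplane orthogonal to \<open>u\<close>; it is identified with the affine hyperplane
  \<open>{v. u \<bullet> v = 1}\<close> through \<open>chart_rep u\<close>.\<close>

definition affine_chart :: "real^'n \<Rightarrow> 'n proj set" where
  "affine_chart u = {p. \<exists>v\<in>Rep_proj p. u \<bullet> v \<noteq> 0}"

definition chart_rep :: "real^'n \<Rightarrow> 'n proj \<Rightarrow> real^'n" where
  "chart_rep u p = (THE v. v \<in> Rep_proj p \<and> u \<bullet> v = 1)"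

definition convex_chart :: "'n::finite proj set \<Rightarrow> real^'n \<Rightarrow> bool" where
  "convex_chart \<Omega> u \<longleftrightarrow> u \<noteq> 0 \<and> closure \<Omega> \<subseteq> affine_chart u \<and>
     bounded (chart_rep u ` \<Omega>) \<and> convex (chart_rep u ` \<Omega>)"

definition properly_convex_domain :: "'n::finite proj set \<Rightarrow> bool" where
  "properly_convex_domain \<Omega> \<longleftrightarrow> \<Omega> \<noteq> {} \<and> open \<Omega> \<and> (\<exists>u. convex_chart \<Omega> u)"

text \<open>Segments and the Hilbert metric do not depend on the chart containing \<open>closure \<Omega>\<close>
  in which they are computed, so an arbitrary one is chosen.\<close>

definition dom_rep :: "'n::finite proj set \<Rightarrow> 'n proj \<Rightarrow> real^'n" where
  "dom_rep \<Omega> = chart_rep (SOME u. convex_chart \<Omega> u)"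

definition proj_seg :: "'n::finite proj set \<Rightarrow> 'n proj \<Rightarrow> 'n proj \<Rightarrow> 'n proj set" where
  "proj_seg \<Omega> x y = pline ` closed_segment (dom_rep \<Omega> x) (dom_rep \<Omega> y)"

definition open_proj_seg :: "'n::finite proj set \<Rightarrow> 'n proj \<Rightarrow> 'n proj \<Rightarrow> 'n proj set" where
  "open_proj_seg \<Omega> x y = proj_seg \<Omega> x y - {x, y}"

definition hilbert_dist :: "'n::finite proj set \<Rightarrow> 'n proj \<Rightarrow> 'n proj \<Rightarrow> real" where
  "hilbert_dist \<Omega> x y = (if x = y then 0 else
     (THE r. \<exists>a b. a \<in> frontier \<Omega> \<and> b \<in> frontier \<Omega> \<and>
        closure \<Omega> \<inter> proj_line x y = proj_seg \<Omega> a b \<and>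
        x \<in> proj_seg \<Omega> a y \<and> y \<in> proj_seg \<Omega> x b \<and>
        r = 1 / 2 * ln (norm (dom_rep \<Omega> b - dom_rep \<Omega> x) * norm (dom_rep \<Omega> y - dom_rep \<Omega> a) /
              (norm (dom_rep \<Omega> b - dom_rep \<Omega> y) * norm (dom_rep \<Omega> x - dom_rep \<Omega> a)))))"


section \<open>Automorphisms and the rank one condition\<close>

text \<open>Automorphisms are elements of the projective linear group; they are given by representing
  matrices, and every notion below is invariant under rescaling the matrix.\<close>

definition automorphisms :: "'n::finite proj set \<Rightarrow> (real^'n^'n) set" where
  "automorphisms \<Omega> = {g. invertible g \<and> pact g ` \<Omega> = \<Omega>}"

text \<open>The condition \<open>a \<noteq> b\<close> is implicit in calling \<open>(a, b)\<close> a geodesic; for \<open>a = b\<close> the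
  open segment is empty.\<close>

definition rank_one_geodesic :: "'n::finite proj set \<Rightarrow> 'n proj \<Rightarrow> 'n proj \<Rightarrow> bool" where
  "rank_one_geodesic \<Omega> a b \<longleftrightarrow>
     a \<in> frontier \<Omega> \<and> b \<in> frontier \<Omega> \<and> a \<noteq> b \<and> open_proj_seg \<Omega> a b \<subseteq> \<Omega> \<and>
     (\<forall>z\<in>frontier \<Omega>. open_proj_seg \<Omega> a z \<subseteq> \<Omega> \<or> open_proj_seg \<Omega> z b \<subseteq> \<Omega>)"

definition translation_length :: "'n::finite proj set \<Rightarrow> real^'n^'n \<Rightarrow> real" where
  "translation_length \<Omega> g = (INF x\<in>\<Omega>. hilbert_dist \<Omega> x (pact g x))"

definition is_axis :: "'n::finite proj set \<Rightarrow> real^'n^'n \<Rightarrow> 'n proj \<Rightarrow> 'n proj \<Rightarrow> bool" where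
  "is_axis \<Omega> g a b \<longleftrightarrow>
     a \<in> frontier \<Omega> \<and> b \<in> frontier \<Omega> \<and> a \<noteq> b \<and>
     (\<exists>V. subspace V \<and> dim V = 2 \<and> (*v) g ` V \<subseteq> V \<and> open_proj_seg \<Omega> a b = proj_sub V \<inter> \<Omega>)"

definition rank_one_isometry :: "'n::finite proj set \<Rightarrow> real^'n^'n \<Rightarrow> bool" where
  "rank_one_isometry \<Omega> g \<longleftrightarrow>
     g \<in> automorphisms \<Omega> \<and>
     translation_length \<Omega> g > 0 \<and>
     (\<exists>a b. is_axis \<Omega> g a b) \<and>
     (\<forall>a b. is_axis \<Omega> g a b \<longrightarrow>
        \<not> (\<exists>z\<in>frontier \<Omega>. proj_seg \<Omega> a z \<union> proj_seg \<Omega> z b \<subseteq> frontier \<Omega>))"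

definition rank_one_hilbert_geometry :: "'n::finite proj set \<Rightarrow> (real^'n^'n) set \<Rightarrow> bool" where
  "rank_one_hilbert_geometry \<Omega> \<Gamma> \<longleftrightarrow> (\<exists>g\<in>\<Gamma>. rank_one_isometry \<Omega> g)"

text \<open>Moduli are compared with those of all complex eigenvalues. The extremal eigenvalues of a rank
  one isometry are simple and strictly extremal in modulus, hence real, so that the descriptions
  below are unique.\<close>

definition complex_eigenvalue :: "real^'n^'n \<Rightarrow> complex \<Rightarrow> bool" where
  "complex_eigenvalue g \<mu> \<longleftrightarrow>
     (\<exists>w :: complex^'n. w \<noteq> 0 \<and> (\<chi> i j. complex_of_real (g $ i $ j)) *v w = \<mu> *s w)"

definition attracting_point :: "real^'n^'n \<Rightarrow> 'n proj" where
  "attracting_point g = (THE p. \<exists>c::real. (\<forall>v\<in>Rep_proj p. g *v v = c *\<^sub>R v) \<and>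
     (\<forall>\<mu>. complex_eigenvalue g \<mu> \<longrightarrow> cmod \<mu> \<le> \<bar>c\<bar>))"

definition repelling_point :: "real^'n^'n \<Rightarrow> 'n proj" where
  "repelling_point g = (THE p. \<exists>c::real. (\<forall>v\<in>Rep_proj p. g *v v = c *\<^sub>R v) \<and>
     (\<forall>\<mu>. complex_eigenvalue g \<mu> \<longrightarrow> \<bar>c\<bar> \<le> cmod \<mu>))"


section \<open>The special linear group and its Zariski topology\<close>

definition SL :: "(real^'n^'n) monoid" where
  "SL = \<lparr>carrier = {A. det A = 1}, mult = (**), one = mat 1\<rparr>"

lemma group_SL: "group (SL :: (real^'n^'n) monoid)"
proof (rule groupI)
  fix A :: "real^'n^'n" assume "A \<in> carrier SL"
  then have d: "det A = 1" by (simp add: SL_def)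
  then have "invertible A" by (simp add: invertible_det_nz)
  then obtain B where B: "A ** B = mat 1" "B ** A = mat 1" unfolding invertible_def by blast
  then have "det B = 1" using d by (metis det_I det_mul mult_1)
  then show "\<exists>B\<in>carrier SL. B \<otimes>\<^bsub>SL\<^esub> A = \<one>\<^bsub>SL\<^esub>"
    using B by (auto simp: SL_def)
qed (auto simp: SL_def det_mul matrix_mul_assoc)

definition zariski_SL :: "(real^'n^'n) topology" where
  "zariski_SL = topology_generated_by
     {{A \<in> carrier SL. f A \<noteq> 0} | f. real_polynomial_function f}"

lemma topspace_zariski_SL: "topspace zariski_SL = carrier SL"
proof
  have "carrier SL \<in> {{A \<in> carrier SL. f A \<noteq> 0} | f :: real^'n^'n \<Rightarrow> real. real_polynomial_function f}"
    by (auto intro!: exI[of _ "\<lambda>_. 1"] real_polynomial_function.intros(2))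
  then show "carrier SL \<subseteq> topspace (zariski_SL :: (real^'n^'n) topology)"
    unfolding zariski_SL_def topology_generated_by_topspace by blast
qed (auto simp: zariski_SL_def topology_generated_by_topspace)

definition zariski_dense :: "(real^'n^'n) set \<Rightarrow> bool" where
  "zariski_dense S \<longleftrightarrow> S \<subseteq> carrier SL \<and> zariski_SL closure_of S = carrier SL"


section \<open>The proximal limit set\<close>

text \<open>The index type carries no order, so an enumeration of the coordinates by \<open>1, \<dots>, d + 1\<close> is
  fixed. Another choice conjugates the decomposition below by a rotation matrix and affects neither
  the singular values nor the point \<open>cartan_point g\<close>.\<close>

definition coord :: "nat \<Rightarrow> 'n::finite" where
  "coord = (SOME \<sigma>. bij_betw \<sigma> {1..CARD('n)} UNIV)"

definition diag_matrix :: "real^'n \<Rightarrow> real^'n^'n" where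
  "diag_matrix a = (\<chi> i j. if i = j then a $ i else 0)"

definition cartan_decomposition ::
    "real^'n^'n \<Rightarrow> real^'n^'n \<Rightarrow> real^'n \<Rightarrow> real^'n^'n \<Rightarrow> bool" where
  "cartan_decomposition g k a l \<longleftrightarrow>
     rotation_matrix k \<and> rotation_matrix l \<and> g = k ** diag_matrix a ** l \<and>
     (\<forall>i j. 1 \<le> i \<and> i \<le> j \<and> j \<le> CARD('n) \<longrightarrow> a $ coord j \<le> a $ coord i) \<and>
     (\<forall>i. a $ i > 0)"

definition sing_val :: "real^'n^'n \<Rightarrow> nat \<Rightarrow> real" where
  "sing_val g i = (THE r. \<exists>k a l. cartan_decomposition g k a l \<and> r = a $ coord i)"

text \<open>Well defined when \<open>sing_val g 1 > sing_val g 2\<close>.\<close>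

definition cartan_point :: "real^'n^'n \<Rightarrow> 'n proj" where
  "cartan_point g = (THE p. \<exists>k a l. cartan_decomposition g k a l \<and>
     p = pact k (pline (axis (coord 1) 1)))"

definition proximal_limit_set :: "(real^'n^'n) set \<Rightarrow> 'n proj set" where
  "proximal_limit_set \<Gamma> = {p. \<exists>\<gamma> :: nat \<Rightarrow> real^'n^'n. (\<forall>n. \<gamma> n \<in> \<Gamma>) \<and>
     filterlim (\<lambda>n. ln (sing_val (\<gamma> n) 1 / sing_val (\<gamma> n) 2)) at_top sequentially \<and>
     (\<exists>r :: nat \<Rightarrow> nat. strict_mono r \<and> (\<lambda>n. cartan_point (\<gamma> (r n))) \<longlonglongrightarrow> p)}"

end

theory Submission
  imports Defs "HOL-Library.Function_Algebras"
begin

text \<open>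
  Everything is read off the convex cone \<open>C\<close> over \<open>\<Omega>\<close> and limits of rescaled elements of \<open>\<Gamma>\<close>.
  The singular value decomposition identifies \<open>\<Lambda>\<^sub>\<Gamma>\<close> with the images of the rank one matrices
  \<open>u f\<^sup>T\<close> that are limits of multiples of elements of \<open>\<Gamma>\<close>. If a cone automorphism \<open>g\<close> fixes the
  rays through \<open>a\<close> and \<open>b\<close> with eigenvalues \<open>\<alpha> > \<beta> > 0\<close> and no half triangle contains the segment
  between them, then \<open>g\<^sup>n / \<alpha>\<^sup>n\<close> converges to a rank one matrix with image spanned by \<open>a\<close>, and
  similarly for the inverse and \<open>b\<close>; this dynamical property characterises rank one isometries.

  Since having no half triangle is an open condition and Brouwer's theorem produces eigenvectors, an
  automorphism is already rank one if it is close to \<open>u f\<^sup>T\<close> and its inverse to \<open>w f'\<^sup>T\<close>, up to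
  scaling, where \<open>u\<close> and \<open>w\<close> bound no half triangle. Sequences in \<open>\<Gamma>\<close> with limit points \<open>a'\<close> and
  \<open>b'\<close> are combined into one of this kind by inserting an element of \<open>\<Gamma>\<close> that is generic in the Zariski
  sense. For a rank one \<open>g\<close> and generic \<open>h \<in> \<Gamma>\<close> the elements \<open>g\<^sup>n h g\<^sup>n\<close> are rank one for large
  \<open>n\<close>; a polynomial vanishing on all of them vanishes at \<open>h\<close>, because its translates satisfy a linear
  recurrence. Conjugating \<open>g\<close> by elements of \<open>\<Gamma>\<close> moves its attracting point close to any point of
  \<open>\<Lambda>\<^sub>\<Gamma>\<close>.
\<close>

section \<open>Rank one matrices and limits of matrices\<close>

text \<open>The obstacle is that nothing is known about the spectrum of elements of \<Gamma>, only
  limits of rescaled matrices. Positivity replaces spectral theory: a matrix mapping the cone into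
  its closure is bounded by its value at one interior point, and together with the half triangle
  condition this determines the limit of g^n without Jordan forms. Inverses must be carried along,
  because closeness to a rank one matrix says little about where the inverse goes. If M_n tends to u
  f^T and N_n to w f'^T, only some limits A and B of the normalised inverses are at hand; but M_n h
  N_n^-1 tends, up to scale, to u (f h B)^T and its inverse to w (f' h^-1 A)^T, so genericity of h
  reduces to two nonvanishing pairings. The product of both limits is a limit of multiples of the
  identity and has rank at most one, so it vanishes; this is what separates the two eigenvalues.
  Genericity relies on irreducibility of the group, obtained by restricting polynomials to a
  rational curve. Elements of \<Gamma> can exchange the cone with its negative, so signs are
  corrected before positivity is used.\<close>

definition outer :: "real^'m \<Rightarrow> real^'n \<Rightarrow> real^'n^'m" where
  "outer u f = (\<chi> i j. u $ i * f $ j)"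

lemma outer_vec [simp]: "outer u f *v x = (f \<bullet> x) *\<^sub>R u"
  by (simp add: vec_eq_iff outer_def matrix_vector_mult_def inner_vec_def sum_distrib_left
      sum_distrib_right mult_ac)

lemma matrix_outer: "A ** outer u f = outer (A *v u) f"
  by (simp add: vec_eq_iff outer_def matrix_vector_mult_def matrix_matrix_mult_def
      sum_distrib_left sum_distrib_right mult_ac)

lemma outer_matrix: "outer u f ** A = outer u (f v* A)"
  by (simp add: vec_eq_iff outer_def vector_matrix_mult_def matrix_matrix_mult_def
      sum_distrib_left sum_distrib_right mult_ac)

lemma outer_outer: "outer u f ** outer v g = (f \<bullet> v) *\<^sub>R outer u g"
  by (simp add: matrix_outer) (simp add: vec_eq_iff outer_def)

lemma outer_scaleR: "outer (c *\<^sub>R u) f = c *\<^sub>R outer u f" "outer u (c *\<^sub>R f) = c *\<^sub>R outer u f"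
  by (simp_all add: vec_eq_iff outer_def)

lemma outer_eq_0_iff [simp]: "outer u f = 0 \<longleftrightarrow> u = 0 \<or> f = 0"
  by (auto simp: vec_eq_iff outer_def)

lemma tendsto_outer [tendsto_intros]:
  "(u \<longlongrightarrow> a) F \<Longrightarrow> (f \<longlongrightarrow> b) F \<Longrightarrow> ((\<lambda>n. outer (u n) (f n)) \<longlongrightarrow> outer a b) F"
  unfolding outer_def by (intro tendsto_vec_lambda tendsto_intros)

lemma scaleR_matrix_vec [simp]: "(c *\<^sub>R A) *v x = c *\<^sub>R (A *v x)" for A :: "real^'m^'n"
  by (simp add: scaleR_matrix_vector_assoc)

lemma matrix_vec_scaleR [simp]: "A *v (c *\<^sub>R x) = c *\<^sub>R (A *v x)" for A :: "real^'m^'n"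
  by (simp add: matrix_vector_mult_scaleR)

lemma scaleR_matrix_mult [simp]: "(c *\<^sub>R A) ** B = c *\<^sub>R (A ** B)" "A ** (c *\<^sub>R B) = c *\<^sub>R (A ** B)"
  for A :: "real^'m^'n"
  by (simp_all add: scalar_matrix_assoc matrix_scalar_ac)

lemma matrix_vec_add: "A *v (x + y) = A *v x + A *v y" for A :: "real^'m^'n"
  by (rule matrix_vector_right_distrib)

lemma tendsto_matrix_mult [tendsto_intros]:
  fixes A :: "'a \<Rightarrow> real^'m^'n" and B :: "'a \<Rightarrow> real^'k^'m"
  assumes "(A \<longlongrightarrow> A0) F" "(B \<longlongrightarrow> B0) F"
  shows "((\<lambda>n. A n ** B n) \<longlongrightarrow> A0 ** B0) F"
  unfolding matrix_matrix_mult_def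
  by (intro tendsto_vec_lambda tendsto_sum tendsto_mult tendsto_vec_nth assms)

lemma tendsto_matrix_vec [tendsto_intros]:
  fixes A :: "'a \<Rightarrow> real^'m^'n"
  assumes "(A \<longlongrightarrow> A0) F" "(x \<longlongrightarrow> x0) F"
  shows "((\<lambda>n. A n *v x n) \<longlongrightarrow> A0 *v x0) F"
  unfolding matrix_vector_mult_def
  by (intro tendsto_vec_lambda tendsto_sum tendsto_mult tendsto_vec_nth assms)

lemma matrix_entry_inner: "(A *v axis j 1) $ i = A $ i $ j" for A :: "real^'n^'m"
  by (simp add: matrix_vector_mult_basis column_def)

text \<open>Reduces bounds on matrices to bounds on columns. The constant is crude; only its
  independence of \<open>A\<close> matters.\<close>

lemma norm_matrix_le:
  fixes A :: "real^'n^'m"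
  assumes "\<And>j. norm (A *v axis j 1) \<le> B"
  shows "norm A \<le> real CARD('m) * (real CARD('n) * B)"
proof -
  have "norm (A $ i) \<le> real CARD('n) * B" for i
  proof -
    have "norm (A $ i) \<le> (\<Sum>j\<in>UNIV. \<bar>A $ i $ j\<bar>)" by (rule norm_le_l1_cart)
    also have "\<dots> \<le> (\<Sum>j\<in>(UNIV::'n set). B)"
    proof (rule sum_mono)
      fix j show "\<bar>A $ i $ j\<bar> \<le> B"
        using component_le_norm_cart[of "A *v axis j 1" i] assms[of j] by (simp add: matrix_entry_inner)
    qed
    finally show ?thesis by simp
  qed
  then have "(\<Sum>i\<in>UNIV. norm (A $ i)) \<le> (\<Sum>i\<in>(UNIV::'m set). real CARD('n) * B)"
    by (intro sum_mono)
  moreover have "norm A \<le> (\<Sum>i\<in>UNIV. norm (A $ i))"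
    unfolding norm_vec_def by (rule L2_set_le_sum) simp
  ultimately show ?thesis by simp
qed

section \<open>Powers of matrices\<close>

primrec mpow :: "real^'n^'n \<Rightarrow> nat \<Rightarrow> real^'n^'n" where
  "mpow A 0 = mat 1"
| "mpow A (Suc k) = A ** mpow A k"

lemma mpow_add: "mpow A (m + k) = mpow A m ** mpow A k"
  by (induction m) (simp_all add: matrix_mul_assoc)

lemma mpow_Suc_right: "mpow A (Suc k) = mpow A k ** A"
  using mpow_add[of A k 1] by simp

lemma mpow_scaleR: "mpow (c *\<^sub>R A) k = c ^ k *\<^sub>R mpow A k"
  by (induction k) simp_all

lemma mpow_eigen: "A *v x = c *\<^sub>R x \<Longrightarrow> mpow A k *v x = c ^ k *\<^sub>R x"
  by (induction k) (simp_all add: matrix_vector_mul_assoc[symmetric] mult_ac)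

lemma mpow_inverse: "A ** B = mat 1 \<Longrightarrow> mpow A k ** mpow B k = mat 1"
proof (induction k)
  case (Suc k)
  have "mpow A (Suc k) ** mpow B (Suc k) = mpow A k ** (A ** B) ** mpow B k"
    by (simp only: mpow_Suc_right[of A] mpow.simps(2)[of B] matrix_mul_assoc)
  with Suc show ?case by simp
qed simp

section \<open>The Zariski topology of the special linear group\<close>

text \<open>The product of two polynomials turns an intersection of principal open sets into a
  principal open set, so these sets form a base and not merely a subbase.\<close>

lemma zariski_SL_basic_open:
  assumes "generate_topology_on {{A \<in> carrier SL. f A \<noteq> 0} | f. real_polynomial_function f} U"
    and "X \<in> U"
  shows "\<exists>f. real_polynomial_function f \<and> X \<in> carrier SL \<and> f X \<noteq> 0 \<and> {A \<in> carrier SL. f A \<noteq> 0} \<subseteq> U"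
  using assms
proof (induction rule: generate_topology_on.induct)
  case (Int U V)
  then obtain f g where "real_polynomial_function f" "f X \<noteq> 0" "{A \<in> carrier SL. f A \<noteq> 0} \<subseteq> U"
    "real_polynomial_function g" "g X \<noteq> 0" "{A \<in> carrier SL. g A \<noteq> 0} \<subseteq> V" "X \<in> carrier SL"
    by blast
  then show ?case
    by (intro exI[of _ "\<lambda>A. f A * g A"] conjI real_polynomial_function.intros(4)) auto
next
  case (UN K)
  then obtain k where k: "k \<in> K" "X \<in> k" by blast
  show ?case using UN.IH[OF k] k(1) by (meson Union_upper subset_trans)
qed blast+

text \<open>Because principal open sets form a base, density only has to be tested on nonvanishing
  loci of single polynomials.\<close>

lemma zariski_dense_iff:
  "zariski_dense S \<longleftrightarrow> S \<subseteq> carrier SL \<and>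
     (\<forall>f. real_polynomial_function f \<longrightarrow> (\<forall>X\<in>S. f X = 0) \<longrightarrow> (\<forall>X\<in>carrier SL. f X = 0))"
    (is "_ \<longleftrightarrow> _ \<and> ?P")
proof -
  have "zariski_SL closure_of S = carrier SL \<longleftrightarrow> ?P" if S: "S \<subseteq> carrier SL"
  proof
    assume cl: "zariski_SL closure_of S = carrier SL"
    show ?P
    proof (intro allI impI ballI, rule ccontr)
      fix f X assume f: "real_polynomial_function f" "\<forall>X\<in>S. f X = 0" "X \<in> carrier SL" "f X \<noteq> 0"
      have op: "openin zariski_SL {A \<in> carrier SL. f A \<noteq> 0}"
        unfolding zariski_SL_def by (rule topology_generated_by_Basis) (use f(1) in blast)
      have "X \<in> zariski_SL closure_of S" using cl f(3) by simp
      then have *: "\<And>T. X \<in> T \<and> openin zariski_SL T \<Longrightarrow> \<exists>y. y \<in> S \<and> y \<in> T"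
        unfolding in_closure_of by blast
      have "\<exists>y. y \<in> S \<and> y \<in> {A \<in> carrier SL. f A \<noteq> 0}"
        by (rule *) (use f(3,4) op in simp)
      with f(2) show False by blast
    qed
  next
    assume P: ?P
    have "carrier SL \<subseteq> zariski_SL closure_of S"
    proof
      fix X :: "real^'a^'a" assume X: "X \<in> carrier SL"
      have "\<exists>y\<in>S. y \<in> U" if U: "openin zariski_SL U" "X \<in> U" for U
      proof -
        obtain f where "real_polynomial_function f" "f X \<noteq> 0" "{A \<in> carrier SL. f A \<noteq> 0} \<subseteq> U"
          using zariski_SL_basic_open[OF openin_topology_generated_by[OF U(1)[unfolded zariski_SL_def]] U(2)]
          by blast
        with P X S show ?thesis by blast
      qed
      then show "X \<in> zariski_SL closure_of S"
        using X by (simp add: in_closure_of topspace_zariski_SL) blast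
    qed
    then show "zariski_SL closure_of S = carrier SL"
      using closure_of_subset_topspace[of zariski_SL S] topspace_zariski_SL by blast
  qed
  then show ?thesis unfolding zariski_dense_def by blast
qed

lemma zariski_denseD:
  assumes "zariski_dense S" "real_polynomial_function f" "X \<in> carrier SL" "f X \<noteq> 0"
  shows "\<exists>Y\<in>S. f Y \<noteq> 0"
  using assms zariski_dense_iff by blast

section \<open>Polynomial functions along curves of matrices\<close>

lemma real_polynomial_finite_zeros:
  fixes p :: "real \<Rightarrow> real"
  assumes "real_polynomial_function p" "p s \<noteq> 0"
  shows "finite {t. p t = 0}"
proof -
  obtain a n where p: "p = (\<lambda>x. \<Sum>i\<le>n. a i * x ^ i)"
    using assms(1) real_polynomial_function_iff_sum by metis
  then have "\<exists>i\<le>n. a i \<noteq> 0" using assms(2) by (metis (no_types, lifting) atMost_iff mult_zero_left sum.neutral)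
  then show ?thesis unfolding p polyfun_finite_roots .
qed

text \<open>Along a curve renormalised to determinant one, the entries of one column are divided by
  the determinant \<open>q\<close>, so a polynomial in the matrix becomes rational in
  \<open>t\<close>. Induction on \<open>f\<close> collects all denominators in one power of
  \<open>q\<close>; zeros of \<open>f\<close> on the curve are then zeros of the polynomial
  \<open>p\<close>.\<close>

lemma real_polynomial_function_clear_denominator:
  fixes f :: "'a::euclidean_space \<Rightarrow> real" and q :: "real \<Rightarrow> real"
  assumes "real_polynomial_function f" "polynomial_function P" "polynomial_function Q"
    "real_polynomial_function q"
  shows "\<exists>N p. real_polynomial_function p \<and>
    (\<forall>t. q t \<noteq> 0 \<longrightarrow> f (P t + inverse (q t) *\<^sub>R Q t) = p t / q t ^ N)"
  using assms(1)
proof (induction)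
  case (linear f)
  have lin: "real_polynomial_function (\<lambda>t. f (P t))" "real_polynomial_function (\<lambda>t. f (Q t))"
    using real_polynomial_function_compose[OF assms(2) real_polynomial_function.intros(1)[OF linear]]
      real_polynomial_function_compose[OF assms(3) real_polynomial_function.intros(1)[OF linear]]
    by (simp_all add: o_def)
  have "real_polynomial_function (\<lambda>t. q t * f (P t) + f (Q t))"
    by (intro real_polynomial_function.intros(3) real_polynomial_function.intros(4) lin assms(4))
  moreover have "f (P t + inverse (q t) *\<^sub>R Q t) = (q t * f (P t) + f (Q t)) / q t ^ 1" if "q t \<noteq> 0" for t
    using that linear by (simp add: linear_simps field_simps)
  ultimately show ?case
    by (intro exI[of _ 1] exI[of _ "\<lambda>t. q t * f (P t) + f (Q t)"]) simp
next
  case (const c)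
  show ?case by (rule exI[of _ 0], rule exI[of _ "\<lambda>_. c"]) (simp add: real_polynomial_function.intros(2))
next
  case (add f g)
  then obtain N p M r where "real_polynomial_function p" "real_polynomial_function r"
    "\<forall>t. q t \<noteq> 0 \<longrightarrow> f (P t + inverse (q t) *\<^sub>R Q t) = p t / q t ^ N"
    "\<forall>t. q t \<noteq> 0 \<longrightarrow> g (P t + inverse (q t) *\<^sub>R Q t) = r t / q t ^ M" by blast
  then show ?case
    by (intro exI[of _ "N + M"] exI[of _ "\<lambda>t. p t * q t ^ M + r t * q t ^ N"] conjI
        real_polynomial_function.intros(3) real_polynomial_function.intros(4) real_polynomial_function_power assms(4))
      (simp_all add: add_divide_distrib power_add)
next
  case (mult f g)
  then obtain N p M r where "real_polynomial_function p" "real_polynomial_function r"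
    "\<forall>t. q t \<noteq> 0 \<longrightarrow> f (P t + inverse (q t) *\<^sub>R Q t) = p t / q t ^ N"
    "\<forall>t. q t \<noteq> 0 \<longrightarrow> g (P t + inverse (q t) *\<^sub>R Q t) = r t / q t ^ M" by blast
  then show ?case
    by (intro exI[of _ "N + M"] exI[of _ "\<lambda>t. p t * r t"] conjI real_polynomial_function.intros(4))
      (simp_all add: power_add)
qed

lemma real_polynomial_function_nth: "real_polynomial_function (\<lambda>A. A $ i $ j)"
  by (intro real_polynomial_function.intros(1) bounded_linear_compose[OF bounded_linear_vec_nth bounded_linear_vec_nth])

lemma real_polynomial_function_det:
  assumes "\<And>i j. real_polynomial_function (\<lambda>t. M t $ i $ j)"
  shows "real_polynomial_function (\<lambda>t. det (M t :: real^'n^'n))"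
  unfolding det_def
  by (intro real_polynomial_function_sum real_polynomial_function.intros(4) real_polynomial_function.intros(2)
      real_polynomial_function_prod assms) (auto intro: finite_permutations)

lemma polynomial_function_matrixI:
  assumes "\<And>i j. real_polynomial_function (\<lambda>t. M t $ i $ j)"
  shows "polynomial_function (M :: _ \<Rightarrow> real^'n^'m)"
  unfolding polynomial_function_iff_Basis_inner
  using assms by (auto simp: Basis_vec_def inner_axis real_polynomial_function_eq[symmetric])

lemma SL_column_scale:
  fixes A :: "real^'n^'n"
  assumes "det A \<noteq> 0"
  shows "det (\<chi> i j. if j = k then inverse (det A) * A $ i $ j else A $ i $ j) = 1"
proof -
  have "det (\<chi> i j. if j = k then inverse (det A) * A $ i $ j else A $ i $ j) =
    det (transpose (\<chi> i j. if j = k then inverse (det A) * A $ i $ j else A $ i $ j))" by simp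
  also have "transpose (\<chi> i j. if j = k then inverse (det A) * A $ i $ j else A $ i $ j) =
    (\<chi> j. if j = k then inverse (det A) *s (transpose A $ j) else transpose A $ j)"
    by (simp add: vec_eq_iff transpose_def)
  also have "det \<dots> = inverse (det A) * det (\<chi> j. if j = k then transpose A $ j else transpose A $ j)"
    by (rule det_row_mul)
  also have "\<dots> = 1" using assms by simp
  finally show ?thesis .
qed

text \<open>Two points are joined by an affine line, renormalised to determinant one by scaling a column.\<close>

lemma SL_irreducible:
  fixes f g :: "real^'n^'n \<Rightarrow> real"
  assumes f: "real_polynomial_function f" and g: "real_polynomial_function g"
    and A: "A \<in> carrier SL" "f A \<noteq> 0" and B: "B \<in> carrier SL" "g B \<noteq> 0"
  shows "\<exists>X\<in>carrier SL. f X \<noteq> 0 \<and> g X \<noteq> 0"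
proof -
  define L where "L t = A + t *\<^sub>R (B - A)" for t :: real
  \<comment> \<open>Any column serves; it absorbs the factor that restores determinant one.\<close>
  define k :: 'n where "k = undefined"
  define P Q :: "real \<Rightarrow> real^'n^'n" where
    "P t = (\<chi> i j. if j = k then 0 else L t $ i $ j)" and
    "Q t = (\<chi> i j. if j = k then L t $ i $ j else 0)" for t
  have L: "real_polynomial_function (\<lambda>t. L t $ i $ j)" for i j
    unfolding L_def vector_add_component vector_scaleR_component real_scaleR_def
    by (intro real_polynomial_function.intros(2-4) real_polynomial_function.intros(1)[OF bounded_linear_ident])
  have P: "polynomial_function P" and Q: "polynomial_function Q"
    by (rule polynomial_function_matrixI; case_tac "j = k";
        simp add: P_def Q_def L real_polynomial_function.intros(2))+
  define q where "q t = det (L t)" for t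
  have q: "real_polynomial_function q" unfolding q_def by (rule real_polynomial_function_det[OF L])
  obtain N p where p: "real_polynomial_function p"
    "\<And>t. q t \<noteq> 0 \<Longrightarrow> f (P t + inverse (q t) *\<^sub>R Q t) = p t / q t ^ N"
    using real_polynomial_function_clear_denominator[OF f P Q q] by blast
  obtain M r where r: "real_polynomial_function r"
    "\<And>t. q t \<noteq> 0 \<Longrightarrow> g (P t + inverse (q t) *\<^sub>R Q t) = r t / q t ^ M"
    using real_polynomial_function_clear_denominator[OF g P Q q] by blast
  have q01: "q 0 = 1" "q 1 = 1" using A(1) B(1) by (simp_all add: q_def L_def SL_def)
  have PQ: "P t + inverse (q t) *\<^sub>R Q t = (\<chi> i j. if j = k then inverse (q t) * L t $ i $ j else L t $ i $ j)"
    for t by (simp add: vec_eq_iff P_def Q_def)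
  have "P 0 + inverse (q 0) *\<^sub>R Q 0 = A" "P 1 + inverse (q 1) *\<^sub>R Q 1 = B"
    by (subst PQ; simp add: q01 L_def vec_eq_iff)+
  \<comment> \<open>The endpoints witness that neither numerator is the zero polynomial, so only
    finitely many parameters are excluded.\<close>
  then have "p 0 \<noteq> 0" "r 1 \<noteq> 0" using p(2)[of 0] r(2)[of 1] A(2) B(2) q01 by auto
  then have "finite ({t. q t = 0} \<union> {t. p t = 0} \<union> {t. r t = 0})"
    using real_polynomial_finite_zeros[OF p(1)] real_polynomial_finite_zeros[OF r(1)]
      real_polynomial_finite_zeros[OF q, of 0] q01 by simp
  then obtain t where "t \<notin> {t. q t = 0} \<union> {t. p t = 0} \<union> {t. r t = 0}"
    using ex_new_if_finite[OF infinite_UNIV_char_0] by meson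
  then have t: "q t \<noteq> 0" "p t \<noteq> 0" "r t \<noteq> 0" by simp_all
  have "P t + inverse (q t) *\<^sub>R Q t \<in> carrier SL"
    unfolding PQ[of t] using SL_column_scale[of "L t" k] t(1) unfolding q_def[of t] by (simp add: SL_def)
  moreover have "f (P t + inverse (q t) *\<^sub>R Q t) \<noteq> 0" "g (P t + inverse (q t) *\<^sub>R Q t) \<noteq> 0"
    using p(2)[OF t(1)] r(2)[OF t(1)] t by simp_all
  ultimately show ?thesis by blast
qed

section \<open>Projective space\<close>

lemma pline_eq_iff:
  assumes "u \<noteq> 0" "v \<noteq> 0"
  shows "pline u = pline v \<longleftrightarrow> (\<exists>c. c \<noteq> 0 \<and> v = c *\<^sub>R u)"
proof
  assume "pline u = pline v"
  then have "span {u} = span {v}" using assms Rep_pline by metis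
  then have "v \<in> span {u}" by (simp add: span_base)
  then obtain c where "v = c *\<^sub>R u" by (auto simp: span_singleton)
  with assms show "\<exists>c. c \<noteq> 0 \<and> v = c *\<^sub>R u" by auto
next
  assume "\<exists>c. c \<noteq> 0 \<and> v = c *\<^sub>R u"
  then obtain c where c: "c \<noteq> 0" "v = c *\<^sub>R u" by blast
  have "span {v} = span {u}"
  proof
    show "span {v} \<subseteq> span {u}" using c by (intro span_minimal) (auto simp: span_base span_scale)
    have "u = inverse c *\<^sub>R v" using c by simp
    then have "u \<in> span {v}" by (metis span_base span_scale singletonI)
    then show "span {u} \<subseteq> span {v}" by (intro span_minimal) auto
  qed
  then show "pline u = pline v" by (simp add: pline_def)
qed

lemma pline_scaleR: "c \<noteq> 0 \<Longrightarrow> v \<noteq> 0 \<Longrightarrow> pline (c *\<^sub>R v) = pline v"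
  by (subst pline_eq_iff) (auto intro!: exI[of _ "inverse c"])

lemma pline_cases: obtains v where "v \<noteq> 0" "p = pline v"
proof -
  have "subspace (Rep_proj p)" "dim (Rep_proj p) = 1" using Rep_proj[of p] by auto
  moreover obtain B where "B \<subseteq> Rep_proj p" "independent B" "Rep_proj p \<subseteq> span B" "card B = dim (Rep_proj p)"
    using basis_exists by blast
  ultimately obtain v where v: "B = {v}" "v \<in> Rep_proj p" "Rep_proj p \<subseteq> span {v}" "independent {v}"
    by (metis card_1_singletonE insert_subset)
  have "v \<noteq> 0" using v(4) by auto
  moreover have "Rep_proj p = span {v}"
    using v \<open>subspace (Rep_proj p)\<close> by (meson empty_subsetI insert_subset span_minimal subset_antisym)
  then have "p = pline v" unfolding pline_def by (metis Rep_proj_inverse)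
  ultimately show ?thesis by (rule that)
qed

lemma Rep_pline_iff: "v \<noteq> 0 \<Longrightarrow> x \<in> Rep_proj (pline v) \<longleftrightarrow> (\<exists>c. x = c *\<^sub>R v)"
  by (auto simp: Rep_pline span_singleton)

lemma pline_in_proj_sub: "subspace V \<Longrightarrow> v \<noteq> 0 \<Longrightarrow> pline v \<in> proj_sub V \<longleftrightarrow> v \<in> V"
proof -
  assume "subspace V" "v \<noteq> 0"
  then have "span {v} \<subseteq> V \<longleftrightarrow> v \<in> V"
    using span_minimal[of "{v}" V] span_base[of v "{v}"] by auto
  then show ?thesis using \<open>v \<noteq> 0\<close> by (simp add: proj_sub_def Rep_pline)
qed

lemma tendsto_pline:
  assumes "(v \<longlongrightarrow> w) F" "w \<noteq> 0"
  shows "((\<lambda>n. pline (v n)) \<longlongrightarrow> pline w) F"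
proof (rule topological_tendstoI)
  fix U :: "'b proj set" assume "open U" "pline w \<in> U"
  then have "open {v. v \<noteq> 0 \<and> pline v \<in> U}" "w \<in> {v. v \<noteq> 0 \<and> pline v \<in> U}"
    using assms(2) by (simp_all add: open_proj_def)
  from topological_tendstoD[OF assms(1) this] show "eventually (\<lambda>n. pline (v n) \<in> U) F"
    by (rule eventually_mono) simp
qed

text \<open>The cone spanned by \<open>V\<close> without the origin is a union of dilates of
  \<open>V\<close>, so \<open>pline\<close> is an open map.\<close>

lemma open_pline_image:
  assumes "open V" "0 \<notin> V"
  shows "open (pline ` V)"
proof -
  have "{v. v \<noteq> 0 \<and> pline v \<in> pline ` V} = (\<Union>c\<in>-{0}. (*\<^sub>R) c ` V)" (is "?L = ?R")
  proof (rule Set.set_eqI, rule iffI)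
    fix v assume "v \<in> ?L"
    then obtain w where "w \<in> V" "v \<noteq> 0" "pline w = pline v" by force
    moreover from this have "w \<noteq> 0" using assms(2) by auto
    ultimately obtain c where "c \<noteq> 0" "v = c *\<^sub>R w" using pline_eq_iff by blast
    with \<open>w \<in> V\<close> show "v \<in> ?R" by blast
  next
    fix v assume "v \<in> ?R"
    then obtain c w where "c \<noteq> 0" "w \<in> V" "v = c *\<^sub>R w" by blast
    moreover from this have "w \<noteq> 0" using assms(2) by auto
    ultimately show "v \<in> ?L" by (simp add: pline_scaleR)
  qed
  moreover have "open ?R" using assms(1) by (intro open_UN ballI open_scaling) auto
  ultimately show ?thesis by (simp add: open_proj_def)
qed

text \<open>Distinct points are separated by the function \<open>pline x \<mapsto> cos\<^sup>2\<close> of the angle between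
  \<open>x\<close> and a representative \<open>u\<close> of one of them.\<close>

instance proj :: (finite) t2_space
proof
  fix p q :: "'a proj" assume "p \<noteq> q"
  obtain u where u: "u \<noteq> 0" "p = pline u" by (rule pline_cases)
  obtain v where v: "v \<noteq> 0" "q = pline v" by (rule pline_cases)
  define h :: "real^'a \<Rightarrow> real" where "h x = (u \<bullet> x)\<^sup>2 / (x \<bullet> x)" for x
  have h: "h (c *\<^sub>R x) = h x" if "c \<noteq> 0" for c x
    using that by (simp add: h_def power2_eq_square)
  have cont: "continuous_on (-{0}) h" unfolding h_def by (intro continuous_intros) auto
  have op: "open {x. x \<noteq> 0 \<and> h x \<in> S}" if "open S" for S
  proof -
    have "open (- {0} \<inter> h -` S)" by (rule continuous_open_preimage[OF cont _ that]) auto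
    moreover have "- {0} \<inter> h -` S = {x. x \<noteq> 0 \<and> h x \<in> S}" by auto
    ultimately show ?thesis by simp
  qed
  have "h v < h u"
  proof -
    have "\<bar>u \<bullet> v\<bar> \<noteq> norm u * norm v"
    proof
      assume "\<bar>u \<bullet> v\<bar> = norm u * norm v"
      then consider "norm u *\<^sub>R v = norm v *\<^sub>R u" | "norm u *\<^sub>R v = - norm v *\<^sub>R u"
        using norm_cauchy_schwarz_abs_eq by blast
      then have "\<exists>c. c \<noteq> 0 \<and> v = c *\<^sub>R u"
      proof cases
        case 1
        then have "v = (norm v / norm u) *\<^sub>R u" using u(1)
          by (metis (no_types) divide_inverse_commute norm_eq_zero scaleR_one scaleR_scaleR left_inverse)
        then show ?thesis using u(1) v(1) by (metis divide_eq_0_iff norm_eq_zero)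
      next
        case 2
        then have "v = (- norm v / norm u) *\<^sub>R u" using u(1)
          by (metis (no_types) divide_inverse_commute norm_eq_zero scaleR_one scaleR_scaleR left_inverse)
        then show ?thesis using u(1) v(1) by (metis divide_eq_0_iff neg_equal_0_iff_equal norm_eq_zero)
      qed
      then have "p = q" using u v pline_eq_iff by metis
      with \<open>p \<noteq> q\<close> show False ..
    qed
    then have "\<bar>u \<bullet> v\<bar> < norm u * norm v" using Cauchy_Schwarz_ineq2[of u v] by simp
    then have "\<bar>u \<bullet> v\<bar>\<^sup>2 < (norm u * norm v)\<^sup>2" by (intro power_strict_mono) auto
    then have "(u \<bullet> v)\<^sup>2 < (u \<bullet> u) * (v \<bullet> v)" by (simp add: power_mult_distrib power2_norm_eq_inner)
    then show ?thesis using u(1) v(1) by (simp add: h_def power2_eq_square divide_less_eq)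
  qed
  then obtain m where m: "h v < m" "m < h u" using dense by blast
  define U where "U = pline ` {x. x \<noteq> 0 \<and> h x \<in> {m<..}}"
  define V where "V = pline ` {x. x \<noteq> 0 \<and> h x \<in> {..<m}}"
  have "open U" "open V" unfolding U_def V_def by (intro open_pline_image op; simp)+
  moreover have "p \<in> U" "q \<in> V" using u v m by (auto simp: U_def V_def)
  moreover have "U \<inter> V = {}"
  proof (rule ccontr)
    assume "U \<inter> V \<noteq> {}"
    then obtain x y where "x \<noteq> 0" "y \<noteq> 0" "pline x = pline y" "h x > m" "h y < m"
      unfolding U_def V_def by auto
    moreover from this obtain c where "c \<noteq> 0" "y = c *\<^sub>R x" using pline_eq_iff by blast
    ultimately show False using h by auto
  qed
  ultimately show "\<exists>U V. open U \<and> open V \<and> p \<in> U \<and> q \<in> V \<and> U \<inter> V = {}" by blast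
qed

lemma chart_rep_pline:
  assumes "e \<bullet> v \<noteq> 0"
  shows "chart_rep e (pline v) = inverse (e \<bullet> v) *\<^sub>R v"
proof -
  have "v \<noteq> 0" using assms by auto
  show ?thesis
    unfolding chart_rep_def
  proof (rule the_equality)
    show "inverse (e \<bullet> v) *\<^sub>R v \<in> Rep_proj (pline v) \<and> e \<bullet> inverse (e \<bullet> v) *\<^sub>R v = 1"
      using assms \<open>v \<noteq> 0\<close> by (auto simp: Rep_pline_iff)
    fix w assume "w \<in> Rep_proj (pline v) \<and> e \<bullet> w = 1"
    moreover from this obtain c where "w = c *\<^sub>R v" using \<open>v \<noteq> 0\<close> by (auto simp: Rep_pline_iff)
    ultimately have "c * (e \<bullet> v) = 1" "w = c *\<^sub>R v" by auto
    then show "w = inverse (e \<bullet> v) *\<^sub>R v" using assms by (simp add: field_simps)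
  qed
qed

lemma pline_in_affine_chart: "v \<noteq> 0 \<Longrightarrow> pline v \<in> affine_chart e \<longleftrightarrow> e \<bullet> v \<noteq> 0"
  unfolding affine_chart_def
  by (auto simp: Rep_pline_iff intro!: bexI[of _ v] exI[of _ 1])

section \<open>Sharp convex cones\<close>

text \<open>Axiomatises one of the two cones over a properly convex domain. The last assumption
  bounds the slices of constant \<open>e\<close> uniformly; it passes to the closure, where it
  excludes lines and makes the slice of height one compact.\<close>

locale sharp_cone =
  fixes e :: "real^'n" and C :: "(real^'n) set" and R :: real
  assumes open_C: "open C" and ne: "C \<noteq> {}"
    and add: "x \<in> C \<Longrightarrow> y \<in> C \<Longrightarrow> x + y \<in> C"
    and scale: "x \<in> C \<Longrightarrow> 0 < t \<Longrightarrow> t *\<^sub>R x \<in> C"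
    and pos: "x \<in> C \<Longrightarrow> 0 < e \<bullet> x"
    and bound: "x \<in> C \<Longrightarrow> norm x \<le> R * (e \<bullet> x)"
begin

abbreviation K where "K \<equiv> closure C"

lemma convex_C: "convex C"
proof (rule convexI)
  fix x y u v assume "x \<in> C" "y \<in> C" "0 \<le> u" "0 \<le> v" "u + v = (1::real)"
  then show "u *\<^sub>R x + v *\<^sub>R y \<in> C"
    by (cases "u = 0"; cases "v = 0") (auto intro!: add[OF scale scale])
qed

lemma R_pos: "R > 0"
proof -
  obtain x where x: "x \<in> C" using ne by blast
  then have "e \<bullet> x > 0" "norm x > 0" "norm x \<le> R * (e \<bullet> x)" using pos[of x] bound by auto
  then show ?thesis by (metis less_le_trans zero_less_mult_pos2)
qed

lemma K_lim: "x \<in> K \<longleftrightarrow> (\<exists>s. (\<forall>n. s n \<in> C) \<and> s \<longlonglongrightarrow> x)"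
  by (rule closure_sequential)

lemma C_K: "x \<in> C \<Longrightarrow> x \<in> K" using closure_subset by blast

lemma K_closed: "closed K" by simp

lemma K_limI: "(\<And>n. s n \<in> K) \<Longrightarrow> s \<longlonglongrightarrow> x \<Longrightarrow> x \<in> K"
  using K_closed closed_sequential_limits by blast

lemma K_bound: "x \<in> K \<Longrightarrow> norm x \<le> R * (e \<bullet> x)"
proof -
  assume "x \<in> K"
  then obtain s where s: "\<forall>n. s n \<in> C" "s \<longlonglongrightarrow> x" by (auto simp: K_lim)
  show ?thesis
    by (rule LIMSEQ_le[of "\<lambda>n. norm (s n)" _ "\<lambda>n. R * (e \<bullet> s n)"]; intro tendsto_intros exI s(2))
      (use s bound in auto)
qed

lemma K_pos: "x \<in> K \<Longrightarrow> x \<noteq> 0 \<Longrightarrow> 0 < e \<bullet> x"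
proof -
  assume "x \<in> K" "x \<noteq> 0"
  then have "0 < R * (e \<bullet> x)" using K_bound[of x] by (meson less_le_trans zero_less_norm_iff)
  then show ?thesis using R_pos by (simp add: zero_less_mult_iff)
qed

lemma K_add: "x \<in> K \<Longrightarrow> y \<in> K \<Longrightarrow> x + y \<in> K"
proof -
  assume "x \<in> K" "y \<in> K"
  then obtain s t where s: "\<forall>n. s n \<in> C" "s \<longlonglongrightarrow> x" and t: "\<forall>n. t n \<in> C" "t \<longlonglongrightarrow> y"
    unfolding K_lim by blast
  have "(\<lambda>n. s n + t n) \<longlonglongrightarrow> x + y" by (rule tendsto_add[OF s(2) t(2)])
  moreover have "\<forall>n. s n + t n \<in> C" using s t add by simp
  ultimately show ?thesis unfolding K_lim by (intro exI conjI)
qed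

lemma K_scale: "x \<in> K \<Longrightarrow> 0 \<le> t \<Longrightarrow> t *\<^sub>R x \<in> K"
proof -
  assume x: "x \<in> K" "0 \<le> t"
  then obtain s where s: "\<forall>n. s n \<in> C" "s \<longlonglongrightarrow> x" by (auto simp: K_lim)
  have "(\<lambda>n. (t + inverse (real (Suc n))) *\<^sub>R s n) \<longlonglongrightarrow> (t + 0) *\<^sub>R x"
    by (intro tendsto_intros LIMSEQ_inverse_real_of_nat s)
  moreover have "(t + inverse (real (Suc n))) *\<^sub>R s n \<in> C" for n
    using s x by (intro scale) (auto intro!: add_nonneg_pos)
  ultimately show ?thesis unfolding K_lim by (metis (no_types, lifting) add_0_right)
qed

text \<open>An element of the closure differs from an element of \<open>C\<close> by an error small
  enough to be absorbed in a ball around the interior point \<open>x\<close>.\<close>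

lemma C_add_K: "x \<in> C \<Longrightarrow> y \<in> K \<Longrightarrow> x + y \<in> C"
proof -
  assume x: "x \<in> C" and y: "y \<in> K"
  obtain r where r: "r > 0" "ball x r \<subseteq> C" using open_C x open_contains_ball by blast
  obtain z where z: "z \<in> C" "dist z y < r" using y r(1) closure_approachable by blast
  have "x + (y - z) \<in> ball x r" using z(2) by (simp add: dist_norm norm_minus_commute)
  then have "x + (y - z) + z \<in> C" using r(2) z(1) by (intro add[of "x + (y - z)" z]) auto
  then show ?thesis by simp
qed

lemma K_add_C: "x \<in> K \<Longrightarrow> y \<in> C \<Longrightarrow> x + y \<in> C"
  using C_add_K[of y x] by (simp add: add.commute)

lemma zero_notin_C: "0 \<notin> C" using pos[of 0] by auto

lemma K_antisym: "x \<in> K \<Longrightarrow> - x \<in> K \<Longrightarrow> x = 0"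
  using K_pos[of x] K_pos[of "-x"] by force

lemma compact_slice: "compact {x \<in> K. e \<bullet> x = 1}"
proof -
  have "{x \<in> K. e \<bullet> x = 1} = K \<inter> {x. e \<bullet> x = 1}" by auto
  moreover have "closed (K \<inter> {x. e \<bullet> x = 1})" by (intro closed_Int closed_hyperplane) simp
  moreover have "bounded {x \<in> K. e \<bullet> x = 1}"
    unfolding bounded_iff using K_bound by force
  ultimately show ?thesis using compact_eq_bounded_closed by metis
qed

lemma C_scale_iff: "0 < t \<Longrightarrow> t *\<^sub>R x \<in> C \<longleftrightarrow> x \<in> C"
  using scale[of "t *\<^sub>R x" "inverse t"] scale[of x t] by auto

text \<open>Subtracting \<open>min s t\<close> copies of \<open>a + z\<close> leaves an element of
  the closed cone. Hence the single point \<open>a + z\<close> decides whether the whole open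
  segment between the two rays is interior.\<close>

lemma C_pos_comb: "a + z \<in> C \<Longrightarrow> a \<in> K \<Longrightarrow> z \<in> K \<Longrightarrow> 0 < s \<Longrightarrow> 0 < t \<Longrightarrow> s *\<^sub>R a + t *\<^sub>R z \<in> C"
proof -
  assume az: "a + z \<in> C" "a \<in> K" "z \<in> K" and st: "0 < s" "0 < t"
  define m where "m = min s t"
  have "m *\<^sub>R (a + z) + ((s - m) *\<^sub>R a + (t - m) *\<^sub>R z) \<in> C"
    using az st by (intro C_add_K[OF scale] K_add[OF K_scale K_scale]) (auto simp: m_def)
  then show ?thesis by (simp add: algebra_simps)
qed

text \<open>The converse direction: elements of the closed cone are added until
  \<open>max s t\<close> copies of \<open>a + z\<close> are reached.\<close>

lemma C_comb_imp: "s *\<^sub>R a + t *\<^sub>R z \<in> C \<Longrightarrow> a \<in> K \<Longrightarrow> z \<in> K \<Longrightarrow> 0 \<le> s \<Longrightarrow> 0 \<le> t \<Longrightarrow> a + z \<in> C"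
proof -
  assume az: "s *\<^sub>R a + t *\<^sub>R z \<in> C" "a \<in> K" "z \<in> K" and st: "0 \<le> s" "0 \<le> t"
  define m where "m = max s t"
  have "m > 0" using az(1) st zero_notin_C by (auto simp: m_def less_max_iff_disj order.order_iff_strict)
  have "(s *\<^sub>R a + t *\<^sub>R z) + ((m - s) *\<^sub>R a + (m - t) *\<^sub>R z) \<in> C"
    by (rule C_add_K[OF az(1) K_add[OF K_scale[OF az(2)] K_scale[OF az(3)]]]) (simp_all add: m_def)
  then have "m *\<^sub>R (a + z) \<in> C" by (simp add: algebra_simps)
  then show ?thesis using \<open>m > 0\<close> C_scale_iff by blast
qed

text \<open>An interior point can be moved a little against the direction of \<open>f\<close>
  without leaving \<open>C\<close>, which makes the value strictly smaller.\<close>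

lemma linear_functional_pos:
  assumes "\<And>x. x \<in> C \<Longrightarrow> 0 \<le> f \<bullet> x" "f \<noteq> 0" "x \<in> C"
  shows "0 < f \<bullet> x"
proof -
  obtain r where r: "r > 0" "cball x r \<subseteq> C" using open_C assms(3) open_contains_cball by blast
  define y where "y = x - (r / norm f) *\<^sub>R f"
  have "y \<in> C" using r assms(2) by (intro subsetD[OF r(2)]) (simp add: y_def dist_norm)
  then have "0 \<le> f \<bullet> x - r / norm f * (f \<bullet> f)" using assms(1)[of y] by (simp add: y_def inner_diff_right)
  moreover have "r / norm f * (f \<bullet> f) > 0" using r assms(2) by simp
  ultimately show ?thesis by linarith
qed

lemma K_functional_nonneg:
  assumes "\<And>x. x \<in> C \<Longrightarrow> 0 \<le> f \<bullet> x" "x \<in> K"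
  shows "0 \<le> f \<bullet> x"
proof -
  obtain s where "\<forall>n. s n \<in> C" "s \<longlonglongrightarrow> x" using assms(2) by (auto simp: K_lim)
  then show ?thesis
    by (intro LIMSEQ_le_const[OF tendsto_inner[OF tendsto_const]]) (use assms(1) in auto)
qed

end

section \<open>The cone over a properly convex domain\<close>

text \<open>The same choice as in \<open>dom_rep\<close>, so that \<open>dom_rep\<close> is the
  normalisation to the slice on which this functional equals one.\<close>

definition chart_vec :: "'n::finite proj set \<Rightarrow> real^'n" where
  "chart_vec \<Omega> = (SOME u. convex_chart \<Omega> u)"

text \<open>The positivity condition picks one of the two opposite cones over the domain.\<close>

definition dcone :: "'n::finite proj set \<Rightarrow> (real^'n) set" where
  "dcone \<Omega> = {v. 0 < chart_vec \<Omega> \<bullet> v \<and> pline v \<in> \<Omega>}"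

locale convex_domain =
  fixes \<Omega> :: "'n::finite proj set"
  assumes pcd: "properly_convex_domain \<Omega>"
begin

abbreviation e where "e \<equiv> chart_vec \<Omega>"
abbreviation C where "C \<equiv> dcone \<Omega>"

lemma chart: "convex_chart \<Omega> e" "open \<Omega>" "\<Omega> \<noteq> {}" "\<And>p. p \<in> \<Omega> \<Longrightarrow> p \<in> affine_chart e"
proof -
  show "convex_chart \<Omega> e" "open \<Omega>" "\<Omega> \<noteq> {}"
    using pcd someI_ex[of "convex_chart \<Omega>"] by (auto simp: properly_convex_domain_def chart_vec_def)
  then show "p \<in> affine_chart e" if "p \<in> \<Omega>" for p
    using that closure_subset by (auto simp: convex_chart_def)
qed

lemma chart_rep_C: "v \<in> C \<Longrightarrow> inverse (e \<bullet> v) *\<^sub>R v \<in> chart_rep e ` \<Omega>"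
  using chart_rep_pline[of e v] by (auto simp: dcone_def intro!: image_eqI[of _ _ "pline v"])

lemma chart_rep_C_conv:
  assumes "x \<in> chart_rep e ` \<Omega>" shows "x \<in> C"
proof -
  obtain p where p: "p \<in> \<Omega>" "x = chart_rep e p" using assms by blast
  obtain v where v: "v \<noteq> 0" "p = pline v" by (rule pline_cases)
  then have "e \<bullet> v \<noteq> 0" using p chart(4) pline_in_affine_chart by blast
  then have "x = inverse (e \<bullet> v) *\<^sub>R v" using p v chart_rep_pline by simp
  then show ?thesis using v p \<open>e \<bullet> v \<noteq> 0\<close> by (simp add: dcone_def pline_scaleR)
qed

lemma C_lift:
  assumes "v \<noteq> 0" "pline v \<in> \<Omega>" shows "v \<in> C \<or> - v \<in> C"
proof -
  have "e \<bullet> v \<noteq> 0" using assms chart(4) pline_in_affine_chart by blast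
  then show ?thesis using assms pline_scaleR[of "-1" v] by (auto simp: dcone_def)
qed

text \<open>Boundedness of the domain in its chart supplies \<open>R\<close>; convexity there gives
  closure under addition once both summands are normalised to height one.\<close>

lemma ex_sharp_cone: "\<exists>R. sharp_cone e C R"
proof -
  have bd: "bounded (chart_rep e ` \<Omega>)" and cv: "convex (chart_rep e ` \<Omega>)"
    using chart(1) by (auto simp: convex_chart_def)
  obtain R where R: "\<And>x. x \<in> chart_rep e ` \<Omega> \<Longrightarrow> norm x \<le> R" using bd bounded_iff by metis
  show ?thesis
  proof (rule exI[of _ R], unfold_locales)
    have "C = {v. v \<noteq> 0 \<and> pline v \<in> \<Omega>} \<inter> {v. 0 < e \<bullet> v}" by (auto simp: dcone_def)
    then show "open C" using chart(2) open_halfspace_gt[of 0 e] by (simp add: open_proj_def open_Int)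
    show "C \<noteq> {}" using chart(3) chart_rep_C_conv by blast
    show "t *\<^sub>R x \<in> C" if "x \<in> C" "0 < t" for x t
      using that pline_scaleR[of t x] by (cases "x = 0") (auto simp: dcone_def)
    then show "x + y \<in> C" if "x \<in> C" "y \<in> C" for x y
    proof -
      have p: "0 < e \<bullet> x" "0 < e \<bullet> y" using that by (auto simp: dcone_def)
      define s where "s = e \<bullet> x + e \<bullet> y"
      have "s > 0" using p by (simp add: s_def)
      \<comment> \<open>The weights are the shares of the total height, so the normalised vectors
        recombine to a multiple of \<open>x + y\<close>.\<close>
      have "(e \<bullet> x / s) *\<^sub>R (inverse (e \<bullet> x) *\<^sub>R x) + (e \<bullet> y / s) *\<^sub>R (inverse (e \<bullet> y) *\<^sub>R y) \<in> chart_rep e ` \<Omega>"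
        using p \<open>s > 0\<close> that
        by (intro convexD[OF cv] chart_rep_C) (auto simp: s_def add_divide_distrib[symmetric])
      also have "(e \<bullet> x / s) *\<^sub>R (inverse (e \<bullet> x) *\<^sub>R x) + (e \<bullet> y / s) *\<^sub>R (inverse (e \<bullet> y) *\<^sub>R y) =
          inverse s *\<^sub>R (x + y)"
        using p by (simp add: field_simps scaleR_add_right)
      finally have "inverse s *\<^sub>R (x + y) \<in> C" by (rule chart_rep_C_conv)
      then have "s *\<^sub>R (inverse s *\<^sub>R (x + y)) \<in> C"
        using \<open>\<And>x t. x \<in> C \<Longrightarrow> 0 < t \<Longrightarrow> t *\<^sub>R x \<in> C\<close> \<open>s > 0\<close> by blast
      then show ?thesis using \<open>s > 0\<close> by simp
    qed
    show "0 < e \<bullet> x" if "x \<in> C" for x using that by (simp add: dcone_def)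
    show "norm x \<le> R * (e \<bullet> x)" if "x \<in> C" for x
    proof -
      have "norm (inverse (e \<bullet> x) *\<^sub>R x) \<le> R" "0 < e \<bullet> x"
        using R[OF chart_rep_C[OF that]] that by (auto simp: dcone_def)
      moreover from this(2) have "norm (inverse (e \<bullet> x) *\<^sub>R x) = norm x / (e \<bullet> x)"
        by (simp add: divide_inverse)
      ultimately show ?thesis by (simp add: pos_divide_le_eq)
    qed
  qed
qed

definition bnd where "bnd = (SOME R. sharp_cone e C R)"

end

sublocale convex_domain \<subseteq> sharp_cone "chart_vec \<Omega>" "dcone \<Omega>" bnd
  using someI_ex[OF ex_sharp_cone] by (simp add: bnd_def)

context convex_domain begin

lemma pline_in_iff: "v \<in> K \<Longrightarrow> v \<noteq> 0 \<Longrightarrow> pline v \<in> \<Omega> \<longleftrightarrow> v \<in> C"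
  using K_pos[of v] unfolding dcone_def by simp

lemma closure_dom: "closure \<Omega> = pline ` (K - {0})"
proof
  show "pline ` (K - {0}) \<subseteq> closure \<Omega>"
  proof
    fix p assume "p \<in> pline ` (K - {0})"
    then obtain v where v: "v \<in> K" "v \<noteq> 0" "p = pline v" by blast
    then obtain s where s: "\<forall>n. s n \<in> C" "s \<longlonglongrightarrow> v" by (auto simp: K_lim)
    have "(\<lambda>n. pline (s n)) \<longlonglongrightarrow> p" using tendsto_pline s(2) v by blast
    moreover have "pline (s n) \<in> closure \<Omega>" for n
      using s closure_subset by (auto simp: dcone_def)
    ultimately show "p \<in> closure \<Omega>"
      by (intro Lim_in_closed_set[of "closure \<Omega>" "\<lambda>n. pline (s n)" sequentially p])
        (simp_all add: always_eventually)
  qed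
  show "closure \<Omega> \<subseteq> pline ` (K - {0})"
  proof
    fix p assume p: "p \<in> closure \<Omega>"
    obtain w where w: "w \<noteq> 0" "p = pline w" by (rule pline_cases)
    have "p \<in> affine_chart e" using p chart(1) by (auto simp: convex_chart_def)
    then have ew: "e \<bullet> w \<noteq> 0" using w pline_in_affine_chart by blast
    define v where "v = inverse (e \<bullet> w) *\<^sub>R w"
    have v: "e \<bullet> v = 1" "p = pline v" using ew w pline_scaleR[of "inverse (e \<bullet> w)" w] by (simp_all add: v_def)
    have "\<exists>y\<in>C. dist y v < d" if "d > 0" for d
    proof -
      \<comment> \<open>Restricting the ball to the half space makes the representative found over
        the domain lie in \<open>C\<close> and not in its negative.\<close>
      define U where "U = ball v d \<inter> {x. 0 < e \<bullet> x}"
      have "open (pline ` U)"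
        by (rule open_pline_image) (auto simp: U_def open_halfspace_gt)
      moreover have "p \<in> pline ` U" using v that by (auto simp: U_def)
      ultimately obtain q where "q \<in> pline ` U" "q \<in> \<Omega>" using p closure_iff_nhds_not_empty
        by (metis disjoint_iff open_Int_closure_eq_empty)
      then show ?thesis by (auto simp: U_def dcone_def dist_commute)
    qed
    then have "v \<in> K" by (simp add: closure_approachable)
    then show "p \<in> pline ` (K - {0})" using v by (auto intro!: image_eqI[of _ _ v])
  qed
qed

lemma frontier_iff: "p \<in> frontier \<Omega> \<longleftrightarrow> (\<exists>v. v \<in> K \<and> v \<noteq> 0 \<and> v \<notin> C \<and> p = pline v)"
  using chart(2) by (auto simp: frontier_def interior_open closure_dom pline_in_iff)

lemma pline_frontier_iff: "v \<in> K \<Longrightarrow> v \<noteq> 0 \<Longrightarrow> pline v \<in> frontier \<Omega> \<longleftrightarrow> v \<notin> C"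
  using chart(2) by (auto simp: frontier_def interior_open closure_dom pline_in_iff)

lemma dom_rep_pline: "v \<in> K \<Longrightarrow> v \<noteq> 0 \<Longrightarrow> dom_rep \<Omega> (pline v) = inverse (e \<bullet> v) *\<^sub>R v"
  using K_pos[of v] chart_rep_pline[of e v] unfolding dom_rep_def chart_vec_def by simp

lemma pline_K_inj:
  assumes "u \<in> K" "u \<noteq> 0" "v \<in> K" "v \<noteq> 0" "pline u = pline v"
  obtains c where "c > 0" "v = c *\<^sub>R u"
proof -
  obtain c where c: "c \<noteq> 0" "v = c *\<^sub>R u" using assms pline_eq_iff by blast
  then have "c * (e \<bullet> u) > 0" using K_pos[of v] assms by simp
  then have "c > 0" using K_pos[of u] assms by (simp add: zero_less_mult_iff)
  with c that show ?thesis by blast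
qed

lemma proj_seg_slice:
  "u \<in> K \<Longrightarrow> e \<bullet> u = 1 \<Longrightarrow> v \<in> K \<Longrightarrow> e \<bullet> v = 1 \<Longrightarrow>
     proj_seg \<Omega> (pline u) (pline v) = pline ` closed_segment u v"
  unfolding proj_seg_def by (cases "u = 0"; cases "v = 0"; simp add: dom_rep_pline)

text \<open>Segments are defined through representatives of height one, a normalisation that
  automorphisms do not respect. Allowing all nonnegative weights removes it.\<close>

lemma proj_seg_pline:
  assumes "u \<in> K" "u \<noteq> 0" "v \<in> K" "v \<noteq> 0"
  shows "proj_seg \<Omega> (pline u) (pline v) = {pline (s *\<^sub>R u + t *\<^sub>R v) | s t. 0 \<le> s \<and> 0 \<le> t \<and> 0 < s + t}"
    (is "?L = ?R")
proof -
  have p: "e \<bullet> u > 0" "e \<bullet> v > 0" using assms K_pos by auto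
  have L: "?L = pline ` closed_segment (inverse (e \<bullet> u) *\<^sub>R u) (inverse (e \<bullet> v) *\<^sub>R v)"
    using assms by (simp add: proj_seg_def dom_rep_pline)
  show ?thesis
  proof (rule Set.set_eqI, rule iffI)
    fix x assume "x \<in> ?L"
    then obtain r where r: "0 \<le> r" "r \<le> 1"
      "x = pline ((1 - r) *\<^sub>R (inverse (e \<bullet> u) *\<^sub>R u) + r *\<^sub>R (inverse (e \<bullet> v) *\<^sub>R v))"
      unfolding L closed_segment_def by blast
    have "0 < (1 - r) * inverse (e \<bullet> u) + r * inverse (e \<bullet> v)"
      using r p by (cases "r = 0") (auto intro!: add_nonneg_pos mult_pos_pos)
    moreover have "0 \<le> (1 - r) * inverse (e \<bullet> u)" "0 \<le> r * inverse (e \<bullet> v)" using r p by simp_all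
    moreover have "x = pline (((1 - r) * inverse (e \<bullet> u)) *\<^sub>R u + (r * inverse (e \<bullet> v)) *\<^sub>R v)"
      using r(3) by simp
    ultimately show "x \<in> ?R" by blast
  next
    fix x assume "x \<in> ?R"
    then obtain s t where st: "0 \<le> s" "0 \<le> t" "0 < s + t" "x = pline (s *\<^sub>R u + t *\<^sub>R v)" by blast
    define m where "m = s * (e \<bullet> u) + t * (e \<bullet> v)"
    have m: "m > 0" unfolding m_def using st p
      by (metis add_nonneg_pos add_pos_nonneg add.right_neutral less_eq_real_def mult_nonneg_nonneg mult_pos_pos)
    \<comment> \<open>The affine parameter is the share of \<open>v\<close> in the total height
      \<open>m\<close>.\<close>
    define r where "r = t * (e \<bullet> v) / m"
    have r: "0 \<le> r" "r \<le> 1" "1 - r = s * (e \<bullet> u) / m"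
      using st p m by (auto simp: r_def m_def field_simps)
    have eq: "(1 - r) *\<^sub>R (inverse (e \<bullet> u) *\<^sub>R u) + r *\<^sub>R (inverse (e \<bullet> v) *\<^sub>R v) =
        inverse m *\<^sub>R (s *\<^sub>R u + t *\<^sub>R v)"
      unfolding r(3) using p by (simp add: r_def scaleR_add_right field_simps)
    have "e \<bullet> (s *\<^sub>R u + t *\<^sub>R v) = m" by (simp add: inner_add_right m_def)
    then have "s *\<^sub>R u + t *\<^sub>R v \<noteq> 0" using m by auto
    then have "x = pline ((1 - r) *\<^sub>R (inverse (e \<bullet> u) *\<^sub>R u) + r *\<^sub>R (inverse (e \<bullet> v) *\<^sub>R v))"
      unfolding eq using st m by (simp add: pline_scaleR)
    then show "x \<in> ?L" unfolding L closed_segment_def using r by blast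
  qed
qed

lemma open_proj_seg_pline:
  assumes "u \<in> K" "u \<noteq> 0" "v \<in> K" "v \<noteq> 0" "pline u \<noteq> pline v"
  shows "open_proj_seg \<Omega> (pline u) (pline v) = {pline (s *\<^sub>R u + t *\<^sub>R v) | s t. 0 < s \<and> 0 < t}"
    (is "?L = ?R")
proof (rule Set.set_eqI, rule iffI)
  fix x assume x: "x \<in> ?L"
  then obtain s t where st: "0 \<le> s" "0 \<le> t" "0 < s + t" "x = pline (s *\<^sub>R u + t *\<^sub>R v)"
    "x \<noteq> pline u" "x \<noteq> pline v"
    unfolding open_proj_seg_def proj_seg_pline[OF assms(1-4)] by blast
  have "s \<noteq> 0" using st assms pline_scaleR[of t v] by auto
  moreover have "t \<noteq> 0" using st assms pline_scaleR[of s u] by auto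
  ultimately show "x \<in> ?R" using st by (auto simp: less_le)
next
  fix x assume "x \<in> ?R"
  then obtain s t where st: "0 < s" "0 < t" "x = pline (s *\<^sub>R u + t *\<^sub>R v)" by blast
  have in_seg: "x \<in> proj_seg \<Omega> (pline u) (pline v)"
    unfolding proj_seg_pline[OF assms(1-4)] using st by force
  have w: "s *\<^sub>R u + t *\<^sub>R v \<in> K" using st assms by (intro K_add K_scale) auto
  have w0: "s *\<^sub>R u + t *\<^sub>R v \<noteq> 0"
    using K_pos[of u] K_pos[of v] assms st
    by (metis add_pos_pos inner_add_right inner_scaleR_right inner_zero_right less_irrefl mult_pos_pos)
  have "x \<noteq> pline u"
  proof
    assume "x = pline u"
    then obtain c where "s *\<^sub>R u + t *\<^sub>R v = c *\<^sub>R u"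
      using pline_K_inj[OF assms(1,2) w w0] st(3) by metis
    then have "t *\<^sub>R v = (c - s) *\<^sub>R u" by (simp add: algebra_simps)
    then have "v = ((c - s) / t) *\<^sub>R u" using st by (metis divide_inverse_commute less_irrefl scaleR_scaleR scaleR_one left_inverse)
    then show False using assms pline_scaleR[of "(c - s) / t" u] by auto
  qed
  moreover have "x \<noteq> pline v"
  proof
    assume "x = pline v"
    then obtain c where "s *\<^sub>R u + t *\<^sub>R v = c *\<^sub>R v"
      using pline_K_inj[OF assms(3,4) w w0] st(3) by metis
    then have "s *\<^sub>R u = (c - t) *\<^sub>R v" by (simp add: algebra_simps)
    then have "u = ((c - t) / s) *\<^sub>R v" using st by (metis divide_inverse_commute less_irrefl scaleR_scaleR scaleR_one left_inverse)
    then show False using assms pline_scaleR[of "(c - t) / s" v] by auto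
  qed
  ultimately show "x \<in> ?L" using in_seg by (simp add: open_proj_seg_def)
qed

text \<open>A representing matrix may exchange the cone with its opposite. The height
  \<open>e\<close> of the image never vanishes on the convex set \<open>C\<close>, hence has
  constant sign there, and the matrix is corrected by that sign. The equivalence uses that the
  domain is mapped onto itself.\<close>

lemma automorphism_cone:
  assumes g: "g \<in> automorphisms \<Omega>"
  obtains c :: real where "c = 1 \<or> c = - 1" "\<And>v. (c *\<^sub>R g) *v v \<in> C \<longleftrightarrow> v \<in> C"
proof -
  have inv: "invertible g" and im: "pact g ` \<Omega> = \<Omega>" using g by (auto simp: automorphisms_def)
  have g0: "g *v v \<noteq> 0" if "v \<noteq> 0" for v
    using inv that by (metis invertible_left_inverse matrix_left_invertible_ker)
  have gO: "pline (g *v v) \<in> \<Omega>" if "v \<in> C" for v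
  proof -
    have "v \<noteq> 0" "pline v \<in> \<Omega>" using that by (auto simp: dcone_def)
    then show ?thesis using im pact_pline[OF inv] by (metis imageI)
  qed
  have ne0: "e \<bullet> (g *v v) \<noteq> 0" if "v \<in> C" for v
  proof -
    have "v \<noteq> 0" using that zero_notin_C by blast
    then have "g *v v \<in> C \<or> - (g *v v) \<in> C" using C_lift g0 gO[OF that] by blast
    then show ?thesis using pos[of "g *v v"] pos[of "- (g *v v)"] by auto
  qed
  have const: "0 < e \<bullet> (g *v v)" if "v \<in> C" "w \<in> C" "0 < e \<bullet> (g *v w)" for v w
  proof (rule ccontr)
    assume "\<not> 0 < e \<bullet> (g *v v)"
    with ne0 that have neg: "e \<bullet> (g *v v) < 0" by force
    \<comment> \<open>If the sign changed, this positive combination would have an image of height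
      zero.\<close>
    define z where "z = (e \<bullet> (g *v w)) *\<^sub>R v + (- (e \<bullet> (g *v v))) *\<^sub>R w"
    have "z \<in> C" unfolding z_def using that neg by (intro add scale) auto
    moreover have "e \<bullet> (g *v z) = 0"
      by (simp add: z_def matrix_vec_add inner_diff_right matrix_vector_mult_diff_distrib)
    ultimately show False using ne0 by blast
  qed
  obtain x where x: "x \<in> C" using ne by blast
  define c :: real where "c = (if 0 < e \<bullet> (g *v x) then 1 else - 1)"
  have c: "c = 1 \<or> c = - 1" by (simp add: c_def)
  have fwd: "(c *\<^sub>R g) *v v \<in> C" if "v \<in> C" for v
  proof -
    have "0 < e \<bullet> ((c *\<^sub>R g) *v v)"
      using const[OF that x] const[OF x that] ne0[OF that] ne0[OF x]
      by (cases "0 < e \<bullet> (g *v v)") (auto simp: c_def)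
    moreover have "pline ((c *\<^sub>R g) *v v) \<in> \<Omega>"
    proof -
      have "v \<noteq> 0" "c \<noteq> 0" using that zero_notin_C c by auto
      then show ?thesis using gO[OF that] g0[of v] pline_scaleR[of c "g *v v"] by simp
    qed
    ultimately show ?thesis by (simp add: dcone_def)
  qed
  have "v \<in> C" if "(c *\<^sub>R g) *v v \<in> C" for v
  proof -
    have v0: "v \<noteq> 0" using that zero_notin_C by auto
    have "pline ((c *\<^sub>R g) *v v) \<in> \<Omega>" using that by (simp add: dcone_def)
    then have "pline (g *v v) \<in> \<Omega>" using pline_scaleR[of c "g *v v"] c g0[OF v0] by auto
    then obtain q where q: "q \<in> \<Omega>" "pline (g *v v) = pact g q" using im by blast
    obtain w' where w': "w' \<noteq> 0" "q = pline w'" by (rule pline_cases)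
    obtain w where w: "w \<in> C" "q = pline w"
      using C_lift[of w'] w' q pline_scaleR[of "-1" w'] by auto
    have w0: "w \<noteq> 0" using w(1) zero_notin_C by auto
    then have "pline (g *v v) = pline (g *v w)" using q w pact_pline[OF inv] by simp
    then obtain d where d: "d \<noteq> 0" "g *v v = d *\<^sub>R (g *v w)"
      using pline_eq_iff g0 v0 w0 by metis
    then have "g *v (v - d *\<^sub>R w) = 0" by (simp add: matrix_vector_mult_diff_distrib)
    then have "v = d *\<^sub>R w" using g0[of "v - d *\<^sub>R w"] by auto
    moreover have "d * (e \<bullet> ((c *\<^sub>R g) *v w)) > 0" using pos[OF that] d by (simp add: mult_ac)
    then have "d > 0" using pos[OF fwd[OF w(1)]] by (meson zero_less_mult_pos2)
    ultimately show ?thesis using scale w by blast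
  qed
  with fwd c that show ?thesis by blast
qed

end

section \<open>Singular value decomposition\<close>

lemma matrix_mult_add_rdistrib: "(A + B) ** M = A ** M + B ** M" for A :: "real^'m^'n"
  by (simp add: vec_eq_iff matrix_matrix_mult_def sum.distrib algebra_simps)

lemma matrix_mult_diff_rdistrib: "(A - B) ** M = A ** M - B ** M" for A :: "real^'m^'n"
  by (simp add: vec_eq_iff matrix_matrix_mult_def sum_subtractf algebra_simps)

lemma matrix_mult_diff_ldistrib: "M ** (A - B) = M ** A - M ** B" for A :: "real^'m^'n"
  by (simp add: vec_eq_iff matrix_matrix_mult_def sum_subtractf algebra_simps)

lemma axis_at: "axis i x $ j = (if j = i then x else 0)"
  by (simp add: axis_def)

lemma tendsto_transpose:
  fixes A :: "'a \<Rightarrow> real^'n^'m"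
  assumes "(A \<longlongrightarrow> A0) F"
  shows "((\<lambda>n. transpose (A n)) \<longlongrightarrow> transpose A0) F"
  unfolding transpose_def by (intro tendsto_vec_lambda tendsto_vec_nth assms)

section \<open>Orthogonal matrices and rotations of coordinate planes\<close>

lemma orthogonal_matrix_norm:
  fixes Q :: "real^'n^'n" shows "orthogonal_matrix Q \<longleftrightarrow> (\<forall>x. norm (Q *v x) = norm x)"
  using orthogonal_transformation_matrix[of "(*v) Q"] by (simp add: orthogonal_transformation)

lemma compact_orthogonal: "compact {Q :: real^'n^'n. orthogonal_matrix Q}"
proof -
  have "closed {Q :: real^'n^'n. orthogonal_matrix Q}"
    unfolding closed_sequential_limits
  proof (intro allI impI)
    fix X and Q :: "real^'n^'n" assume X: "(\<forall>n. X n \<in> {Q. orthogonal_matrix Q}) \<and> X \<longlonglongrightarrow> Q"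
    then have "(\<lambda>n. transpose (X n) ** X n) \<longlonglongrightarrow> transpose Q ** Q"
      by (intro tendsto_matrix_mult tendsto_transpose) auto
    moreover have "(\<lambda>n. transpose (X n) ** X n) = (\<lambda>n. mat 1)"
      using X by (simp add: orthogonal_matrix)
    ultimately have "transpose Q ** Q = mat 1" using LIMSEQ_unique tendsto_const by metis
    then show "Q \<in> {Q. orthogonal_matrix Q}" by (simp add: orthogonal_matrix)
  qed
  moreover have "bounded {Q :: real^'n^'n. orthogonal_matrix Q}"
    unfolding bounded_iff
  proof (intro exI ballI)
    fix Q :: "real^'n^'n" assume "Q \<in> {Q. orthogonal_matrix Q}"
    then show "norm Q \<le> real CARD('n) * (real CARD('n) * 1)"
      by (intro norm_matrix_le) (simp add: orthogonal_matrix_norm norm_axis_1)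
  qed
  ultimately show ?thesis by (simp add: compact_eq_bounded_closed)
qed

text \<open>The rotation of the plane of the \<open>i\<close>-th and \<open>j\<close>-th coordinates
  with cosine \<open>c\<close> and sine \<open>s\<close>. Writing it with matrix units makes
  weighted traces of products affine in \<open>c\<close> and \<open>s\<close>.\<close>

definition givens :: "'n \<Rightarrow> 'n \<Rightarrow> real \<Rightarrow> real \<Rightarrow> real^'n^'n" where
  "givens i j c s = mat 1 + (c - 1) *\<^sub>R (outer (axis i 1) (axis i 1) + outer (axis j 1) (axis j 1)) +
     s *\<^sub>R (outer (axis j 1) (axis i 1) - outer (axis i 1) (axis j 1))"

lemma orthogonal_givens:
  assumes "i \<noteq> j" "c\<^sup>2 + s\<^sup>2 = 1"
  shows "orthogonal_matrix (givens i j c s :: real^'n^'n)"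
  unfolding orthogonal_matrix_norm
proof
  fix x :: "real^'n"
  define p where "p = (c - 1) * x $ i - s * x $ j"
  define q where "q = (c - 1) * x $ j + s * x $ i"
  have "givens i j c s *v x = x + (p *\<^sub>R axis i 1 + q *\<^sub>R axis j 1)"
    by (simp add: givens_def matrix_vector_mult_add_rdistrib matrix_vector_mult_diff_rdistrib
        inner_axis' p_def q_def algebra_simps)
  moreover have "(x + (p *\<^sub>R axis i 1 + q *\<^sub>R axis j 1)) \<bullet> (x + (p *\<^sub>R axis i 1 + q *\<^sub>R axis j 1)) =
      x \<bullet> x + 2 * p * x $ i + 2 * q * x $ j + p\<^sup>2 + q\<^sup>2"
    using assms(1)
    by (simp add: inner_add_left inner_add_right inner_axis inner_axis' axis_at power2_eq_square)
      (simp add: algebra_simps)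
  moreover have "2 * p * x $ i + 2 * q * x $ j + p\<^sup>2 + q\<^sup>2 = ((x $ i)\<^sup>2 + (x $ j)\<^sup>2) * (c\<^sup>2 + s\<^sup>2 - 1)"
    unfolding p_def q_def by algebra
  ultimately show "norm (givens i j c s *v x) = norm x"
    using assms(2) by (simp add: norm_eq_sqrt_inner)
qed

text \<open>For equal weights a maximiser would merely be symmetric; pairwise distinct positive
  weights break the symmetry between the coordinates and force it to be diagonal.\<close>

definition wtrace :: "('n \<Rightarrow> real) \<Rightarrow> real^'n^'n \<Rightarrow> real" where
  "wtrace w M = (\<Sum>i\<in>UNIV. w i * M $ i $ i)"

lemma wtrace_add: "wtrace w (A + B) = wtrace w A + wtrace w B"
  and wtrace_diff: "wtrace w (A - B) = wtrace w A - wtrace w B"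
  and wtrace_scaleR: "wtrace w (c *\<^sub>R A) = c * wtrace w A"
  by (simp_all add: wtrace_def sum.distrib sum_subtractf sum_distrib_left algebra_simps)

lemma wtrace_outer: "wtrace w (outer u f) = (\<Sum>i\<in>UNIV. w i * (u $ i * f $ i))"
  by (simp add: wtrace_def outer_def)

lemma wtrace_unit_left: "wtrace w (outer (axis p 1) (axis q 1) ** M) = w p * M $ q $ p"
proof -
  have "wtrace w (outer (axis p 1) (axis q 1) ** M) = (\<Sum>i\<in>UNIV. if i = p then w p * M $ q $ p else 0)"
    unfolding outer_matrix wtrace_outer
    by (rule sum.cong) (auto simp: axis_at vector_matrix_mult_def if_distrib[of "\<lambda>x. x * _"] if_distrib[of "\<lambda>x. _ * x"] cong: if_cong)
  then show ?thesis by simp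
qed

lemma wtrace_unit_right: "wtrace w (M ** outer (axis p 1) (axis q 1)) = w q * M $ q $ p"
proof -
  have "wtrace w (M ** outer (axis p 1) (axis q 1)) = (\<Sum>i\<in>UNIV. if i = q then w q * M $ q $ p else 0)"
    unfolding matrix_outer wtrace_outer matrix_entry_inner
    by (rule sum.cong) (auto simp: axis_at)
  then show ?thesis by simp
qed

lemma wtrace_givens_left:
  "wtrace w (givens i j c s ** M) =
     wtrace w M + (c - 1) * (w i * M $ i $ i + w j * M $ j $ j) + s * (w j * M $ i $ j - w i * M $ j $ i)"
  by (simp add: givens_def matrix_mult_add_rdistrib matrix_mult_diff_rdistrib wtrace_add wtrace_diff wtrace_scaleR
      wtrace_unit_left algebra_simps)

lemma wtrace_givens_right:
  "wtrace w (M ** givens i j c s) =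
     wtrace w M + (c - 1) * (w i * M $ i $ i + w j * M $ j $ j) + s * (w i * M $ i $ j - w j * M $ j $ i)"
  by (simp add: givens_def matrix_add_ldistrib matrix_mult_diff_ldistrib wtrace_add wtrace_diff wtrace_scaleR
      wtrace_unit_right algebra_simps)

text \<open>The left side is the change of a weighted trace under a rotation, maximal at angle zero,
  and \<open>B\<close> is its derivative there. Calculus is avoided by the rational parametrisation
  of the circle, which yields \<open>t * B \<le> t\<^sup>2 * A\<close> for every
  \<open>t\<close>.\<close>

lemma circle_max:
  assumes "\<And>c s. c\<^sup>2 + s\<^sup>2 = 1 \<Longrightarrow> (c - 1) * A + s * B \<le> (0::real)"
  shows "B = 0"
proof -
  have A: "A \<ge> 0" using assms[of "-1" 0] by simp
  have t: "t * B \<le> t\<^sup>2 * A" for t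
  proof -
    define d where "d = 1 + t\<^sup>2"
    have d: "d > 0" by (simp add: d_def add_pos_nonneg)
    have "((1 - t\<^sup>2) / d)\<^sup>2 + (2 * t / d)\<^sup>2 = ((1 - t\<^sup>2)\<^sup>2 + (2 * t)\<^sup>2) / d\<^sup>2"
      by (simp add: power_divide add_divide_distrib)
    also have "(1 - t\<^sup>2)\<^sup>2 + (2 * t)\<^sup>2 = d\<^sup>2" unfolding d_def by algebra
    finally have "((1 - t\<^sup>2) / d - 1) * A + 2 * t / d * B \<le> 0" using d by (intro assms) simp
    moreover have "((1 - t\<^sup>2) / d - 1) = - 2 * t\<^sup>2 / d" using d by (simp add: field_simps) (simp add: d_def algebra_simps)
    ultimately have "- 2 * t\<^sup>2 / d * A + 2 * t / d * B \<le> 0" by (simp only:)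
    moreover have "- 2 * t\<^sup>2 / d * A + 2 * t / d * B = 2 * (t * B - t\<^sup>2 * A) / d"
      by (simp add: diff_divide_distrib algebra_simps)
    ultimately have "2 * (t * B - t\<^sup>2 * A) / d \<le> 0" by (simp only:)
    then show ?thesis using d by (simp add: divide_le_0_iff)
  qed
  show ?thesis
  proof (cases "A = 0")
    case True then show ?thesis using t[of 1] t[of "-1"] by simp
  next
    case False
    \<comment> \<open>This value of \<open>t\<close> turns the inequality into
      \<open>B * B / (2 * A) \<le> B * B / (4 * A)\<close>.\<close>
    then have "B / (2 * A) * B \<le> (B / (2 * A))\<^sup>2 * A" by (intro t)
    also have "(B / (2 * A))\<^sup>2 * A = B / (2 * A) * B / 2" using False by (simp add: power2_eq_square)
    finally have "B / (2 * A) * B \<le> 0" by simp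
    then have "B * B \<le> 0" using A False by (simp add: field_simps)
    then show ?thesis using zero_le_square[of B] by (metis antisym mult_eq_0_iff)
  qed
qed

text \<open>The decomposition is read off a maximiser \<open>(k, l)\<close> of a weighted trace of \<open>k ** g ** l\<close>.\<close>

lemma orthogonal_diagonalisation:
  fixes g :: "real^'n^'n" and w :: "'n \<Rightarrow> real"
  assumes g: "det g \<noteq> 0" and w: "\<And>i. w i > 0" "inj w"
  obtains k l a where "orthogonal_matrix k" "orthogonal_matrix l" "k ** g ** l = diag_matrix a"
    "\<And>i. a $ i > 0" "\<And>i j. w i > w j \<Longrightarrow> a $ i \<ge> a $ j"
proof -
  define O' where "O' = {Q :: real^'n^'n. orthogonal_matrix Q}"
  have cont: "continuous_on (O' \<times> O') (\<lambda>p. wtrace w (fst p ** g ** snd p))"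
    unfolding continuous_on_def wtrace_def
    by (intro ballI tendsto_sum tendsto_mult tendsto_const tendsto_vec_nth tendsto_matrix_mult
        tendsto_fst tendsto_snd tendsto_ident_at)
  have "compact (O' \<times> O')" unfolding O'_def by (intro compact_Times compact_orthogonal)
  moreover have "(mat 1, mat 1) \<in> O' \<times> O'" by (simp add: O'_def orthogonal_matrix_id)
  ultimately obtain k l where kl: "k \<in> O'" "l \<in> O'"
    and max: "\<And>k' l'. k' \<in> O' \<Longrightarrow> l' \<in> O' \<Longrightarrow> wtrace w (k' ** g ** l') \<le> wtrace w (k ** g ** l)"
    using continuous_attains_sup[OF _ _ cont] by (metis (no_types, lifting) SigmaE2 SigmaI all_not_in_conv fst_conv mem_Sigma_iff snd_conv surj_pair)
  define M where "M = k ** g ** l"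
  have maxM: "wtrace w (p ** M ** q) \<le> wtrace w M" if "p \<in> O'" "q \<in> O'" for p q
  proof -
    have "p ** k \<in> O'" "l ** q \<in> O'" using that kl by (simp_all add: O'_def orthogonal_matrix_mul)
    from max[OF this] show ?thesis by (simp add: M_def matrix_mul_assoc)
  qed
  have id: "mat 1 \<in> O'" by (simp add: O'_def orthogonal_matrix_id)
  have G: "givens i j c s \<in> O'" if "i \<noteq> j" "c\<^sup>2 + s\<^sup>2 = 1" for i j c s
    using orthogonal_givens[OF that] by (simp add: O'_def)
  have diag: "M $ i $ j = 0" if ij: "i \<noteq> j" for i j
  proof -
    have "w j * M $ i $ j - w i * M $ j $ i = 0"
    proof (rule circle_max)
      fix c s :: real assume "c\<^sup>2 + s\<^sup>2 = 1"
      from maxM[OF G[OF ij this] id]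
      show "(c - 1) * (w i * M $ i $ i + w j * M $ j $ j) + s * (w j * M $ i $ j - w i * M $ j $ i) \<le> 0"
        by (simp add: wtrace_givens_left)
    qed
    moreover have "w i * M $ i $ j - w j * M $ j $ i = 0"
    proof (rule circle_max)
      fix c s :: real assume "c\<^sup>2 + s\<^sup>2 = 1"
      from maxM[OF id G[OF ij this]]
      show "(c - 1) * (w i * M $ i $ i + w j * M $ j $ j) + s * (w i * M $ i $ j - w j * M $ j $ i) \<le> 0"
        by (simp add: wtrace_givens_right)
    qed
    \<comment> \<open>Rotations from the left and from the right give two linear relations between
      \<open>M $ i $ j\<close> and \<open>M $ j $ i\<close>; eliminating the latter leaves a factor
      \<open>(w j)\<^sup>2 - (w i)\<^sup>2\<close>, nonzero for distinct positive weights.\<close>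
    ultimately have "w j * (w j * M $ i $ j) = w i * (w i * M $ i $ j)" by (simp add: algebra_simps)
    then have "(w j - w i) * (w j + w i) * M $ i $ j = 0" by algebra
    moreover have "w j - w i \<noteq> 0" using injD[OF w(2)] ij by auto
    moreover have "w j + w i \<noteq> 0" using w(1)[of i] w(1)[of j] by linarith
    ultimately show ?thesis by simp
  qed
  define a where "a = (\<chi> i. M $ i $ i)"
  have Ma: "M = diag_matrix a" using diag by (simp add: vec_eq_iff diag_matrix_def a_def)
  have "det M \<noteq> 0"
    using g kl det_orthogonal_matrix[of k] det_orthogonal_matrix[of l]
    by (auto simp: M_def det_mul O'_def)
  moreover have "det M = (\<Prod>i\<in>UNIV. a $ i)" using diag by (simp add: det_diagonal a_def)
  ultimately have a0: "a $ i \<noteq> 0" for i by auto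
  have apos: "a $ i > 0" for i
  proof -
    \<comment> \<open>The reflection changes the sign of one diagonal entry, so at a maximum that
      entry is nonnegative.\<close>
    define H :: "real^'n^'n" where "H = mat 1 - 2 *\<^sub>R outer (axis i 1) (axis i 1)"
    have "orthogonal_matrix H"
      unfolding orthogonal_matrix_norm
    proof
      fix x :: "real^'n"
      have "H *v x = x - (2 * x $ i) *\<^sub>R axis i 1"
        by (simp add: H_def matrix_vector_mult_diff_rdistrib inner_axis')
      moreover have "(x - (2 * x $ i) *\<^sub>R axis i 1) \<bullet> (x - (2 * x $ i) *\<^sub>R axis i 1) = x \<bullet> x"
        by (simp add: inner_diff_left inner_diff_right inner_axis inner_axis' axis_at algebra_simps)
      ultimately show "norm (H *v x) = norm x" by (simp add: norm_eq_sqrt_inner)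
    qed
    then have "wtrace w (H ** M ** mat 1) \<le> wtrace w M" using id by (intro maxM) (auto simp: O'_def)
    then have "0 \<le> w i * M $ i $ i"
      by (simp add: H_def matrix_mult_diff_rdistrib wtrace_diff wtrace_scaleR wtrace_unit_left)
    then have "0 \<le> a $ i" using w(1)[of i] by (simp add: a_def zero_le_mult_iff)
    with a0[of i] show ?thesis by simp
  qed
  have order: "a $ i \<ge> a $ j" if "w i > w j" for i j
  proof -
    have ij: "i \<noteq> j" using that by auto
    \<comment> \<open>Opposite quarter turns on both sides exchange the two diagonal entries;
      maximality then becomes the rearrangement inequality.\<close>
    define N where "N = M ** givens i j 0 (-1)"
    have N: "N $ i $ i = 0" "N $ j $ j = 0" "N $ i $ j = a $ i" "N $ j $ i = - a $ j"
    proof -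
      have "N $ p $ q = a $ p * givens i j 0 (-1) $ p $ q" for p q
        by (simp add: N_def Ma diag_matrix_def matrix_matrix_mult_def if_distrib[of "\<lambda>x. x * _"] cong: if_cong)
      then show "N $ i $ i = 0" "N $ j $ j = 0" "N $ i $ j = a $ i" "N $ j $ i = - a $ j"
        using ij by (simp_all add: givens_def outer_def axis_at mat_def)
    qed
    have "wtrace w (givens i j 0 1 ** M ** givens i j 0 (-1)) \<le> wtrace w M"
      by (intro maxM G ij) auto
    moreover have "wtrace w (givens i j 0 1 ** M ** givens i j 0 (-1)) = wtrace w (givens i j 0 1 ** N)"
      by (simp add: N_def matrix_mul_assoc)
    moreover have "\<dots> = wtrace w N + w j * a $ i + w i * a $ j"
      by (simp add: wtrace_givens_left N)
    moreover have "wtrace w N = wtrace w M - w i * a $ i - w j * a $ j"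
      using diag ij by (simp add: N_def wtrace_givens_right a_def)
    ultimately have "0 \<le> (w i - w j) * (a $ i - a $ j)" by (simp add: algebra_simps)
    then show ?thesis using that by (simp add: zero_le_mult_iff)
  qed
  show ?thesis
    by (rule that[of k l a]) (use kl apos order Ma in \<open>auto simp: O'_def M_def\<close>)
qed

section \<open>Ordered singular values and their independence of the decomposition\<close>

lemma bij_coord: "bij_betw (coord :: nat \<Rightarrow> 'n::finite) {1..CARD('n)} UNIV"
  unfolding coord_def by (rule someI_ex[OF ex_bij_betw_nat_finite_1]) simp

lemma coord_cases: obtains m where "1 \<le> m" "m \<le> CARD('n)" "(i::'n::finite) = coord m"
proof -
  have "i \<in> coord ` {1..CARD('n)}" using bij_coord[where 'n='n] unfolding bij_betw_def by blast
  then show ?thesis using that by auto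
qed

lemma coord_eq_iff:
  "m \<in> {1..CARD('n)} \<Longrightarrow> k \<in> {1..CARD('n)} \<Longrightarrow> (coord m :: 'n::finite) = coord k \<longleftrightarrow> m = k"
  using bij_coord[where 'n='n] unfolding bij_betw_def by (blast dest: inj_on_eq_iff)

lemma det_diag_matrix: "det (diag_matrix a) = (\<Prod>i\<in>UNIV. a $ i)"
  by (subst det_diagonal) (auto simp: diag_matrix_def)

lemma ex_cartan_decomposition:
  fixes g :: "real^'n^'n"
  assumes g: "det g > 0"
  shows "\<exists>k a l. cartan_decomposition g k a l"
proof -
  define idx where "idx i = (SOME m. m \<in> {1..CARD('n)} \<and> i = (coord m :: 'n))" for i
  have idx: "idx i \<in> {1..CARD('n)} \<and> i = coord (idx i)" for i
    unfolding idx_def by (rule someI_ex) (metis atLeastAtMost_iff coord_cases)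
  have idx_coord: "idx (coord m) = m" if "m \<in> {1..CARD('n)}" for m
    using idx[of "coord m"] coord_eq_iff[OF that, of "idx (coord m)"] by simp
  \<comment> \<open>Any positive weights that decrease strictly along the enumeration would do; they
    force the singular values into decreasing order.\<close>
  define w where "w i = 1 / real (idx i)" for i
  have w: "w i > 0" for i using idx[of i] by (simp add: w_def)
  have "inj w"
  proof (rule injI)
    fix i j assume "w i = w j"
    then have "idx i = idx j" using idx[of i] idx[of j] by (simp add: w_def)
    then show "i = j" using idx by metis
  qed
  then obtain k l a where *: "orthogonal_matrix k" "orthogonal_matrix l" "k ** g ** l = diag_matrix a"
    "\<And>i. a $ i > 0" "\<And>i j. w i > w j \<Longrightarrow> a $ i \<ge> a $ j"
    using orthogonal_diagonalisation[of g w] g w by auto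
  define k' where "k' = transpose k" define l' where "l' = transpose l"
  have o: "orthogonal_matrix k'" "orthogonal_matrix l'" using * by (simp_all add: k'_def l'_def)
  have "k' ** (k ** g ** l) ** l' = (k' ** k) ** g ** (l ** l')" by (simp add: matrix_mul_assoc)
  then have gk: "g = k' ** diag_matrix a ** l'"
    using * unfolding k'_def l'_def orthogonal_matrix_def by simp
  have ord: "a $ coord j \<le> a $ coord i" if "1 \<le> i" "i \<le> j" "j \<le> CARD('n)" for i j
  proof (cases "i = j")
    case False
    then have "w (coord i) > w (coord j)" using that by (simp add: w_def idx_coord divide_strict_left_mono)
    then show ?thesis by (rule *(5))
  qed simp
  have pr: "(\<Prod>i\<in>UNIV. a $ i) > 0" using *(4) by (simp add: prod_pos)
  have "det g = det k' * (\<Prod>i\<in>UNIV. a $ i) * det l'" by (subst gk) (simp add: det_mul det_diag_matrix)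
  then have "(det k' * det l') * (\<Prod>i\<in>UNIV. a $ i) > 0" using g by (simp add: mult_ac)
  then have "det k' * det l' > 0" using pr zero_less_mult_pos2 by blast
  then consider "det k' = 1" "det l' = 1" | "det k' = -1" "det l' = -1"
    using det_orthogonal_matrix[OF o(1)] det_orthogonal_matrix[OF o(2)] by auto
  then show ?thesis
  proof cases
    case 1
    then have "cartan_decomposition g k' a l'"
      unfolding cartan_decomposition_def rotation_matrix_def using o gk ord *(4) by blast
    then show ?thesis by blast
  next
    case 2
    \<comment> \<open>Both orthogonal factors reverse orientation. Inserting the reflection
      \<open>D\<close> on either side of the diagonal part repairs both at once, because it commutes
      with diagonal matrices and squares to the identity.\<close>
    define b :: "real^'n" where "b = (\<chi> i. if i = coord 1 then - 1 else 1)"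
    define D where "D = diag_matrix b"
    have mul: "diag_matrix x ** diag_matrix y = diag_matrix (\<chi> i. x $ i * y $ i)" for x y :: "real^'n"
      by (simp add: vec_eq_iff diag_matrix_def matrix_matrix_mult_def if_distrib[of "\<lambda>x. x * _"] cong: if_cong)
    have DD: "D ** D = mat 1" "D ** diag_matrix a ** D = diag_matrix a"
      by (auto simp: D_def mul) (auto simp: vec_eq_iff diag_matrix_def b_def mat_def)
    have "transpose D = D" by (simp add: vec_eq_iff D_def diag_matrix_def transpose_def)
    then have oD: "orthogonal_matrix D" using DD by (simp add: orthogonal_matrix)
    have "det D = (\<Prod>i\<in>UNIV. b $ i)" by (simp add: D_def det_diag_matrix)
    also have "\<dots> = -1" by (simp add: b_def prod.delta')
    finally have dD: "det D = -1" .
    have "k' ** D ** diag_matrix a ** (D ** l') = k' ** (D ** diag_matrix a ** D) ** l'"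
      by (simp add: matrix_mul_assoc)
    then have "g = k' ** D ** diag_matrix a ** (D ** l')" using gk DD by simp
    moreover have "rotation_matrix (k' ** D)" "rotation_matrix (D ** l')"
      using o oD 2 dD by (simp_all add: rotation_matrix_def orthogonal_matrix_mul det_mul)
    ultimately have "cartan_decomposition g (k' ** D) a (D ** l')"
      unfolding cartan_decomposition_def using ord *(4) by blast
    then show ?thesis by blast
  qed
qed

text \<open>Computing \<open>transpose g ** g\<close> from both decompositions shows that
  \<open>l ** transpose l'\<close> intertwines the squared diagonal parts, so its nonzero entries
  link equal singular values.\<close>

lemma cartan_decomposition_transition:
  fixes g :: "real^'n^'n"
  assumes "cartan_decomposition g k a l" "cartan_decomposition g k' a' l'" "(l ** transpose l') $ i $ j \<noteq> 0"
  shows "a $ i = a' $ j"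
proof -
  have o: "orthogonal_matrix k" "orthogonal_matrix l" "orthogonal_matrix k'" "orthogonal_matrix l'"
    and p: "a $ i > 0" "a' $ j > 0"
    and g: "g = k ** diag_matrix a ** l" "g = k' ** diag_matrix a' ** l'"
    using assms by (auto simp: cartan_decomposition_def rotation_matrix_def)
  have tr: "transpose (diag_matrix x) = diag_matrix x" for x :: "real^'n"
    by (simp add: vec_eq_iff diag_matrix_def transpose_def)
  have gg: "transpose g ** g = transpose q ** (diag_matrix b ** diag_matrix b) ** q"
    if "g = p ** diag_matrix b ** q" "orthogonal_matrix p" for p b q
  proof -
    have "transpose g ** g = transpose q ** diag_matrix b ** (transpose p ** p) ** diag_matrix b ** q"
      by (simp add: that(1) matrix_transpose_mul tr matrix_mul_assoc)
    also have "transpose p ** p = mat 1" using that(2) by (simp add: orthogonal_matrix)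
    finally show ?thesis by (simp add: matrix_mul_assoc)
  qed
  define P where "P = l ** transpose l'"
  define D where "D = diag_matrix a ** diag_matrix a"
  define D' where "D' = diag_matrix a' ** diag_matrix a'"
  have "transpose l ** D ** l = transpose l' ** D' ** l'"
    using gg[OF g(1) o(1)] gg[OF g(2) o(3)] by (simp add: D_def D'_def)
  then have "l ** (transpose l ** D ** l) ** transpose l' = l ** (transpose l' ** D' ** l') ** transpose l'"
    by simp
  then have "(l ** transpose l) ** D ** P = P ** D' ** (l' ** transpose l')"
    by (simp add: P_def matrix_mul_assoc)
  then have DP: "D ** P = P ** D'" using o by (simp add: orthogonal_matrix_def)
  have "(D ** P) $ i $ j = (a $ i)\<^sup>2 * P $ i $ j" "(P ** D') $ i $ j = P $ i $ j * (a' $ j)\<^sup>2"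
    by (simp_all add: D_def D'_def matrix_matrix_mult_def diag_matrix_def if_distrib[of "\<lambda>x. x * _"]
        if_distrib[of "\<lambda>x. _ * x"] power2_eq_square cong: if_cong)
  then have "(a $ i)\<^sup>2 = (a' $ j)\<^sup>2" using DP assms(3) by (simp add: P_def)
  then show ?thesis using p by (simp add: power2_eq_iff_nonneg less_imp_le)
qed

lemma cartan_decomposition_ord:
  fixes g :: "real^'n^'n"
  assumes "cartan_decomposition g k a l"
  shows "a $ i \<le> a $ coord 1" and "i \<noteq> coord 1 \<Longrightarrow> a $ i \<le> a $ coord 2"
proof -
  have ord: "\<And>i j. 1 \<le> i \<Longrightarrow> i \<le> j \<Longrightarrow> j \<le> CARD('n) \<Longrightarrow> a $ coord j \<le> a $ coord i"
    using assms by (auto simp: cartan_decomposition_def)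
  obtain m where m: "1 \<le> m" "m \<le> CARD('n)" "i = coord m" by (rule coord_cases)
  show "a $ i \<le> a $ coord 1" using ord[of 1 m] m by simp
  show "a $ i \<le> a $ coord 2" if "i \<noteq> coord 1"
  proof -
    have "m \<noteq> 1" using that m(3) by auto
    then show ?thesis using ord[of 2 m] m by simp
  qed
qed

text \<open>If \<open>a'\<close> were larger in first place, the first column of the orthogonal
  matrix \<open>P\<close> would vanish; if larger in second place, the first two columns of
  \<open>P\<close> would both be multiples of the first basis vector. Either contradicts injectivity
  of \<open>P\<close>. Symmetry in the two decompositions then makes the first two singular values
  well defined.\<close>

lemma cartan_decomposition_le:
  fixes g :: "real^'n^'n"
  assumes c: "cartan_decomposition g k a l" "cartan_decomposition g k' a' l'"
  shows "a' $ coord 1 \<le> a $ coord 1" and "CARD('n) \<ge> 2 \<Longrightarrow> a' $ coord 2 \<le> a $ coord 2"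
proof -
  define P where "P = l ** transpose l'"
  have "orthogonal_matrix P"
    using c by (auto simp: P_def cartan_decomposition_def rotation_matrix_def orthogonal_matrix_mul)
  then have nP: "\<And>x. norm (P *v x) = norm x" by (simp add: orthogonal_matrix_norm)
  have z: "P $ i $ j = 0" if "a $ i < a' $ j" for i j
    using cartan_decomposition_transition[OF c, of i j] that by (auto simp: P_def)
  show "a' $ coord 1 \<le> a $ coord 1"
  proof (rule ccontr)
    assume "\<not> ?thesis"
    then have "P $ i $ coord 1 = 0" for i using cartan_decomposition_ord(1)[OF c(1), of i] by (intro z) simp
    then have "P *v axis (coord 1) 1 = 0" by (simp add: vec_eq_iff matrix_entry_inner)
    then show False using nP[of "axis (coord 1) 1"] by (simp add: norm_axis_1)
  qed
  show "a' $ coord 2 \<le> a $ coord 2" if card: "CARD('n) \<ge> 2"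
  proof (rule ccontr)
    assume less: "\<not> ?thesis"
    have neq: "(coord 1 :: 'n) \<noteq> coord 2" using card by (subst coord_eq_iff) auto
    have le: "a' $ coord 2 \<le> a' $ coord 1" by (rule cartan_decomposition_ord[OF c(2)])
    have 0: "P $ i $ j = 0" if "i \<noteq> coord 1" "j \<in> {coord 1, coord 2}" for i j
    proof (rule z)
      have "a $ i \<le> a $ coord 2" using cartan_decomposition_ord(2)[OF c(1) that(1)] .
      also have "\<dots> < a' $ coord 2" using less by simp
      also have "a' $ coord 2 \<le> a' $ j" using that(2) le by auto
      finally show "a $ i < a' $ j" .
    qed
    define x y where "x = P $ coord 1 $ coord 1" and "y = P $ coord 1 $ coord 2"
    have Pc: "P *v axis (coord 1) 1 = x *\<^sub>R axis (coord 1) 1" "P *v axis (coord 2) 1 = y *\<^sub>R axis (coord 1) 1"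
    proof -
      have "(P *v axis (coord 1) 1) $ i = (x *\<^sub>R axis (coord 1) 1) $ i"
        "(P *v axis (coord 2) 1) $ i = (y *\<^sub>R axis (coord 1) 1) $ i" for i
        unfolding matrix_entry_inner vector_scaleR_component axis_at
        using 0[of i] by (cases "i = coord 1"; simp add: x_def y_def)+
      then show "P *v axis (coord 1) 1 = x *\<^sub>R axis (coord 1) 1" "P *v axis (coord 2) 1 = y *\<^sub>R axis (coord 1) 1"
        unfolding vec_eq_iff by blast+
    qed
    have "P *v (y *\<^sub>R axis (coord 1) 1 - x *\<^sub>R axis (coord 2) 1) = 0"
      by (simp add: matrix_vector_mult_diff_distrib Pc del: One_nat_def)
    then have eq0: "y *\<^sub>R axis (coord 1) 1 - x *\<^sub>R axis (coord 2) 1 = (0 :: real^'n)"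
      using nP[of "y *\<^sub>R axis (coord 1) 1 - x *\<^sub>R axis (coord 2) 1"] by simp
    have "(y *\<^sub>R axis (coord 1) 1 - x *\<^sub>R axis (coord 2) 1 :: real^'n) $ coord 2 = 0"
      by (simp only: eq0 zero_index)
    then have "x = 0" using neq by (simp add: axis_at)
    then show False using nP[of "axis (coord 1) 1"] Pc by (simp add: norm_axis_1)
  qed
qed

lemma sing_val_eq:
  fixes g :: "real^'n^'n"
  assumes c: "cartan_decomposition g k a l"
  shows "sing_val g 1 = a $ coord 1" and "CARD('n) \<ge> 2 \<Longrightarrow> sing_val g 2 = a $ coord 2"
  unfolding sing_val_def
  by (rule the_equality; use c cartan_decomposition_le in \<open>metis (no_types, lifting) antisym\<close>)+

text \<open>The gap forces the transition matrix \<open>P\<close> to preserve the first coordinate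
  line. Evaluating \<open>g\<close> on the first column of \<open>transpose l'\<close> in both
  decompositions then shows that \<open>k\<close> and \<open>k'\<close> send that line to the same
  point.\<close>

lemma cartan_point_eq:
  fixes g :: "real^'n^'n"
  assumes c: "cartan_decomposition g k a l" and gap: "a $ coord 2 < a $ coord 1"
  shows "cartan_point g = pline (k *v axis (coord 1) 1)"
proof -
  have pact: "pact k' (pline (axis (coord 1) 1)) = pline (k' *v axis (coord 1) 1)"
    if "cartan_decomposition g k' a' l'" for k' a' l'
    using that by (intro pact_pline)
      (auto simp: cartan_decomposition_def rotation_matrix_def invertible_det_nz axis_eq_0_iff)
  show ?thesis
    unfolding cartan_point_def
  proof (rule the_equality)
    show "\<exists>k' a l. cartan_decomposition g k' a l \<and>
        pline (k *v axis (coord 1) 1) = pact k' (pline (axis (coord 1) 1))"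
      using c pact[OF c] by metis
  next
    fix p assume "\<exists>k' a l. cartan_decomposition g k' a l \<and> p = pact k' (pline (axis (coord 1) 1))"
    then obtain k' a' l' where c': "cartan_decomposition g k' a' l'" and p: "p = pline (k' *v axis (coord 1) 1)"
      using pact by metis
    define P where "P = l ** transpose l'"
    have o: "orthogonal_matrix l" "orthogonal_matrix l'" "orthogonal_matrix k'" "orthogonal_matrix k"
      using c c' by (auto simp: cartan_decomposition_def rotation_matrix_def)
    then have oP: "orthogonal_matrix P" by (simp add: P_def orthogonal_matrix_mul)
    have a1: "a' $ coord 1 = a $ coord 1"
      using cartan_decomposition_le(1)[OF c c'] cartan_decomposition_le(1)[OF c' c] by simp
    have "P $ i $ coord 1 = 0" if "i \<noteq> coord 1" for i
    proof (rule ccontr)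
      assume "P $ i $ coord 1 \<noteq> 0"
      then have "a $ i = a' $ coord 1" using cartan_decomposition_transition[OF c c'] by (simp add: P_def)
      then show False using cartan_decomposition_ord(2)[OF c that] gap a1 by simp
    qed
    then have *: "(P *v axis (coord 1) 1) $ i = (if i = coord 1 then P $ coord 1 $ coord 1 else 0)" for i
      by (simp add: matrix_entry_inner)
    then obtain x where x: "P *v axis (coord 1) 1 = x *\<^sub>R axis (coord 1) 1"
      by (intro that[of "P $ coord 1 $ coord 1"]) (use * in \<open>auto simp: vec_eq_iff axis_at\<close>)
    have x0: "x \<noteq> 0" using oP[unfolded orthogonal_matrix_norm, rule_format, of "axis (coord 1) 1"] x
      by (auto simp: norm_axis_1)
    have dx: "diag_matrix b *v axis (coord 1) 1 = b $ coord 1 *\<^sub>R axis (coord 1) 1" for b :: "real^'n"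
      by (auto simp: vec_eq_iff matrix_entry_inner diag_matrix_def axis_at)
    have g: "g = k ** diag_matrix a ** l" "g = k' ** diag_matrix a' ** l'" and ll: "l' ** transpose l' = mat 1"
      using c c' o(2) unfolding cartan_decomposition_def orthogonal_matrix_def by blast+
    have "g *v (transpose l' *v axis (coord 1) 1) = k' *v (diag_matrix a' *v ((l' ** transpose l') *v axis (coord 1) 1))"
      by (simp only: g(2) matrix_vector_mul_assoc matrix_mul_assoc)
    then have 1: "g *v (transpose l' *v axis (coord 1) 1) = a' $ coord 1 *\<^sub>R (k' *v axis (coord 1) 1)"
      by (simp only: ll matrix_vector_mul_lid dx matrix_vec_scaleR)
    have "g *v (transpose l' *v axis (coord 1) 1) = k *v (diag_matrix a *v (P *v axis (coord 1) 1))"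
      by (simp only: g(1) P_def matrix_vector_mul_assoc matrix_mul_assoc)
    then have 2: "g *v (transpose l' *v axis (coord 1) 1) = a $ coord 1 *\<^sub>R (x *\<^sub>R (k *v axis (coord 1) 1))"
      by (simp only: x dx matrix_vec_scaleR scaleR_scaleR mult.commute)
    have "a $ coord 1 > 0" using c by (auto simp: cartan_decomposition_def)
    moreover have "a $ coord 1 *\<^sub>R (k' *v axis (coord 1) 1) = a $ coord 1 *\<^sub>R (x *\<^sub>R (k *v axis (coord 1) 1))"
      using 1 2 a1 by (simp only: scaleR_scaleR mult.commute)
    ultimately have eq: "k' *v axis (coord 1) 1 = x *\<^sub>R (k *v axis (coord 1) 1)"
      by (metis less_irrefl scaleR_cancel_left)
    have "k *v axis (coord 1) 1 \<noteq> 0"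
      using o(4)[unfolded orthogonal_matrix_norm, rule_format, of "axis (coord 1) 1"] by (auto simp: norm_axis_1)
    then show "p = pline (k *v axis (coord 1) 1)" using p eq x0 by (simp add: pline_scaleR)
  qed
qed

section \<open>The proximal limit set as a set of rank one limits\<close>

text \<open>Scalars of either sign, and zero, are allowed, so every limit of rescaled elements
  belongs to it whatever the normalisation.\<close>

definition cone_closure :: "(real^'n^'n) set \<Rightarrow> (real^'n^'n) set" where
  "cone_closure \<Gamma> = closure {c *\<^sub>R g | c g. g \<in> \<Gamma>}"

lemma cone_closureE:
  assumes "A \<in> cone_closure \<Gamma>"
  obtains c g where "\<And>n. g n \<in> \<Gamma>" "(\<lambda>n. c n *\<^sub>R g n) \<longlonglongrightarrow> A"
proof -
  obtain s where s: "\<forall>n. s n \<in> {c *\<^sub>R g | c g. g \<in> \<Gamma>}" "s \<longlonglongrightarrow> A"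
    using assms unfolding cone_closure_def closure_sequential by blast
  then have "\<forall>n. \<exists>c g. g \<in> \<Gamma> \<and> s n = c *\<^sub>R g" by blast
  then obtain c g where "\<And>n. g n \<in> \<Gamma> \<and> s n = c n *\<^sub>R g n" by metis
  moreover from this have "s = (\<lambda>n. c n *\<^sub>R g n)" by auto
  ultimately show ?thesis using that[of g c] s(2) by simp
qed

lemma cone_closureI:
  assumes "\<And>n. g n \<in> \<Gamma>" "(\<lambda>n. c n *\<^sub>R g n) \<longlonglongrightarrow> A"
  shows "A \<in> cone_closure \<Gamma>"
  unfolding cone_closure_def closure_sequential
  by (rule exI[of _ "\<lambda>n. c n *\<^sub>R g n"]) (use assms in blast)

lemma orthogonal_subsequence:
  fixes k l :: "nat \<Rightarrow> real^'n^'n"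
  assumes "\<And>n. orthogonal_matrix (k n)" "\<And>n. orthogonal_matrix (l n)"
  obtains q k' l' where "strict_mono q" "(\<lambda>n. k (q n)) \<longlonglongrightarrow> k'" "(\<lambda>n. l (q n)) \<longlonglongrightarrow> l'"
    "orthogonal_matrix k'" "orthogonal_matrix l'"
proof -
  define O' where "O' = {Q :: real^'n^'n. orthogonal_matrix Q}"
  have "compact (O' \<times> O')" unfolding O'_def by (intro compact_Times compact_orthogonal)
  moreover have "\<forall>n. (k n, l n) \<in> O' \<times> O'" using assms by (simp add: O'_def)
  ultimately obtain z q where z: "z \<in> O' \<times> O'" "strict_mono q" "((\<lambda>n. (k n, l n)) \<circ> q) \<longlonglongrightarrow> z"
    unfolding compact_def by meson
  have "(\<lambda>n. fst (k (q n), l (q n))) \<longlonglongrightarrow> fst z" "(\<lambda>n. snd (k (q n), l (q n))) \<longlonglongrightarrow> snd z"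
    using tendsto_fst[OF z(3)] tendsto_snd[OF z(3)] by (simp_all only: o_def)
  then show ?thesis using that[OF z(2), of "fst z" "snd z"] z(1) by (auto simp: O'_def)
qed

text \<open>Divided by its largest singular value, the diagonal part tends to the first matrix unit,
  since all other ratios are squeezed by the second one. Along a subsequence the orthogonal factors
  converge as well, and the image line of the limit is the limit of the points
  \<open>cartan_point\<close>.\<close>

lemma proximal_limit_set_subset:
  fixes \<Gamma> :: "(real^'n^'n) set"
  assumes \<Gamma>: "\<Gamma> \<subseteq> carrier SL" and card: "CARD('n) \<ge> 2" and p: "p \<in> proximal_limit_set \<Gamma>"
  shows "\<exists>u f. u \<noteq> 0 \<and> f \<noteq> 0 \<and> outer u f \<in> cone_closure \<Gamma> \<and> p = pline u"
proof -
  obtain \<gamma> r where \<gamma>: "\<And>n. \<gamma> n \<in> \<Gamma>"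
    "filterlim (\<lambda>n. ln (sing_val (\<gamma> n) 1 / sing_val (\<gamma> n) 2)) at_top sequentially"
    "strict_mono r" "(\<lambda>n. cartan_point (\<gamma> (r n))) \<longlonglongrightarrow> p"
    using p unfolding proximal_limit_set_def by blast
  have "det (\<gamma> n) > 0" for n using subsetD[OF \<Gamma> \<gamma>(1)[of n]] by (simp add: SL_def)
  then have "\<forall>n. \<exists>k a l. cartan_decomposition (\<gamma> n) k a l" using ex_cartan_decomposition by blast
  then obtain k a l where cd: "\<And>n. cartan_decomposition (\<gamma> n) (k n) (a n) (l n)" by metis
  have o: "orthogonal_matrix (k n)" "orthogonal_matrix (l n)"
    and apos: "a n $ i > 0" and geq: "\<gamma> n = k n ** diag_matrix (a n) ** l n" for n i
    using cd[of n] by (auto simp: cartan_decomposition_def rotation_matrix_def)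
  obtain q k' l' where q: "strict_mono q" "(\<lambda>n. k (r (q n))) \<longlonglongrightarrow> k'" "(\<lambda>n. l (r (q n))) \<longlonglongrightarrow> l'"
    "orthogonal_matrix k'" "orthogonal_matrix l'"
    using orthogonal_subsequence[of "\<lambda>n. k (r n)" "\<lambda>n. l (r n)"] o by metis
  define t where "t n = r (q n)" for n
  have tm: "strict_mono t" using \<gamma>(3) q(1) by (simp add: t_def strict_mono_def)
  have lim: "filterlim (\<lambda>n. ln (a n $ coord 1 / a n $ coord 2)) at_top sequentially"
    using \<gamma>(2) sing_val_eq[OF cd] card by simp
  have "filterlim (\<lambda>n. exp (- ln (a n $ coord 1 / a n $ coord 2))) (nhds 0) sequentially"
    by (rule filterlim_compose[OF exp_at_bot]) (use lim in \<open>simp add: filterlim_uminus_at_bot\<close>)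
  moreover have "exp (- ln (a n $ coord 1 / a n $ coord 2)) = a n $ coord 2 / a n $ coord 1" for n
    using apos[of n] by (simp add: exp_minus)
  ultimately have "(\<lambda>n. a n $ coord 2 / a n $ coord 1) \<longlonglongrightarrow> 0" by simp
  then have rat: "(\<lambda>n. a (t n) $ coord 2 / a (t n) $ coord 1) \<longlonglongrightarrow> 0"
    using LIMSEQ_subseq_LIMSEQ[OF _ tm] by (simp add: o_def)
  have dl: "(\<lambda>n. inverse (a (t n) $ coord 1) *\<^sub>R diag_matrix (a (t n))) \<longlonglongrightarrow>
      outer (axis (coord 1) 1) (axis (coord 1) 1)"
  proof (intro vec_tendstoI)
    fix i j
    have 0: "(\<lambda>n. a (t n) $ i / a (t n) $ coord 1) \<longlonglongrightarrow> 0" if "i \<noteq> coord 1"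
    proof (rule tendsto_sandwich[OF _ _ tendsto_const rat])
      show "\<forall>\<^sub>F n in sequentially. 0 \<le> a (t n) $ i / a (t n) $ coord 1"
        using apos by (simp add: less_imp_le)
      show "\<forall>\<^sub>F n in sequentially. a (t n) $ i / a (t n) $ coord 1 \<le> a (t n) $ coord 2 / a (t n) $ coord 1"
        using apos cartan_decomposition_ord(2)[OF cd that] by (simp add: divide_right_mono less_imp_le)
    qed
    have 1: "a (t n) $ coord 1 \<noteq> 0" for n using apos less_irrefl by metis
    show "(\<lambda>n. (inverse (a (t n) $ coord 1) *\<^sub>R diag_matrix (a (t n))) $ i $ j)
        \<longlonglongrightarrow> outer (axis (coord 1) 1) (axis (coord 1) 1) $ i $ j"
      using 0 1 by (cases "i = j"; cases "i = coord 1")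
        (auto simp: diag_matrix_def outer_def axis_at divide_inverse mult.commute)
  qed
  have "(\<lambda>n. k (t n) ** (inverse (a (t n) $ coord 1) *\<^sub>R diag_matrix (a (t n))) ** l (t n)) \<longlonglongrightarrow>
      k' ** outer (axis (coord 1) 1) (axis (coord 1) 1) ** l'"
    by (intro tendsto_matrix_mult dl) (use q in \<open>simp_all add: t_def\<close>)
  moreover have "k (t n) ** (inverse (a (t n) $ coord 1) *\<^sub>R diag_matrix (a (t n))) ** l (t n) =
      inverse (a (t n) $ coord 1) *\<^sub>R \<gamma> (t n)" for n
    by (simp add: geq[of "t n"])
  ultimately have "(\<lambda>n. inverse (a (t n) $ coord 1) *\<^sub>R \<gamma> (t n)) \<longlonglongrightarrow>
      outer (k' *v axis (coord 1) 1) (axis (coord 1) 1 v* l')"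
    by (simp only: matrix_outer outer_matrix)
  then have mem: "outer (k' *v axis (coord 1) 1) (axis (coord 1) 1 v* l') \<in> cone_closure \<Gamma>"
    by (rule cone_closureI[OF \<gamma>(1)])
  have k0: "k' *v axis (coord 1) 1 \<noteq> 0"
    using q(4)[unfolded orthogonal_matrix_norm, rule_format, of "axis (coord 1) 1"] by (auto simp: norm_axis_1)
  have "transpose l' *v axis (coord 1) 1 \<noteq> 0"
    using q(5) orthogonal_matrix_norm[of "transpose l'"] norm_axis_1[of "coord 1"]
    by (metis norm_zero orthogonal_matrix_transpose zero_neq_one)
  then have l0: "axis (coord 1) 1 v* l' \<noteq> 0" by (simp add: transpose_matrix_vector)
  \<comment> \<open>Eventually the gap is strict, so that \<open>cartan_point\<close> can be
    computed from the chosen decomposition.\<close>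
  have "eventually (\<lambda>n. a (t n) $ coord 2 / a (t n) $ coord 1 < 1) sequentially"
    using order_tendstoD(2)[OF rat] by simp
  then have ev: "eventually (\<lambda>n. cartan_point (\<gamma> (t n)) = pline (k (t n) *v axis (coord 1) 1)) sequentially"
  proof (rule eventually_mono)
    fix n assume "a (t n) $ coord 2 / a (t n) $ coord 1 < 1"
    then have "a (t n) $ coord 2 < a (t n) $ coord 1" using apos[of "t n" "coord 1"] by (simp add: divide_less_eq)
    then show "cartan_point (\<gamma> (t n)) = pline (k (t n) *v axis (coord 1) 1)"
      using cartan_point_eq[OF cd] by blast
  qed
  have "(\<lambda>n. k (t n) *v axis (coord 1) 1) \<longlonglongrightarrow> k' *v axis (coord 1) 1"
    by (intro tendsto_matrix_vec tendsto_const) (use q in \<open>simp add: t_def\<close>)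
  then have "(\<lambda>n. pline (k (t n) *v axis (coord 1) 1)) \<longlonglongrightarrow> pline (k' *v axis (coord 1) 1)"
    using k0 by (rule tendsto_pline)
  then have "(\<lambda>n. cartan_point (\<gamma> (t n))) \<longlonglongrightarrow> pline (k' *v axis (coord 1) 1)"
    using tendsto_cong[OF ev] by blast
  moreover have "(\<lambda>n. cartan_point (\<gamma> (t n))) \<longlonglongrightarrow> p"
    using LIMSEQ_subseq_LIMSEQ[OF \<gamma>(4) q(1)] by (simp add: o_def t_def)
  ultimately have "p = pline (k' *v axis (coord 1) 1)" using LIMSEQ_unique by blast
  with mem k0 l0 show ?thesis by blast
qed

text \<open>Removing the orthogonal factors in the limit leaves a diagonal matrix of rank one, so a
  single nonzero entry. The ordering of the singular values puts it in first place, and the ratio of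
  the second to the first tends to zero whatever the scalars \<open>c\<close> are.\<close>

lemma rank_one_limit_in_proximal_limit_set:
  fixes \<Gamma> :: "(real^'n^'n) set"
  assumes \<Gamma>: "\<Gamma> \<subseteq> carrier SL" and card: "CARD('n) \<ge> 2" and u: "u \<noteq> 0" and f: "f \<noteq> 0"
    and mem: "outer u f \<in> cone_closure \<Gamma>"
  shows "pline u \<in> proximal_limit_set \<Gamma>"
proof -
  obtain c \<gamma> where \<gamma>: "\<And>n. \<gamma> n \<in> \<Gamma>" "(\<lambda>n. c n *\<^sub>R \<gamma> n) \<longlonglongrightarrow> outer u f"
    using cone_closureE[OF mem] by blast
  have "det (\<gamma> n) > 0" for n using subsetD[OF \<Gamma> \<gamma>(1)[of n]] by (simp add: SL_def)
  then have "\<forall>n. \<exists>k a l. cartan_decomposition (\<gamma> n) k a l" using ex_cartan_decomposition by blast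
  then obtain k a l where cd: "\<And>n. cartan_decomposition (\<gamma> n) (k n) (a n) (l n)" by metis
  have o: "orthogonal_matrix (k n)" "orthogonal_matrix (l n)"
    and apos: "a n $ i > 0" and geq: "\<gamma> n = k n ** diag_matrix (a n) ** l n" for n i
    using cd[of n] by (auto simp: cartan_decomposition_def rotation_matrix_def)
  obtain q k' l' where q: "strict_mono q" "(\<lambda>n. k (q n)) \<longlonglongrightarrow> k'" "(\<lambda>n. l (q n)) \<longlonglongrightarrow> l'"
    "orthogonal_matrix k'" "orthogonal_matrix l'"
    using orthogonal_subsequence[of k l] o by metis
  define v where "v = transpose k' *v u"
  define h where "h = f v* transpose l'"
  have "(\<lambda>n. transpose (k (q n)) ** (c (q n) *\<^sub>R \<gamma> (q n)) ** transpose (l (q n))) \<longlonglongrightarrow>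
      transpose k' ** outer u f ** transpose l'"
    using LIMSEQ_subseq_LIMSEQ[OF \<gamma>(2) q(1)] q
    by (intro tendsto_matrix_mult tendsto_transpose) (auto simp: o_def)
  moreover have "transpose (k m) ** (c m *\<^sub>R \<gamma> m) ** transpose (l m) = c m *\<^sub>R diag_matrix (a m)" for m
  proof -
    have "transpose (k m) ** (c m *\<^sub>R \<gamma> m) ** transpose (l m) =
      c m *\<^sub>R ((transpose (k m) ** k m) ** diag_matrix (a m) ** (l m ** transpose (l m)))"
      by (simp add: geq[of m] matrix_mul_assoc)
    then show ?thesis using o[of m] by (simp add: orthogonal_matrix_def)
  qed
  ultimately have lim: "(\<lambda>n. c (q n) *\<^sub>R diag_matrix (a (q n))) \<longlonglongrightarrow> outer v h"
    by (simp only: matrix_outer outer_matrix v_def h_def)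
  have ent: "(\<lambda>n. if i = j then c (q n) * a (q n) $ i else 0) \<longlonglongrightarrow> v $ i * h $ j" for i j
    using tendsto_vec_nth[OF tendsto_vec_nth[OF lim, of i], of j]
    by (simp add: diag_matrix_def outer_def if_distrib cong: if_cong)
  then have off: "v $ i * h $ j = 0" if "i \<noteq> j" for i j
  proof -
    have "(\<lambda>n. 0) \<longlonglongrightarrow> v $ i * h $ j" using that ent[of i j] by (simp only: if_False)
    then show ?thesis using LIMSEQ_unique tendsto_const by metis
  qed
  have dia: "(\<lambda>n. c (q n) * a (q n) $ i) \<longlonglongrightarrow> v $ i * h $ i" for i using ent[of i i] by simp
  have v0: "v \<noteq> 0"
  proof -
    have "orthogonal_matrix (transpose k')" using q(4) by simp
    then have "norm v = norm u" unfolding v_def orthogonal_matrix_norm by blast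
    then show ?thesis using u by (metis norm_eq_zero)
  qed
  have h0: "h \<noteq> 0"
  proof -
    have "norm h = norm f"
      using q(5) unfolding h_def vector_transpose_matrix orthogonal_matrix_norm by blast
    then show ?thesis using f by (metis norm_eq_zero)
  qed
  obtain i where i: "v $ i \<noteq> 0" using v0 by (auto simp: vec_eq_iff)
  have hj: "h $ j = 0" if "j \<noteq> i" for j using off[of i j] i that by auto
  have hi: "h $ i \<noteq> 0"
  proof
    assume "h $ i = 0"
    then have "h $ j = 0" for j using hj by (cases "j = i") auto
    then show False using h0 by (simp add: vec_eq_iff)
  qed
  have vj: "v $ j = 0" if "j \<noteq> i" for j using off[of j i] hi that by auto
  have "i = coord 1"
  proof (rule ccontr)
    assume ne: "i \<noteq> coord 1"
    \<comment> \<open>The scalars \<open>c\<close> may have either sign, hence the absolute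
      values.\<close>
    have "\<bar>v $ i * h $ i\<bar> \<le> \<bar>v $ coord 1 * h $ coord 1\<bar>"
    proof (rule LIMSEQ_le[OF tendsto_rabs[OF dia] tendsto_rabs[OF dia]], intro exI allI impI)
      fix n show "\<bar>c (q n) * a (q n) $ i\<bar> \<le> \<bar>c (q n) * a (q n) $ coord 1\<bar>"
        using cartan_decomposition_ord(1)[OF cd, of "q n" i] apos[of "q n" i]
        by (auto simp: abs_mult intro!: mult_left_mono)
    qed
    then show False using i hi vj[of "coord 1"] ne by simp
  qed
  have neq: "(coord 2 :: 'n) \<noteq> coord 1" using card by (subst coord_eq_iff) auto
  have "(\<lambda>n. (c (q n) * a (q n) $ coord 2) / (c (q n) * a (q n) $ coord 1)) \<longlonglongrightarrow>
      (v $ coord 2 * h $ coord 2) / (v $ coord 1 * h $ coord 1)"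
    using i hi \<open>i = coord 1\<close> by (intro tendsto_divide dia) auto
  then have *: "(\<lambda>n. (c (q n) * a (q n) $ coord 2) / (c (q n) * a (q n) $ coord 1)) \<longlonglongrightarrow> 0"
    using vj[of "coord 2"] neq \<open>i = coord 1\<close> by simp
  have "eventually (\<lambda>n. c (q n) * a (q n) $ coord 1 \<noteq> 0) sequentially"
    by (rule tendsto_imp_eventually_ne[OF dia]) (use i hi \<open>i = coord 1\<close> in auto)
  then have "eventually (\<lambda>n. (c (q n) * a (q n) $ coord 2) / (c (q n) * a (q n) $ coord 1) =
      a (q n) $ coord 2 / a (q n) $ coord 1) sequentially"
    by (rule eventually_mono) auto
  from iffD1[OF tendsto_cong[OF this] *]
  have rat: "(\<lambda>n. a (q n) $ coord 2 / a (q n) $ coord 1) \<longlonglongrightarrow> 0" .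
  have "filterlim (\<lambda>n. a (q n) $ coord 2 / a (q n) $ coord 1) (at_right 0) sequentially"
    by (rule tendsto_imp_filterlim_at_right[OF rat]) (simp add: apos)
  from filterlim_compose[OF ln_at_0 this]
  have "filterlim (\<lambda>n. - ln (a (q n) $ coord 2 / a (q n) $ coord 1)) at_top sequentially"
    by (simp add: filterlim_uminus_at_bot)
  moreover have "- ln (a m $ coord 2 / a m $ coord 1) = ln (a m $ coord 1 / a m $ coord 2)" for m
    using apos[of m "coord 1"] apos[of m "coord 2"] by (simp add: ln_div)
  ultimately have fl: "filterlim (\<lambda>n. ln (sing_val (\<gamma> (q n)) 1 / sing_val (\<gamma> (q n)) 2)) at_top sequentially"
    using sing_val_eq[OF cd] card by simp
  have "eventually (\<lambda>n. a (q n) $ coord 2 / a (q n) $ coord 1 < 1) sequentially"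
    using order_tendstoD(2)[OF rat] by simp
  then have ev: "eventually (\<lambda>n. cartan_point (\<gamma> (q n)) = pline (k (q n) *v axis (coord 1) 1)) sequentially"
  proof (rule eventually_mono)
    fix n assume "a (q n) $ coord 2 / a (q n) $ coord 1 < 1"
    then have "a (q n) $ coord 2 < a (q n) $ coord 1" using apos[of "q n" "coord 1"] by (simp add: divide_less_eq)
    then show "cartan_point (\<gamma> (q n)) = pline (k (q n) *v axis (coord 1) 1)"
      using cartan_point_eq[OF cd] by blast
  qed
  have k0: "k' *v axis (coord 1) 1 \<noteq> 0"
    using q(4)[unfolded orthogonal_matrix_norm, rule_format, of "axis (coord 1) 1"] by (auto simp: norm_axis_1)
  have "(\<lambda>n. pline (k (q n) *v axis (coord 1) 1)) \<longlonglongrightarrow> pline (k' *v axis (coord 1) 1)"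
    by (intro tendsto_pline tendsto_matrix_vec tendsto_const q k0)
  then have cp: "(\<lambda>n. cartan_point (\<gamma> (q n))) \<longlonglongrightarrow> pline (k' *v axis (coord 1) 1)"
    using tendsto_cong[OF ev] by blast
  have "v = v $ coord 1 *\<^sub>R axis (coord 1) 1" using vj \<open>i = coord 1\<close> by (auto simp: vec_eq_iff axis_at)
  moreover have "u = k' *v v" using q(4) unfolding v_def matrix_vector_mul_assoc orthogonal_matrix_def by (metis matrix_vector_mul_lid)
  ultimately have "u = v $ coord 1 *\<^sub>R (k' *v axis (coord 1) 1)" by (metis matrix_vec_scaleR)
  then have "pline u = pline (k' *v axis (coord 1) 1)" using i \<open>i = coord 1\<close> k0 pline_scaleR by metis
  with cp have "(\<lambda>n. cartan_point (\<gamma> (q (id n)))) \<longlonglongrightarrow> pline u" by simp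
  then show ?thesis unfolding proximal_limit_set_def using \<gamma>(1) fl strict_mono_id
    by (auto intro!: exI[of _ "\<lambda>n. \<gamma> (q n)"] exI[of _ id])
qed

text \<open>Points of the limit set correspond to rank one limits \<open>outer u f\<close>.
  Normalising \<open>f\<close> to length one prevents these from degenerating; compactness of the
  sphere and closedness of \<open>cone_closure\<close> then allow passing to the limit.\<close>

lemma closed_proximal_limit_set:
  fixes \<Gamma> :: "(real^'n^'n) set"
  assumes \<Gamma>: "\<Gamma> \<subseteq> carrier SL" and card: "CARD('n) \<ge> 2"
  shows "closed (proximal_limit_set \<Gamma>)"
proof -
  define \<Lambda> where "\<Lambda> = proximal_limit_set \<Gamma>"
  \<comment> \<open>Adding the origin makes the cone of representatives closed in the whole space,
    so sequences suffice.\<close>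
  have "closed (insert 0 {v :: real^'n. v \<noteq> 0 \<and> pline v \<in> \<Lambda>})"
    unfolding closed_sequential_limits
  proof (intro allI impI)
    fix x and v :: "real^'n" assume x: "(\<forall>n. x n \<in> insert 0 {v. v \<noteq> 0 \<and> pline v \<in> \<Lambda>}) \<and> x \<longlonglongrightarrow> v"
    show "v \<in> insert 0 {v. v \<noteq> 0 \<and> pline v \<in> \<Lambda>}"
    proof (cases "v = 0")
      case False
      then have ev: "eventually (\<lambda>n. x n \<noteq> 0) sequentially" using x tendsto_imp_eventually_ne by blast
      then obtain N where N: "\<And>n. n \<ge> N \<Longrightarrow> x n \<noteq> 0" unfolding eventually_sequentially by blast
      define y where "y n = x (n + N)" for n
      have y: "y \<longlonglongrightarrow> v" "y n \<noteq> 0" "pline (y n) \<in> \<Lambda>" for n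
        using x N[of "n + N"] LIMSEQ_ignore_initial_segment[of x v N] unfolding y_def by auto
      have "\<exists>f. norm f = 1 \<and> outer (y n) f \<in> cone_closure \<Gamma>" for n
      proof -
        obtain u f where uf: "u \<noteq> 0" "f \<noteq> 0" "outer u f \<in> cone_closure \<Gamma>" "pline (y n) = pline u"
          using proximal_limit_set_subset[OF \<Gamma> card] y(3) by (metis \<Lambda>_def)
        then obtain c where c: "y n = c *\<^sub>R u" using y(2) pline_eq_iff by metis
        obtain d g where dg: "\<And>m. g m \<in> \<Gamma>" "(\<lambda>m. d m *\<^sub>R g m) \<longlonglongrightarrow> outer u f"
          using cone_closureE[OF uf(3)] by blast
        have "(\<lambda>m. (c / norm f * d m) *\<^sub>R g m) \<longlonglongrightarrow> (c / norm f) *\<^sub>R outer u f"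
          using tendsto_scaleR[OF tendsto_const dg(2), of "c / norm f"] by simp
        then have "(c / norm f) *\<^sub>R outer u f \<in> cone_closure \<Gamma>" by (rule cone_closureI[OF dg(1)])
        moreover have "(c / norm f) *\<^sub>R outer u f = outer (y n) (inverse (norm f) *\<^sub>R f)"
          by (simp add: c outer_scaleR divide_inverse)
        ultimately show ?thesis using uf(2) by (intro exI[of _ "inverse (norm f) *\<^sub>R f"]) simp
      qed
      then obtain f where f: "\<And>n. norm (f n) = 1" "\<And>n. outer (y n) (f n) \<in> cone_closure \<Gamma>" by metis
      have "compact (sphere 0 1 :: (real^'n) set)" by simp
      moreover have "\<forall>n. f n \<in> sphere 0 1" using f by simp
      ultimately obtain h r where h: "h \<in> sphere 0 1" "strict_mono r" "(f \<circ> r) \<longlonglongrightarrow> h"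
        unfolding compact_def by meson
      have "(\<lambda>n. outer (y (r n)) (f (r n))) \<longlonglongrightarrow> outer v h"
        by (intro tendsto_outer) (use LIMSEQ_subseq_LIMSEQ[OF y(1) h(2)] h(3) in \<open>simp_all add: o_def\<close>)
      then have "outer v h \<in> cone_closure \<Gamma>"
        using f(2) unfolding cone_closure_def
        by (intro Lim_in_closed_set[OF closed_closure _ trivial_limit_sequentially]) auto
      moreover have "h \<noteq> 0" using h(1) by auto
      ultimately show ?thesis
        using rank_one_limit_in_proximal_limit_set[OF \<Gamma> card False] by (simp add: \<Lambda>_def)
    qed simp
  qed
  then have "open (- insert 0 {v :: real^'n. v \<noteq> 0 \<and> pline v \<in> \<Lambda>})" by (simp only: closed_def)
  moreover have "- insert 0 {v :: real^'n. v \<noteq> 0 \<and> pline v \<in> \<Lambda>} = {v. v \<noteq> 0 \<and> pline v \<in> - \<Lambda>}" by auto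
  ultimately show ?thesis by (simp add: closed_def open_proj_def \<Lambda>_def)
qed

section \<open>Dynamics of cone automorphisms\<close>

lemma not_eventually_subsequence:
  assumes "\<not> eventually Q sequentially"
  shows "\<exists>r :: nat \<Rightarrow> nat. strict_mono r \<and> (\<forall>n. \<not> Q (r n))"
proof -
  have "infinite {n. \<not> Q n}"
    using assms unfolding eventually_sequentially infinite_nat_iff_unbounded_le by simp
  from infinite_enumerate[OF this] show ?thesis by simp
qed

text \<open>Failure would give counterexamples along a subsequence. By compactness they may be taken
  convergent, while the premise then produces an index at which the property holds.\<close>

lemma eventually_compactI:
  fixes P :: "nat \<Rightarrow> 'a::metric_space \<Rightarrow> bool"
  assumes S: "compact S"
    and P: "\<And>r v l. strict_mono r \<Longrightarrow> (\<And>n. v n \<in> S) \<Longrightarrow> v \<longlonglongrightarrow> l \<Longrightarrow> l \<in> S \<Longrightarrow>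
      \<exists>n. P (r n) (v n)"
  shows "eventually (\<lambda>n. \<forall>v\<in>S. P n v) sequentially"
proof (rule ccontr)
  assume "\<not> ?thesis"
  from not_eventually_subsequence[OF this] obtain r :: "nat \<Rightarrow> nat"
    where r: "strict_mono r" "\<forall>n. \<not> (\<forall>v\<in>S. P (r n) v)" by auto
  then have "\<forall>n. \<exists>v. v \<in> S \<and> \<not> P (r n) v" by blast
  then obtain v where v: "\<And>n. v n \<in> S \<and> \<not> P (r n) (v n)" by metis
  then obtain l q where q: "l \<in> S" "strict_mono q" "(v \<circ> q) \<longlonglongrightarrow> l"
    using S unfolding compact_def by meson
  have "\<exists>n. P ((r \<circ> q) n) ((v \<circ> q) n)"
    by (rule P[OF strict_mono_o[OF r(1) q(2)] _ q(3,1)]) (simp add: v)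
  then show False using v by auto
qed

lemma bounded_unique_limit:
  fixes X :: "nat \<Rightarrow> 'a::euclidean_space"
  assumes bd: "bounded (range X)"
    and uniq: "\<And>r l. strict_mono r \<Longrightarrow> (\<lambda>n. X (r n)) \<longlonglongrightarrow> l \<Longrightarrow> l = L"
  shows "X \<longlonglongrightarrow> L"
proof (rule ccontr)
  assume "\<not> X \<longlonglongrightarrow> L"
  then obtain d where d: "d > 0" "\<not> eventually (\<lambda>n. dist (X n) L < d) sequentially"
    unfolding tendsto_iff by blast
  from not_eventually_subsequence[OF d(2)] obtain r :: "nat \<Rightarrow> nat"
    where r: "strict_mono r" "\<forall>n. \<not> dist (X (r n)) L < d" by auto
  have "bounded (range (X \<circ> r))" using bd by (rule bounded_subset) auto
  then obtain l q where q: "strict_mono q" "((X \<circ> r) \<circ> q) \<longlonglongrightarrow> l"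
    using bounded_imp_convergent_subsequence by blast
  have "l = L" by (rule uniq[OF strict_mono_o[OF r(1) q(1)]]) (use q(2) in \<open>simp add: o_def\<close>)
  then have "eventually (\<lambda>n. dist (X (r (q n))) L < d) sequentially"
    using tendstoD[OF q(2)] d(1) by (simp add: o_def)
  then obtain n where "dist (X (r (q n))) L < d" using eventually_happens'[OF sequentially_bot] by blast
  then show False using r(2) by simp
qed

lemma LIMSEQ_eqI:
  fixes X :: "nat \<Rightarrow> 'a::t2_space"
  assumes "X \<longlonglongrightarrow> a" "Y \<longlonglongrightarrow> b" "\<And>n. X n = Y n"
  shows "a = b"
proof -
  have "X = Y" using assms(3) by (rule ext)
  then show ?thesis using assms(1,2) LIMSEQ_unique by blast
qed

section \<open>Half triangles and automorphisms of a cone\<close>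

context sharp_cone begin

text \<open>For \<open>a\<close> and \<open>b\<close> in the closed cone the sum stands for the open
  segment to \<open>z\<close>, by \<open>C_pos_comb\<close>, so the projective condition needs
  neither segments nor normalisations. Vectors \<open>z\<close> in the open cone satisfy it
  trivially.\<close>

definition no_half_triangle :: "real^'n \<Rightarrow> real^'n \<Rightarrow> bool" where
  "no_half_triangle a b \<longleftrightarrow> (\<forall>z\<in>K. z \<noteq> 0 \<longrightarrow> a + z \<in> C \<or> b + z \<in> C)"

definition auts :: "(real^'n^'n) set" where
  "auts = {g. invertible g \<and> (\<forall>v. g *v v \<in> C \<longleftrightarrow> v \<in> C)}"

lemma no_half_triangle_sym: "no_half_triangle a b \<Longrightarrow> no_half_triangle b a"
  by (auto simp: no_half_triangle_def)

text \<open>The condition is tested at \<open>z = a\<close>; its first alternative would already put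
  \<open>a\<close> itself into the open cone.\<close>

lemma no_half_triangle_sum:
  assumes "no_half_triangle a b" "a \<in> K" "b \<in> K" "a \<noteq> 0"
  shows "a + b \<in> C"
proof -
  consider "a + a \<in> C" | "b + a \<in> C" using assms by (auto simp: no_half_triangle_def)
  then show ?thesis
  proof cases
    case 1
    then have "a \<in> C" using C_scale_iff[of 2 a] by (simp add: scaleR_2)
    then show ?thesis using assms C_add_K by blast
  qed (simp add: add.commute)
qed

lemma auts_C: "g \<in> auts \<Longrightarrow> g *v v \<in> C \<longleftrightarrow> v \<in> C"
  by (simp add: auts_def)

lemma auts_inv: "g \<in> auts \<Longrightarrow> invertible g"
  by (simp add: auts_def)

lemma auts_K: "g \<in> auts \<Longrightarrow> v \<in> K \<Longrightarrow> g *v v \<in> K"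
proof -
  assume g: "g \<in> auts" and "v \<in> K"
  then obtain s where s: "\<forall>n. s n \<in> C" "s \<longlonglongrightarrow> v" by (auto simp: K_lim)
  then have "(\<lambda>n. g *v s n) \<longlonglongrightarrow> g *v v" "\<forall>n. g *v s n \<in> C"
    using g by (auto intro: tendsto_intros simp: auts_C)
  then show "g *v v \<in> K" unfolding K_lim by (intro exI[of _ "\<lambda>n. g *v s n"] conjI)
qed

lemma auts_nonzero: "g \<in> auts \<Longrightarrow> v \<noteq> 0 \<Longrightarrow> g *v v \<noteq> 0"
  using auts_inv by (metis invertible_left_inverse matrix_left_invertible_ker)

lemma auts_mult: "g \<in> auts \<Longrightarrow> h \<in> auts \<Longrightarrow> g ** h \<in> auts"
  by (simp add: auts_def invertible_mult flip: matrix_vector_mul_assoc)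

lemma auts_inverse: "g \<in> auts \<Longrightarrow> g ** h = mat 1 \<Longrightarrow> h \<in> auts"
proof -
  assume g: "g \<in> auts" and gh: "g ** h = mat 1"
  have "invertible h" using gh by (metis invertible_def matrix_left_right_inverse)
  moreover have "h *v v \<in> C \<longleftrightarrow> v \<in> C" for v
    using auts_C[OF g, of "h *v v"] gh by (simp add: matrix_vector_mul_assoc)
  ultimately show ?thesis by (simp add: auts_def)
qed

lemma auts_scaleR: "g \<in> auts \<Longrightarrow> 0 < c \<Longrightarrow> c *\<^sub>R g \<in> auts"
proof -
  assume g: "g \<in> auts" "0 < c"
  obtain h where h: "g ** h = mat 1" "h ** g = mat 1" using auts_inv[OF g(1)] unfolding invertible_def by blast
  then have "invertible (c *\<^sub>R g)" unfolding invertible_def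
    using g(2) by (intro exI[of _ "inverse c *\<^sub>R h"]) simp
  then show ?thesis using g by (simp add: auts_def C_scale_iff)
qed

lemma mat1_auts: "mat 1 \<in> auts"
  by (auto simp: auts_def invertible_def intro: exI[of _ "mat 1"])

lemma mpow_auts: "g \<in> auts \<Longrightarrow> mpow g n \<in> auts"
  by (induction n) (simp_all add: mat1_auts auts_mult)

text \<open>If \<open>x + v\<close> and \<open>x - v\<close> lie in \<open>C\<close>, then
  \<open>g *v v\<close> lies between \<open>- (g *v x)\<close> and \<open>g *v x\<close> in the
  order given by the closed cone. Sharpness turns this order bound into a norm bound, with a
  constant independent of \<open>g\<close>.\<close>

lemma norm_le_norm_at_interior_point:
  assumes "x \<in> C"
  obtains B where "B \<ge> 0" "\<And>g. (\<And>v. v \<in> C \<Longrightarrow> g *v v \<in> K) \<Longrightarrow> norm (g :: real^'n^'n) \<le> B * norm (g *v x)"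
proof -
  obtain r where r: "r > 0" "cball x r \<subseteq> C" using open_C assms open_contains_cball by blast
  define B' where "B' = (2 * R * norm e + 1) / r"
  have B': "B' \<ge> 0" using R_pos r by (simp add: B'_def)
  have "norm g \<le> real CARD('n) * (real CARD('n) * B') * norm (g *v x)"
    if g: "\<And>v. v \<in> C \<Longrightarrow> g *v v \<in> K" for g :: "real^'n^'n"
  proof -
    have "norm (g *v axis j 1) \<le> B' * norm (g *v x)" for j
    proof -
      define v :: "real^'n" where "v = r *\<^sub>R axis j 1"
      have "x + v \<in> C" "x - v \<in> C"
        using r by (auto intro!: subsetD[OF r(2)] simp: v_def dist_norm norm_axis_1)
      then have p: "g *v x + g *v v \<in> K" "g *v x - g *v v \<in> K"
        using g[of "x + v"] g[of "x - v"] by (simp_all add: matrix_vec_add matrix_vector_mult_diff_distrib)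
      have "0 \<le> e \<bullet> (g *v x - g *v v)" using K_pos[OF p(2)] by (cases "g *v x - g *v v = 0") auto
      then have ev: "e \<bullet> (g *v v) \<le> e \<bullet> (g *v x)" by (simp add: inner_diff_right)
      have "norm (g *v v) \<le> norm (g *v x + g *v v) + norm (g *v x)"
        using norm_triangle_ineq4[of "g *v x + g *v v" "g *v x"] by simp
      also have "norm (g *v x + g *v v) \<le> R * (e \<bullet> (g *v x + g *v v))" by (rule K_bound[OF p(1)])
      also have "\<dots> \<le> R * (2 * (e \<bullet> (g *v x)))"
        using ev R_pos by (intro mult_left_mono) (auto simp: inner_add_right)
      also have "\<dots> \<le> R * (2 * (norm e * norm (g *v x)))"
        using R_pos norm_cauchy_schwarz[of e "g *v x"] by (intro mult_left_mono) auto
      finally have "norm (g *v v) \<le> (2 * R * norm e + 1) * norm (g *v x)" by (simp add: algebra_simps)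
      moreover have "norm (g *v v) = r * norm (g *v axis j 1)" using r by (simp add: v_def)
      ultimately show ?thesis using r by (simp add: B'_def field_simps)
    qed
    from norm_matrix_le[OF this] show ?thesis by (simp add: mult_ac)
  qed
  then show ?thesis using that[of "real CARD('n) * (real CARD('n) * B')"] B' by (simp add: zero_le_mult_iff)
qed

text \<open>Nothing is required of the remaining spectrum: that \<alpha> and \<beta> are extremal is
  a consequence of the half triangle condition.\<close>

definition biprox :: "real^'n^'n \<Rightarrow> real^'n \<Rightarrow> real^'n \<Rightarrow> real \<Rightarrow> real \<Rightarrow> bool" where
  "biprox g a b \<alpha> \<beta> \<longleftrightarrow> g \<in> auts \<and> a \<in> K \<and> b \<in> K \<and> a \<noteq> 0 \<and> b \<noteq> 0 \<and> no_half_triangle a b \<and>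
     g *v a = \<alpha> *\<^sub>R a \<and> g *v b = \<beta> *\<^sub>R b \<and> 0 < \<beta> \<and> \<beta> < \<alpha>"

text \<open>Limits of powers of \<open>h\<close> fix \<open>a\<close> and kill \<open>b\<close>; a further fixed direction would span, together
  with \<open>a\<close>, a plane whose intersection with the closed cone has a boundary ray forming a half
  triangle with \<open>a\<close> and \<open>b\<close>.\<close>

lemma biprox_limit_fixed:
  assumes h: "biprox h a b 1 \<beta>" and m: "\<And>n. m n \<ge> n" and E: "(\<lambda>n. mpow h (m n)) \<longlonglongrightarrow> E"
  shows "E *v a = a" "E *v b = 0" "x \<in> K \<Longrightarrow> E *v x \<in> K" "E *v x \<notin> C"
    "E *v v = v \<Longrightarrow> \<exists>c. v = c *\<^sub>R a"
proof -
  note hb = h[unfolded biprox_def]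
  have Ex: "(\<lambda>n. mpow h (m n) *v x) \<longlonglongrightarrow> E *v x" for x by (intro tendsto_intros E)
  show Ea: "E *v a = a"
    by (rule LIMSEQ_eqI[OF Ex tendsto_const]) (use mpow_eigen[of h a 1] hb in simp)
  have "(\<lambda>n. \<beta> ^ m n) \<longlonglongrightarrow> 0"
  proof (rule tendsto_sandwich[OF _ _ tendsto_const LIMSEQ_realpow_zero[of \<beta>]])
    show "\<forall>\<^sub>F n in sequentially. 0 \<le> \<beta> ^ m n" using hb by simp
    show "\<forall>\<^sub>F n in sequentially. \<beta> ^ m n \<le> \<beta> ^ n"
      using hb m by (intro always_eventually allI power_decreasing) auto
  qed (use hb in auto)
  then have "(\<lambda>n. \<beta> ^ m n *\<^sub>R b) \<longlonglongrightarrow> 0 *\<^sub>R b" by (intro tendsto_intros)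
  from LIMSEQ_eqI[OF Ex this] show Eb: "E *v b = 0" using mpow_eigen[of h b \<beta>] hb by simp
  show EK: "E *v x \<in> K" if "x \<in> K" for x
    by (rule K_limI[OF _ Ex]) (use auts_K[OF mpow_auts] hb that in blast)
  show EC: "E *v x \<notin> C" for x
  proof
    assume EC: "E *v x \<in> C"
    \<comment> \<open>\<open>E\<close> kills \<open>b\<close>, so it sends the whole line through
      \<open>x\<close> in direction \<open>b\<close> into \<open>C\<close>. At each point of the
      line some power of \<open>h\<close> already has its value in \<open>C\<close>, and powers
      preserve \<open>C\<close> in both directions.\<close>
    have line: "x - t *\<^sub>R b \<in> C" for t
    proof -
      have "E *v (x - t *\<^sub>R b) \<in> C" using EC Eb by (simp add: matrix_vector_mult_diff_distrib)
      then have "eventually (\<lambda>n. mpow h (m n) *v (x - t *\<^sub>R b) \<in> C) sequentially"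
        using topological_tendstoD[OF Ex open_C] by blast
      then obtain n where "mpow h (m n) *v (x - t *\<^sub>R b) \<in> C"
        using eventually_happens'[OF sequentially_bot] by blast
      then show ?thesis using auts_C[OF mpow_auts] hb by blast
    qed
    have "- b \<in> K"
    proof (rule K_limI)
      show "inverse (real (Suc n)) *\<^sub>R x - b \<in> K" for n
      proof -
        have "inverse (real (Suc n)) *\<^sub>R (x - real (Suc n) *\<^sub>R b) \<in> C" by (intro scale line) simp
        moreover have "inverse (real (Suc n)) *\<^sub>R (x - real (Suc n) *\<^sub>R b) = inverse (real (Suc n)) *\<^sub>R x - b"
          unfolding scaleR_diff_right by simp
        ultimately show ?thesis using C_K by simp
      qed
      have "(\<lambda>n. inverse (real (Suc n)) *\<^sub>R x - b) \<longlonglongrightarrow> 0 *\<^sub>R x - b"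
        by (intro tendsto_intros LIMSEQ_inverse_real_of_nat)
      then show "(\<lambda>n. inverse (real (Suc n)) *\<^sub>R x - b) \<longlonglongrightarrow> - b" by simp
    qed
    then show False using hb K_antisym by blast
  qed
  have main: "\<exists>c. v = c *\<^sub>R a" if Ev: "E *v v = v" and vK: "v \<notin> K" for v
  proof (rule ccontr)
    assume no: "\<not> (\<exists>c. v = c *\<^sub>R a)"
    \<comment> \<open>Since \<open>v\<close> is not in the closed cone, the half line from
      \<open>a\<close> in direction \<open>v\<close> leaves it; its last point \<open>z\<close>
      spans the critical boundary ray.\<close>
    define S where "S = {t. 0 \<le> t \<and> a + t *\<^sub>R v \<in> K}"
    have "closed S"
    proof -
      have "S = {0..} \<inter> (\<lambda>t. a + t *\<^sub>R v) -` K" by (auto simp: S_def)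
      moreover have "closed ((\<lambda>t. a + t *\<^sub>R v) -` K)"
        by (intro continuous_closed_vimage K_closed continuous_intros)
      ultimately show ?thesis by (simp add: closed_Int)
    qed
    moreover have "bounded S"
    proof (rule ccontr)
      assume nb: "\<not> bounded S"
      have "\<exists>t\<in>S. t \<ge> real (Suc n)" for n
      proof (rule ccontr)
        assume "\<not> (\<exists>t\<in>S. t \<ge> real (Suc n))"
        then have "\<forall>t\<in>S. norm t \<le> real (Suc n)" by (force simp: S_def)
        then show False using nb bounded_iff by blast
      qed
      then obtain t where t: "\<And>n. t n \<in> S \<and> t n \<ge> real (Suc n)" by metis
      have it: "(\<lambda>n. inverse (t n)) \<longlonglongrightarrow> 0"
      proof (rule tendsto_sandwich[OF _ _ tendsto_const LIMSEQ_inverse_real_of_nat])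
        show "\<forall>\<^sub>F n in sequentially. 0 \<le> inverse (t n)" using t by (simp add: S_def)
        show "\<forall>\<^sub>F n in sequentially. inverse (t n) \<le> inverse (real (Suc n))"
          using t by (intro always_eventually allI le_imp_inverse_le) auto
      qed
      have "v \<in> K"
      proof (rule K_limI)
        show "inverse (t n) *\<^sub>R a + v \<in> K" for n
        proof -
          have tn: "t n > 0" using t[of n] by simp
          have "inverse (t n) *\<^sub>R (a + t n *\<^sub>R v) \<in> K"
            using t[of n] tn by (intro K_scale) (auto simp: S_def)
          then show ?thesis using tn by (simp add: scaleR_add_right)
        qed
        have "(\<lambda>n. inverse (t n) *\<^sub>R a + v) \<longlonglongrightarrow> 0 *\<^sub>R a + v" by (intro tendsto_intros it)
        then show "(\<lambda>n. inverse (t n) *\<^sub>R a + v) \<longlonglongrightarrow> v" by simp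
      qed
      then show False using vK by simp
    qed
    ultimately have "compact S" by (simp add: compact_eq_bounded_closed)
    moreover have "0 \<in> S" using hb by (simp add: S_def)
    ultimately obtain T where T: "T \<in> S" "\<And>t. t \<in> S \<Longrightarrow> t \<le> T"
      using compact_attains_sup[of S] by blast
    define z where "z = a + T *\<^sub>R v"
    have z: "z \<in> K" "E *v z = z" using T(1) Ea Ev by (simp_all add: z_def S_def matrix_vec_add)
    have "z \<noteq> 0"
    proof
      assume "z = 0"
      then have Tv: "T *\<^sub>R v = - a" by (simp add: z_def eq_neg_iff_add_eq_0 add.commute)
      then have "T \<noteq> 0" using hb by auto
      then have "v = (- inverse T) *\<^sub>R a"
      proof -
        have "v = inverse T *\<^sub>R (T *\<^sub>R v)" using \<open>T \<noteq> 0\<close> by simp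
        then show ?thesis by (simp add: Tv)
      qed
      with no show False by blast
    qed
    \<comment> \<open>In the first case \<open>E\<close> would fix a point of \<open>C\<close>. In
      the second there is room to move from \<open>b + z\<close> along \<open>v\<close>; applying
      \<open>E\<close> removes \<open>b\<close> and gives a point of the closed cone beyond
      \<open>z\<close>.\<close>
    then consider "a + z \<in> C" | "b + z \<in> C" using hb z unfolding no_half_triangle_def by blast
    then show False
    proof cases
      case 1
      have "E *v (a + z) = a + z" by (simp add: matrix_vec_add Ea z)
      with 1 EC show False by metis
    next
      case 2
      have "(\<lambda>n. b + z + inverse (real (Suc n)) *\<^sub>R v) \<longlonglongrightarrow> b + z + 0 *\<^sub>R v"
        by (intro tendsto_intros LIMSEQ_inverse_real_of_nat)
      then have "eventually (\<lambda>n. b + z + inverse (real (Suc n)) *\<^sub>R v \<in> C) sequentially"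
        using topological_tendstoD[OF _ open_C, of "\<lambda>n. b + z + inverse (real (Suc n)) *\<^sub>R v" "b + z"] 2 by simp
      then obtain n where n: "b + z + inverse (real (Suc n)) *\<^sub>R v \<in> C"
        using eventually_happens'[OF sequentially_bot] by blast
      have "E *v (b + z + inverse (real (Suc n)) *\<^sub>R v) \<in> K" using n C_K EK by blast
      then have "a + (T + inverse (real (Suc n))) *\<^sub>R v \<in> K"
        by (simp add: matrix_vec_add Eb z Ev) (simp add: z_def scaleR_add_left add.assoc)
      then have "T + inverse (real (Suc n)) \<in> S" using T(1) by (simp add: S_def)
      from T(2)[OF this] show False by simp
    qed
  qed
  show "\<exists>c. v = c *\<^sub>R a" if Ev: "E *v v = v" for v
  proof (cases "v \<in> K")
    case False with main Ev show ?thesis by blast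
  next
    case True
    show ?thesis
    proof (cases "v = 0")
      case True then show ?thesis by (intro exI[of _ 0]) simp
    next
      case False
      then have "- v \<notin> K" using True K_antisym by blast
      moreover have "E *v (- v) = - v" using Ev matrix_vec_scaleR[of E "-1" v] by simp
      ultimately obtain c where "- v = c *\<^sub>R a" using main by blast
      then have "v = (- c) *\<^sub>R a" by (metis minus_minus scaleR_minus_left)
      then show ?thesis by blast
    qed
  qed
qed

text \<open>The interior vector \<open>a + b\<close> has the bounded orbit
  \<open>a + \<beta> ^ n *\<^sub>R b\<close>, and the value at an interior point controls the
  norm.\<close>

lemma biprox_bounded:
  assumes h: "biprox h a b 1 \<beta>"
  shows "bounded (range (mpow h))"
proof -
  note hb = h[unfolded biprox_def]
  have ab: "a + b \<in> C" using hb no_half_triangle_sum by blast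
  obtain B where B: "B \<ge> 0"
    "\<And>g. (\<And>v. v \<in> C \<Longrightarrow> g *v v \<in> K) \<Longrightarrow> norm (g :: real^'n^'n) \<le> B * norm (g *v (a + b))"
    using norm_le_norm_at_interior_point[OF ab] by blast
  have "norm (mpow h n) \<le> B * (norm a + norm b)" for n
  proof -
    have "norm (mpow h n) \<le> B * norm (mpow h n *v (a + b))"
      by (rule B(2)) (use auts_C[OF mpow_auts] hb C_K in blast)
    also have "mpow h n *v (a + b) = a + \<beta> ^ n *\<^sub>R b"
      using mpow_eigen[of h a 1 n] mpow_eigen[of h b \<beta> n] hb by (simp add: matrix_vec_add)
    also have "norm (a + \<beta> ^ n *\<^sub>R b) \<le> norm a + \<beta> ^ n * norm b"
      using norm_triangle_ineq[of a "\<beta> ^ n *\<^sub>R b"] hb by simp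
    also have "\<dots> \<le> norm a + 1 * norm b"
      using hb by (intro add_left_mono mult_right_mono power_le_one) auto
    finally show ?thesis using B(1) by (simp add: mult_left_mono)
  qed
  then show ?thesis unfolding bounded_iff by blast
qed

text \<open>Comparing the exponents \<open>r (2 * n)\<close> and \<open>r n\<close> gives a further
  limit \<open>E\<close> of powers with \<open>E ** L = L\<close>. Every value of \<open>L\<close>
  is therefore fixed by \<open>E\<close>, and the vectors fixed by \<open>E\<close> are multiples of
  \<open>a\<close>.\<close>

lemma biprox_limit_outer:
  assumes h: "biprox h a b 1 \<beta>" and r: "strict_mono r" and L: "(\<lambda>n. mpow h (r n)) \<longlonglongrightarrow> L"
  obtains f where "L = outer a f" "f \<bullet> a = 1"
proof -
  note hb = h[unfolded biprox_def]
  define d where "d n = r (2 * n) - r n" for n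
  have dn: "d n \<ge> n" for n
  proof -
    have "r (k + n) \<ge> r n + k" for k
      by (induction k) (use r in \<open>auto simp: strict_mono_Suc_iff Suc_le_eq intro: le_less_trans\<close>)
    from this[of n] show ?thesis by (simp add: d_def mult_2)
  qed
  have "bounded (range (\<lambda>n. mpow h (d n)))" using biprox_bounded[OF h] by (rule bounded_subset) auto
  then obtain E s where s: "strict_mono s" "((\<lambda>n. mpow h (d n)) \<circ> s) \<longlonglongrightarrow> E"
    using bounded_imp_convergent_subsequence by blast
  then have E: "(\<lambda>n. mpow h (d (s n))) \<longlonglongrightarrow> E" by (simp add: o_def)
  have ds: "d (s n) \<ge> n" for n using dn[of "s n"] strict_mono_imp_increasing[OF s(1), of n] by linarith
  note lf = biprox_limit_fixed[OF h ds E]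
  have "(\<lambda>n. mpow h (d (s n)) ** mpow h (r (s n))) \<longlonglongrightarrow> E ** L"
    by (intro tendsto_matrix_mult E) (use LIMSEQ_subseq_LIMSEQ[OF L s(1)] in \<open>simp add: o_def\<close>)
  moreover have "mpow h (d (s n)) ** mpow h (r (s n)) = mpow h (r (2 * s n))" for n
  proof -
    have "r (s n) \<le> r (2 * s n)" using r by (simp add: strict_mono_less_eq)
    then show ?thesis by (simp add: d_def flip: mpow_add)
  qed
  moreover have "(\<lambda>n. mpow h (r (2 * s n))) \<longlonglongrightarrow> L"
  proof -
    have "strict_mono (\<lambda>n. 2 * s n)" using s(1) by (simp add: strict_mono_def)
    from LIMSEQ_subseq_LIMSEQ[OF L this] show ?thesis by (simp add: o_def)
  qed
  ultimately have EL: "E ** L = L" using LIMSEQ_eqI by blast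
  \<comment> \<open>Pairing with \<open>a\<close> reads off the coefficient of each value of
    \<open>L\<close> along \<open>a\<close>.\<close>
  define f where "f = inverse (a \<bullet> a) *\<^sub>R (a v* L)"
  have aa: "a \<bullet> a \<noteq> 0" using hb by simp
  have Lx: "L *v x = (f \<bullet> x) *\<^sub>R a" for x
  proof -
    have "E *v (L *v x) = L *v x" using EL by (simp add: matrix_vector_mul_assoc)
    then obtain c where c: "L *v x = c *\<^sub>R a" using lf(5) by blast
    have "f \<bullet> x = inverse (a \<bullet> a) * (a \<bullet> (L *v x))" by (simp add: f_def dot_lmul_matrix)
    also have "\<dots> = c" using c aa by simp
    finally show ?thesis using c by simp
  qed
  then have "L = outer a f" by (simp add: matrix_eq)
  moreover have "f \<bullet> a = 1"
  proof -
    have "(\<lambda>n. mpow h (r n) *v a) \<longlonglongrightarrow> L *v a" by (intro tendsto_intros L)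
    from LIMSEQ_eqI[OF this tendsto_const] have "L *v a = a" using mpow_eigen[of h a 1] hb by simp
    then have "(f \<bullet> a - 1) *\<^sub>R a = 0" by (simp add: Lx scaleR_diff_left)
    then show ?thesis using hb by simp
  qed
  ultimately show ?thesis by (rule that)
qed

text \<open>Every limit along a subsequence has the form \<open>outer a f'\<close> with
  \<open>f' \<bullet> a = 1\<close>. One of them absorbs \<open>h\<close> on the right, hence all
  powers, and multiplying it by another limit identifies the two.\<close>

lemma biprox_normalised_limit:
  assumes h: "biprox h a b 1 \<beta>"
  obtains f where "(\<lambda>n. mpow h n) \<longlonglongrightarrow> outer a f" "f \<bullet> a = 1"
proof -
  note hb = h[unfolded biprox_def]
  obtain L0 r0 where r0: "strict_mono r0" "((\<lambda>n. mpow h n) \<circ> r0) \<longlonglongrightarrow> L0"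
    using biprox_bounded[OF h] bounded_imp_convergent_subsequence by blast
  then obtain f where f: "L0 = outer a f" "f \<bullet> a = 1"
    using biprox_limit_outer[OF h r0(1)] by (auto simp: o_def)
  have lim0: "(\<lambda>n. mpow h (r0 n)) \<longlonglongrightarrow> outer a f" using r0(2) f by (simp add: o_def)
  have "outer a f ** h = outer a f"
  proof -
    have "(\<lambda>n. mpow h (r0 n) ** h) \<longlonglongrightarrow> outer a f ** h" by (intro tendsto_intros lim0)
    moreover have "(\<lambda>n. h ** mpow h (r0 n)) \<longlonglongrightarrow> h ** outer a f" by (intro tendsto_intros lim0)
    moreover have "h ** mpow h (r0 n) = mpow h (r0 n) ** h" for n
      using mpow_Suc_right[of h "r0 n"] by simp
    ultimately have "outer a f ** h = h ** outer a f" by (metis LIMSEQ_eqI)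
    then show ?thesis using hb by (simp add: matrix_outer)
  qed
  then have inv: "outer a f ** mpow h n = outer a f" for n
    by (induction n) (simp_all add: matrix_mul_assoc)
  have "(\<lambda>n. mpow h n) \<longlonglongrightarrow> outer a f"
  proof (rule bounded_unique_limit[OF biprox_bounded[OF h]])
    fix r L assume r: "strict_mono r" and L: "(\<lambda>n. mpow h (r n)) \<longlonglongrightarrow> L"
    obtain f' where f': "L = outer a f'" "f' \<bullet> a = 1" using biprox_limit_outer[OF h r L] .
    have "(\<lambda>n. outer a f ** mpow h (r n)) \<longlonglongrightarrow> outer a f ** L" by (intro tendsto_intros L)
    from LIMSEQ_eqI[OF this tendsto_const] have "outer a f ** L = outer a f" by (simp add: inv)
    then show "L = outer a f" using f' f(2) by (simp add: outer_outer)
  qed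
  then show ?thesis using f(2) that by blast
qed

lemma biprox_normalise: "biprox g a b \<alpha> \<beta> \<Longrightarrow> biprox (inverse \<alpha> *\<^sub>R g) a b 1 (\<beta> / \<alpha>)"
  by (auto simp: biprox_def auts_scaleR field_simps)

text \<open>The limit commutes with \<open>g\<close>, so \<open>f\<close> is a dual eigenvector for
  \<alpha>. It is nonnegative on the cone because a negative value would put \<open>- a\<close> into
  the closed cone.\<close>

lemma biprox_limit:
  assumes g: "biprox g a b \<alpha> \<beta>"
  obtains f where "(\<lambda>n. inverse \<alpha> ^ n *\<^sub>R mpow g n) \<longlonglongrightarrow> outer a f" "f \<bullet> a = 1" "f \<bullet> b = 0"
    "\<And>x. f \<bullet> (g *v x) = \<alpha> * (f \<bullet> x)" "\<And>x. x \<in> C \<Longrightarrow> 0 < f \<bullet> x" "\<And>x. x \<in> K \<Longrightarrow> 0 \<le> f \<bullet> x"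
    "a \<notin> C"
proof -
  note gb = g[unfolded biprox_def]
  have h: "biprox (inverse \<alpha> *\<^sub>R g) a b 1 (\<beta> / \<alpha>)" using g by (rule biprox_normalise)
  obtain f where f: "(\<lambda>n. mpow (inverse \<alpha> *\<^sub>R g) n) \<longlonglongrightarrow> outer a f" "f \<bullet> a = 1"
    using biprox_normalised_limit[OF h] .
  have f1: "(\<lambda>n. inverse \<alpha> ^ n *\<^sub>R mpow g n) \<longlonglongrightarrow> outer a f" using f(1) by (simp add: mpow_scaleR)
  note lf = biprox_limit_fixed[OF h order_refl f(1)]
  have fb: "f \<bullet> b = 0" using lf(2) gb by simp
  have ac: "a \<notin> C" using lf(1) lf(4) by metis
  have lim1: "(\<lambda>n. (inverse \<alpha> ^ n *\<^sub>R mpow g n) ** g) \<longlonglongrightarrow> outer a f ** g" by (intro tendsto_intros f1)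
  have lim2: "(\<lambda>n. g ** (inverse \<alpha> ^ n *\<^sub>R mpow g n)) \<longlonglongrightarrow> g ** outer a f" by (intro tendsto_intros f1)
  have "outer a f ** g = g ** outer a f"
    by (rule LIMSEQ_eqI[OF lim1 lim2]) (use mpow_Suc_right[of g] in simp)
  then have "(outer a f ** g) *v x = (g ** outer a f) *v x" for x by simp
  then have "(f \<bullet> (g *v x)) *\<^sub>R a = (\<alpha> * (f \<bullet> x)) *\<^sub>R a" for x
    using gb by (simp add: mult.commute flip: matrix_vector_mul_assoc)
  then have fg: "f \<bullet> (g *v x) = \<alpha> * (f \<bullet> x)" for x using gb by simp
  have nn: "0 \<le> f \<bullet> x" if "x \<in> C" for x
  proof (rule ccontr)
    assume neg: "\<not> 0 \<le> f \<bullet> x"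
    have fa: "(f \<bullet> x) *\<^sub>R a \<in> K" using lf(3)[OF C_K[OF that]] by simp
    have "inverse (- (f \<bullet> x)) *\<^sub>R ((f \<bullet> x) *\<^sub>R a) \<in> K" using neg by (intro K_scale fa) auto
    then have "- a \<in> K" using neg by simp
    then show False using gb K_antisym by blast
  qed
  have "f \<noteq> 0" using f(2) by auto
  show ?thesis
    by (rule that[OF f1 f(2) fb fg linear_functional_pos[OF nn \<open>f \<noteq> 0\<close>] K_functional_nonneg[OF nn] ac])
qed

lemma biprox_inverse:
  assumes g: "biprox g a b \<alpha> \<beta>" and gh: "g ** h = mat 1" "h ** g = mat 1"
  shows "biprox h b a (inverse \<beta>) (inverse \<alpha>)"
proof -
  note gb = g[unfolded biprox_def]
  have "h *v x = inverse c *\<^sub>R x" if "g *v x = c *\<^sub>R x" "c \<noteq> 0" for c x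
  proof -
    have "x = h *v (g *v x)" by (simp add: matrix_vector_mul_assoc gh)
    also have "\<dots> = c *\<^sub>R (h *v x)" by (simp add: that(1))
    finally have "inverse c *\<^sub>R x = inverse c *\<^sub>R (c *\<^sub>R (h *v x))" by simp
    then show ?thesis using that(2) by simp
  qed
  then show ?thesis
    using gb auts_inverse[OF _ gh(1)] no_half_triangle_sym
    by (auto simp: biprox_def intro: less_imp_inverse_less)
qed

section \<open>Stability under perturbation\<close>

text \<open>By homogeneity \<open>z\<close> can be restricted to the compact slice of height one,
  where openness of \<open>C\<close> gives uniformity.\<close>

lemma no_half_triangle_eventually:
  assumes nt: "no_half_triangle u w" and ab: "a \<longlonglongrightarrow> u" "b \<longlonglongrightarrow> w" "\<And>n. a n \<in> K" "\<And>n. b n \<in> K"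
  shows "eventually (\<lambda>n. no_half_triangle (a n) (b n)) sequentially"
proof -
  have "eventually (\<lambda>n. \<forall>z\<in>{x \<in> K. e \<bullet> x = 1}. a n + z \<in> C \<or> b n + z \<in> C) sequentially"
  proof (rule eventually_compactI[OF compact_slice])
    fix r v l assume r: "strict_mono (r :: nat \<Rightarrow> nat)" and v: "v \<longlonglongrightarrow> l" and l: "l \<in> {x \<in> K. e \<bullet> x = 1}"
    have A: "(\<lambda>n. a (r n) + v n) \<longlonglongrightarrow> u + l" "(\<lambda>n. b (r n) + v n) \<longlonglongrightarrow> w + l"
      using LIMSEQ_subseq_LIMSEQ[OF ab(1) r] LIMSEQ_subseq_LIMSEQ[OF ab(2) r] v
      by (auto intro: tendsto_add simp: o_def)
    have "l \<noteq> 0" using l by auto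
    then consider "u + l \<in> C" | "w + l \<in> C" using nt l unfolding no_half_triangle_def by blast
    then have "eventually (\<lambda>n. a (r n) + v n \<in> C \<or> b (r n) + v n \<in> C) sequentially"
    proof cases
      case 1
      from topological_tendstoD[OF A(1) open_C this] show ?thesis by (rule eventually_mono) simp
    next
      case 2
      from topological_tendstoD[OF A(2) open_C this] show ?thesis by (rule eventually_mono) simp
    qed
    then show "\<exists>n. a (r n) + v n \<in> C \<or> b (r n) + v n \<in> C"
      using eventually_happens'[OF sequentially_bot] by blast
  qed
  then show ?thesis
  proof (rule eventually_mono)
    fix n assume n: "\<forall>z\<in>{x \<in> K. e \<bullet> x = 1}. a n + z \<in> C \<or> b n + z \<in> C"
    show "no_half_triangle (a n) (b n)"
      unfolding no_half_triangle_def
    proof (intro ballI impI)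
      fix z assume z: "z \<in> K" "z \<noteq> 0"
      then have ez: "e \<bullet> z > 0" by (rule K_pos)
      define y where "y = inverse (e \<bullet> z) *\<^sub>R z"
      have y: "y \<in> K" "e \<bullet> y = 1" "z = (e \<bullet> z) *\<^sub>R y"
        using z ez by (auto simp: y_def intro: K_scale)
      have *: "c + z \<in> C" if "c + y \<in> C" "c \<in> K" for c
        using C_pos_comb[OF that y(1), of 1 "e \<bullet> z"] ez y(3) by simp
      show "a n + z \<in> C \<or> b n + z \<in> C" using n y * ab(3,4) by blast
    qed
  qed
qed

lemma no_half_triangle_stable:
  assumes nt: "no_half_triangle u w"
  shows "\<exists>d>0. \<forall>a\<in>K. \<forall>b\<in>K. norm (a - u) < d \<longrightarrow> norm (b - w) < d \<longrightarrow> no_half_triangle a b"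
proof (rule ccontr)
  assume no: "\<not> ?thesis"
  have "\<exists>a\<in>K. \<exists>b\<in>K. norm (a - u) < inverse (real (Suc n)) \<and> norm (b - w) < inverse (real (Suc n)) \<and>
      \<not> no_half_triangle a b" for n
  proof -
    have "inverse (real (Suc n)) > 0" by simp
    then show ?thesis using no by blast
  qed
  then obtain a b where ab: "\<And>n. a n \<in> K" "\<And>n. b n \<in> K" "\<And>n. norm (a n - u) < inverse (real (Suc n))"
    "\<And>n. norm (b n - w) < inverse (real (Suc n))" "\<And>n. \<not> no_half_triangle (a n) (b n)"
    by metis
  have "a \<longlonglongrightarrow> u" "b \<longlonglongrightarrow> w"
    by (rule Lim_transform_bound[OF _ LIMSEQ_inverse_real_of_nat, THEN LIM_zero_cancel],
        use ab in \<open>auto intro!: always_eventually less_imp_le\<close>)+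
  from no_half_triangle_eventually[OF nt this ab(1,2)] ab(5) show False by simp
qed

text \<open>Near \<open>u\<close> the projective action of \<open>M n\<close> contracts a slice of the cone into itself, so that
  Brouwer's theorem gives an eigenvector.\<close>

lemma attracting_eigenvector:
  assumes M: "\<And>n. M n \<in> auts" "M \<longlonglongrightarrow> outer u f" and u: "u \<in> K" "u \<noteq> 0" and fu: "0 < f \<bullet> u" and d: "0 < d"
  shows "eventually (\<lambda>n. \<exists>a\<in>K. \<exists>\<alpha>. a \<noteq> 0 \<and> norm (a - u) < d \<and> M n *v a = \<alpha> *\<^sub>R a \<and> f \<bullet> u / 4 \<le> \<alpha>) sequentially"
proof -
  have eu: "0 < e \<bullet> u" using K_pos u by blast
  have f0: "f \<noteq> 0" using fu by auto
  \<comment> \<open>The first bound keeps the eigenvector within \<open>d\<close> of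
    \<open>u\<close>; the second keeps \<open>f\<close> above half of its value at \<open>u\<close>
    on the ball.\<close>
  define \<delta> where "\<delta> = min (d / 2) (f \<bullet> u / (2 * norm f))"
  have \<delta>: "0 < \<delta>" "\<delta> < d" "\<delta> * norm f \<le> f \<bullet> u / 2"
    using d fu f0 by (auto simp: \<delta>_def field_simps min_def)
  define S where "S = {v \<in> K. e \<bullet> v = e \<bullet> u} \<inter> cball u \<delta>"
  have fv: "f \<bullet> u / 2 \<le> f \<bullet> v" if "v \<in> S" for v
  proof -
    have "f \<bullet> u - f \<bullet> v \<le> norm f * norm (u - v)" using norm_cauchy_schwarz[of f "u - v"] by (simp add: inner_diff_right)
    also have "\<dots> \<le> norm f * \<delta>" using that by (intro mult_left_mono) (auto simp: S_def dist_norm)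
    also have "\<dots> \<le> f \<bullet> u / 2" using \<delta>(3) by (simp add: mult.commute)
    finally show ?thesis by simp
  qed
  have S_eq: "S = K \<inter> {v. e \<bullet> v = e \<bullet> u} \<inter> cball u \<delta>" by (auto simp: S_def)
  have cS: "compact S" unfolding S_eq
    by (intro closed_Int_compact closed_Int closed_hyperplane compact_cball) simp
  have "convex K" using convex_C by (rule convex_closure)
  then have vS: "convex S" unfolding S_eq by (intro convex_Int convex_hyperplane convex_cball)
  have uS: "u \<in> S" using u \<delta> by (simp add: S_def)
  \<comment> \<open>The projective action of \<open>M n\<close>, renormalised to the height of
    \<open>u\<close> so that it can map the compact convex set \<open>S\<close> into itself.\<close>
  define T where "T n v = ((e \<bullet> u) / (e \<bullet> (M n *v v))) *\<^sub>R (M n *v v)" for n v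
  \<comment> \<open>A quarter instead of the half available on \<open>S\<close> leaves room for
    passing to the limit; it becomes the lower bound on the eigenvalue.\<close>
  have "eventually (\<lambda>n. \<forall>v\<in>S. norm (T n v - u) < \<delta> \<and> (f \<bullet> u / 4) * (e \<bullet> u) < e \<bullet> (M n *v v)) sequentially"
  proof (rule eventually_compactI[OF cS])
    fix r v l assume r: "strict_mono (r :: nat \<Rightarrow> nat)" and v: "v \<longlonglongrightarrow> l" "l \<in> S"
    have fl: "f \<bullet> l > 0" using fv[OF v(2)] fu by simp
    have A: "(\<lambda>n. M (r n) *v v n) \<longlonglongrightarrow> outer u f *v l"
      by (intro tendsto_matrix_vec v) (use LIMSEQ_subseq_LIMSEQ[OF M(2) r] in \<open>simp add: o_def\<close>)
    have ne0: "e \<bullet> (outer u f *v l) \<noteq> 0" using fl eu by simp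
    have "(\<lambda>n. T (r n) (v n)) \<longlonglongrightarrow> ((e \<bullet> u) / (e \<bullet> (outer u f *v l))) *\<^sub>R (outer u f *v l)"
      unfolding T_def by (intro tendsto_intros A ne0)
    moreover have "((e \<bullet> u) / (e \<bullet> (outer u f *v l))) *\<^sub>R (outer u f *v l) = u" using fl eu by simp
    ultimately have "(\<lambda>n. norm (T (r n) (v n) - u)) \<longlonglongrightarrow> 0" by (simp add: LIM_zero tendsto_norm_zero)
    then have 1: "eventually (\<lambda>n. norm (T (r n) (v n) - u) < \<delta>) sequentially"
      using \<delta>(1) order_tendstoD(2) by blast
    have lim2: "(\<lambda>n. e \<bullet> (M (r n) *v v n)) \<longlonglongrightarrow> (f \<bullet> l) * (e \<bullet> u)"
      using tendsto_inner[OF tendsto_const A, of e] by simp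
    have "(f \<bullet> u / 4) * (e \<bullet> u) < (f \<bullet> l) * (e \<bullet> u)"
      using fv[OF v(2)] fu eu by (intro mult_strict_right_mono) auto
    from order_tendstoD(1)[OF lim2 this] 1
    have "eventually (\<lambda>n. norm (T (r n) (v n) - u) < \<delta> \<and> (f \<bullet> u / 4) * (e \<bullet> u) < e \<bullet> (M (r n) *v v n)) sequentially"
      by (simp add: eventually_conj_iff)
    then show "\<exists>n. norm (T (r n) (v n) - u) < \<delta> \<and> (f \<bullet> u / 4) * (e \<bullet> u) < e \<bullet> (M (r n) *v v n)"
      using eventually_happens'[OF sequentially_bot] by blast
  qed
  then show ?thesis
  proof (rule eventually_mono)
    fix n assume n: "\<forall>v\<in>S. norm (T n v - u) < \<delta> \<and> (f \<bullet> u / 4) * (e \<bullet> u) < e \<bullet> (M n *v v)"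
    have pos: "0 < e \<bullet> (M n *v v)" if "v \<in> S" for v
    proof -
      have "0 < (f \<bullet> u / 4) * (e \<bullet> u)" using fu eu by simp
      also have "\<dots> < e \<bullet> (M n *v v)" using n that by blast
      finally show ?thesis .
    qed
    have TS: "T n v \<in> S" if "v \<in> S" for v
    proof -
      have "M n *v v \<in> K" using that M(1) by (auto simp: S_def intro: auts_K)
      then have "T n v \<in> K" unfolding T_def using eu pos[OF that] by (intro K_scale) auto
      moreover have "e \<bullet> T n v = e \<bullet> u" using pos[OF that] by (simp add: T_def)
      moreover have "norm (T n v - u) < \<delta>" using n that by blast
      ultimately show ?thesis by (simp add: S_def dist_norm norm_minus_commute)
    qed
    have "continuous_on S (T n)"
      unfolding T_def
    proof (intro continuous_on_scaleR continuous_on_divide continuous_on_const continuous_on_inner)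
      show "continuous_on S ((*v) (M n))" by (simp add: linear_continuous_on)
      then show "continuous_on S ((*v) (M n))" .
      show "\<forall>x\<in>S. e \<bullet> (M n *v x) \<noteq> 0" using pos by force
    qed
    then obtain a where a: "a \<in> S" "T n a = a"
      using brouwer[OF cS vS _ _ , of "T n"] TS uS by (metis Pi_I empty_iff)
    define \<alpha> where "\<alpha> = e \<bullet> (M n *v a) / (e \<bullet> u)"
    have "M n *v a = \<alpha> *\<^sub>R T n a" using pos[OF a(1)] eu by (simp add: T_def \<alpha>_def)
    then have "M n *v a = \<alpha> *\<^sub>R a" by (simp add: a(2))
    moreover have "f \<bullet> u / 4 \<le> \<alpha>"
    proof -
      have "(f \<bullet> u / 4) * (e \<bullet> u) < e \<bullet> (M n *v a)" using n a(1) by blast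
      then show ?thesis using eu unfolding \<alpha>_def by (simp add: pos_le_divide_eq)
    qed
    moreover have "a \<noteq> 0" using a(1) eu by (auto simp: S_def)
    moreover have "norm (a - u) < d" using a(1) \<delta>(2) by (auto simp: S_def dist_norm norm_minus_commute)
    ultimately show "\<exists>a\<in>K. \<exists>\<alpha>. a \<noteq> 0 \<and> norm (a - u) < d \<and> M n *v a = \<alpha> *\<^sub>R a \<and> f \<bullet> u / 4 \<le> \<alpha>"
      using a(1) by (auto simp: S_def)
  qed
qed

text \<open>A negative value of \<open>f\<close> on \<open>C\<close> would put \<open>- u\<close>
  into the closed cone, because the values of the limit lie there.\<close>

lemma rank_one_limit_functional:
  assumes M: "\<And>n. M n \<in> auts" "M \<longlonglongrightarrow> outer u f" and u: "u \<in> K" "u \<noteq> 0" and f: "f \<noteq> 0" and x: "x \<in> C"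
  shows "0 < f \<bullet> x"
proof (rule linear_functional_pos[OF _ f x])
  fix y assume y: "y \<in> C"
  have "(\<lambda>n. M n *v y) \<longlonglongrightarrow> outer u f *v y" by (intro tendsto_intros M)
  then have K: "(f \<bullet> y) *\<^sub>R u \<in> K"
    using K_limI[of "\<lambda>n. M n *v y"] auts_K[OF M(1) C_K[OF y]] by simp
  show "0 \<le> f \<bullet> y"
  proof (rule ccontr)
    assume neg: "\<not> 0 \<le> f \<bullet> y"
    then have "inverse (- (f \<bullet> y)) *\<^sub>R ((f \<bullet> y) *\<^sub>R u) \<in> K" by (intro K_scale K) auto
    then show False using neg u K_antisym by simp
  qed
qed

text \<open>The limit is at once a multiple of the identity and of rank at most one, which in
  dimension at least two leaves only zero.\<close>

lemma scalar_matrix_limit_rank_one: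
  fixes k :: "nat \<Rightarrow> real" and u f :: "real^'m"
  assumes "(\<lambda>n. k n *\<^sub>R mat 1) \<longlonglongrightarrow> c *\<^sub>R outer u f" "CARD('m) \<ge> 2"
  shows "k \<longlonglongrightarrow> 0" "c *\<^sub>R outer u f = 0"
proof -
  have ent: "(\<lambda>n. if i = j then k n else 0) \<longlonglongrightarrow> c * (u $ i * f $ j)" for i j
    using tendsto_vec_nth[OF tendsto_vec_nth[OF assms(1), of i], of j]
    by (simp add: mat_def outer_def if_distrib cong: if_cong)
  have off: "c * (u $ i * f $ j) = 0" if "i \<noteq> j" for i j
  proof -
    have "(\<lambda>n. 0) \<longlonglongrightarrow> c * (u $ i * f $ j)" using that ent[of i j] by (simp only: if_False)
    then show ?thesis using LIMSEQ_unique tendsto_const by metis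
  qed
  have dia: "k \<longlonglongrightarrow> c * (u $ i * f $ i)" for i using ent[of i i] by simp
  obtain i j :: 'm where ij: "i \<noteq> j"
    using assms(2) coord_eq_iff[where 'n='m, of 1 2] by (intro that[of "coord 1" "coord 2"]) auto
  have eq: "c * (u $ i * f $ i) = c * (u $ j * f $ j)" using LIMSEQ_unique[OF dia dia] .
  have "c * (u $ i * f $ i) = 0"
  proof (rule ccontr)
    assume "c * (u $ i * f $ i) \<noteq> 0"
    then have "c * (u $ i * f $ j) \<noteq> 0" using eq by auto
    then show False using off ij by blast
  qed
  then have d0: "k \<longlonglongrightarrow> 0" using dia[of i] by (simp only:)
  then show "k \<longlonglongrightarrow> 0" .
  have "c * (u $ p * f $ q) = 0" for p q
    using off[of p q] LIMSEQ_unique[OF dia[of p] d0] by (cases "p = q") auto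
  then show "c *\<^sub>R outer u f = 0" by (simp add: vec_eq_iff outer_def)
qed

text \<open>The products \<open>M n ** M' n\<close> are scalar and have a limit of rank at most one,
  so the scalars \<open>k n\<close> tend to zero and \<open>f \<bullet> w = 0\<close>. Then
  \<open>f\<close> is positive on \<open>u\<close> because it is positive on \<open>u + w\<close>.
  Both sequences get eigenvectors with eigenvalues bounded below; an eigenvector of
  \<open>M' n\<close> for \<gamma> is one of \<open>M n\<close> for \<open>k n / \<gamma>\<close>,
  which is eventually smaller than \<alpha>.\<close>

lemma biprox_perturbation:
  assumes M: "\<And>n. M n \<in> auts" "M \<longlonglongrightarrow> outer u f" and M': "\<And>n. M' n \<in> auts" "M' \<longlonglongrightarrow> outer w f'"
    and inv: "\<And>n. M n ** M' n = k n *\<^sub>R mat 1" "\<And>n. M' n ** M n = k n *\<^sub>R mat 1"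
    and card: "CARD('n) \<ge> 2" and u: "u \<in> K" "u \<noteq> 0" and w: "w \<in> K" "w \<noteq> 0"
    and f: "f \<noteq> 0" "f' \<noteq> 0" and nt: "no_half_triangle u w" and d: "d > 0"
  shows "eventually (\<lambda>n. \<exists>a b \<alpha> \<beta>. biprox (M n) a b \<alpha> \<beta> \<and> norm (a - u) < d \<and> norm (b - w) < d) sequentially"
proof -
  have uw: "u + w \<in> C" using no_half_triangle_sum nt u w by blast
  have "(\<lambda>n. M n ** M' n) \<longlonglongrightarrow> outer u f ** outer w f'" by (intro tendsto_intros M M')
  then have 1: "(\<lambda>n. k n *\<^sub>R mat 1) \<longlonglongrightarrow> (f \<bullet> w) *\<^sub>R outer u f'" by (simp add: inv outer_outer)
  have "(\<lambda>n. M' n ** M n) \<longlonglongrightarrow> outer w f' ** outer u f" by (intro tendsto_intros M M')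
  then have 2: "(\<lambda>n. k n *\<^sub>R mat 1) \<longlonglongrightarrow> (f' \<bullet> u) *\<^sub>R outer w f" by (simp add: inv outer_outer)
  have k0: "k \<longlonglongrightarrow> 0" by (rule scalar_matrix_limit_rank_one(1)[OF 1 card])
  have fw: "f \<bullet> w = 0" "f' \<bullet> u = 0"
    using scalar_matrix_limit_rank_one(2)[OF 1 card] scalar_matrix_limit_rank_one(2)[OF 2 card] u w f by auto
  have fu: "0 < f \<bullet> u" "0 < f' \<bullet> w"
    using rank_one_limit_functional[OF M u f(1) uw] rank_one_limit_functional[OF M' w f(2) uw] fw
    by (simp_all add: inner_add_right)
  obtain d' where d': "d' > 0"
    "\<And>a b. a \<in> K \<Longrightarrow> b \<in> K \<Longrightarrow> norm (a - u) < d' \<Longrightarrow> norm (b - w) < d' \<Longrightarrow> no_half_triangle a b"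
    using no_half_triangle_stable[OF nt] by blast
  define \<epsilon> where "\<epsilon> = min d d'"
  have \<epsilon>: "\<epsilon> > 0" "\<epsilon> \<le> d" "\<epsilon> \<le> d'" using d d' by (auto simp: \<epsilon>_def)
  \<comment> \<open>The product of the lower bounds for \<alpha> and \<gamma> supplied by
    \<open>attracting_eigenvector\<close>.\<close>
  define q where "q = (f \<bullet> u / 4) * (f' \<bullet> w / 4)"
  have "q > 0" using fu by (simp add: q_def)
  then have "eventually (\<lambda>n. k n < q) sequentially" using order_tendstoD(2)[OF k0] by blast
  with attracting_eigenvector[OF M u fu(1) \<epsilon>(1)] attracting_eigenvector[OF M' w fu(2) \<epsilon>(1)]
  show ?thesis
  proof eventually_elim
    case (elim n)
    then obtain a \<alpha> b \<gamma> where a: "a \<in> K" "a \<noteq> 0" "norm (a - u) < \<epsilon>" "M n *v a = \<alpha> *\<^sub>R a" "f \<bullet> u / 4 \<le> \<alpha>"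
      and b: "b \<in> K" "b \<noteq> 0" "norm (b - w) < \<epsilon>" "M' n *v b = \<gamma> *\<^sub>R b" "f' \<bullet> w / 4 \<le> \<gamma>" by blast
    have \<gamma>: "\<gamma> > 0" "\<alpha> > 0" using fu a b by linarith+
    have "M n *v (M' n *v b) = k n *\<^sub>R b" using inv(1)[of n] by (simp add: matrix_vector_mul_assoc)
    then have "\<gamma> *\<^sub>R (M n *v b) = k n *\<^sub>R b" by (simp add: b(4))
    then have "inverse \<gamma> *\<^sub>R (\<gamma> *\<^sub>R (M n *v b)) = inverse \<gamma> *\<^sub>R (k n *\<^sub>R b)" by simp
    then have Mb: "M n *v b = (k n / \<gamma>) *\<^sub>R b" using \<gamma> by (simp add: divide_inverse mult.commute)
    have "M n *v b \<in> K" "M n *v b \<noteq> 0" using auts_K[OF M(1) b(1)] auts_nonzero[OF M(1) b(2)] by auto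
    then have "0 < e \<bullet> (M n *v b)" by (rule K_pos)
    then have "0 < (k n / \<gamma>) * (e \<bullet> b)" by (simp add: Mb)
    then have kp: "0 < k n / \<gamma>" using K_pos[OF b(1,2)] zero_less_mult_pos2 by blast
    have "k n < q" using elim by blast
    also have "q \<le> \<alpha> * \<gamma>" unfolding q_def using a b fu by (intro mult_mono) auto
    finally have "k n / \<gamma> < \<alpha>" using \<gamma> by (simp add: divide_less_eq)
    moreover have "no_half_triangle a b" using a b \<epsilon> by (intro d'(2)) auto
    ultimately have "biprox (M n) a b \<alpha> (k n / \<gamma>)"
      using a b Mb kp M(1) by (simp add: biprox_def)
    then show ?case using a(3) b(3) \<epsilon> by (intro exI conjI) auto
  qed
qed

end

section \<open>Attracting and repelling points\<close>

abbreviation cmat :: "real^'n^'m \<Rightarrow> complex^'n^'m" where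
  "cmat A \<equiv> (\<chi> i j. complex_of_real (A $ i $ j))"

lemma cmat_mult: "cmat (A ** B) = cmat A ** cmat B"
  by (simp add: vec_eq_iff matrix_matrix_mult_def)

lemma cmat_mpow_eigen:
  assumes "cmat g *v w = \<mu> *s w"
  shows "cmat (mpow g n) *v w = \<mu> ^ n *s w"
proof (induction n)
  case 0
  have "cmat (mat 1 :: real^'a^'a) = mat 1" by (auto simp: vec_eq_iff mat_def)
  then show ?case by simp
next
  case (Suc n)
  have "cmat (mpow g (Suc n)) *v w = cmat g *v (cmat (mpow g n) *v w)"
    by (simp only: mpow.simps cmat_mult matrix_vector_mul_assoc)
  also have "\<dots> = \<mu> ^ n *s (cmat g *v w)" by (simp only: Suc vector_scalar_commute)
  finally show ?case by (simp add: assms vector_smult_assoc mult.commute)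
qed

lemma real_eigenvalue_complex:
  assumes "g *v v = c *\<^sub>R v" "v \<noteq> 0"
  shows "complex_eigenvalue g (of_real c)"
  unfolding complex_eigenvalue_def
proof (intro exI conjI)
  let ?w = "(\<chi> i. complex_of_real (v $ i))"
  show "?w \<noteq> 0" using assms(2) by (auto simp: vec_eq_iff)
  have "(cmat g *v ?w) $ i = of_real ((g *v v) $ i)" for i
    by (simp add: matrix_vector_mult_def)
  then show "cmat g *v ?w = of_real c *s ?w"
    using assms(1) by (simp add: vec_eq_iff)
qed

text \<open>An eigenvalue of larger modulus would make the normalised powers unbounded on its
  eigenvector.\<close>

lemma complex_eigenvalue_bound:
  assumes lim: "(\<lambda>n. inverse \<alpha> ^ n *\<^sub>R mpow g n) \<longlonglongrightarrow> L" and "\<alpha> > 0" "complex_eigenvalue g \<mu>"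
  shows "cmod \<mu> \<le> \<alpha>"
proof (rule ccontr)
  assume big: "\<not> cmod \<mu> \<le> \<alpha>"
  obtain w where w: "w \<noteq> 0" "cmat g *v w = \<mu> *s w" using assms(3) by (auto simp: complex_eigenvalue_def)
  obtain i where i: "w $ i \<noteq> 0" using w(1) by (auto simp: vec_eq_iff)
  have "(\<lambda>n. \<Sum>j\<in>UNIV. complex_of_real ((inverse \<alpha> ^ n *\<^sub>R mpow g n) $ i $ j) * w $ j) \<longlonglongrightarrow>
      (\<Sum>j\<in>UNIV. complex_of_real (L $ i $ j) * w $ j)"
    by (intro tendsto_sum tendsto_mult tendsto_const tendsto_of_real tendsto_vec_nth lim)
  moreover have "(\<Sum>j\<in>UNIV. complex_of_real ((inverse \<alpha> ^ n *\<^sub>R mpow g n) $ i $ j) * w $ j) =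
      (\<mu> / of_real \<alpha>) ^ n * w $ i" for n
  proof -
    have "(\<Sum>j\<in>UNIV. complex_of_real ((inverse \<alpha> ^ n *\<^sub>R mpow g n) $ i $ j) * w $ j) =
        of_real (inverse \<alpha> ^ n) * ((cmat (mpow g n) *v w) $ i)"
      by (simp add: matrix_vector_mult_def sum_distrib_left mult.assoc)
    also have "\<dots> = of_real (inverse \<alpha> ^ n) * (\<mu> ^ n * w $ i)"
      unfolding cmat_mpow_eigen[OF w(2)] by simp
    also have "\<dots> = (\<mu> / of_real \<alpha>) ^ n * w $ i"
      by (simp add: power_mult_distrib power_inverse divide_inverse mult_ac)
    finally show ?thesis .
  qed
  ultimately have "convergent (\<lambda>n. (\<mu> / of_real \<alpha>) ^ n * w $ i)" unfolding convergent_def by auto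
  then have "Bseq (\<lambda>n. (\<mu> / of_real \<alpha>) ^ n * w $ i)" by (rule convergent_imp_Bseq)
  then obtain B where B: "\<And>n. norm ((\<mu> / of_real \<alpha>) ^ n * w $ i) \<le> B" unfolding Bseq_def by blast
  have "1 < cmod \<mu> / \<alpha>" using big assms(2) by simp
  then obtain n where n: "B / cmod (w $ i) < (cmod \<mu> / \<alpha>) ^ n" using real_arch_pow by blast
  have "(cmod \<mu> / \<alpha>) ^ n * cmod (w $ i) \<le> B"
    using B[of n] assms(2) by (simp add: norm_mult norm_power norm_divide)
  then have "(cmod \<mu> / \<alpha>) ^ n \<le> B / cmod (w $ i)" using i by (simp add: pos_le_divide_eq)
  with n show False by simp
qed

lemma complex_eigenvalue_scaleR:
  assumes "complex_eigenvalue g \<mu>"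
  shows "complex_eigenvalue (c *\<^sub>R g) (of_real c * \<mu>)"
proof -
  obtain w where w: "w \<noteq> 0" "cmat g *v w = \<mu> *s w" using assms by (auto simp: complex_eigenvalue_def)
  have "(cmat (c *\<^sub>R g) *v w) $ i = of_real c * ((cmat g *v w) $ i)" for i
    by (simp add: matrix_vector_mult_def sum_distrib_left mult.assoc)
  then have "cmat (c *\<^sub>R g) *v w = (of_real c * \<mu>) *s w"
    using w(2) by (simp add: vec_eq_iff mult.assoc)
  then show ?thesis using w(1) by (auto simp: complex_eigenvalue_def)
qed

lemma complex_eigenvalue_inverse:
  assumes gh: "h ** g = mat 1" and "complex_eigenvalue g \<mu>"
  shows "\<mu> \<noteq> 0 \<and> complex_eigenvalue h (inverse \<mu>)"
proof -
  obtain w where w: "w \<noteq> 0" "cmat g *v w = \<mu> *s w" using assms(2) by (auto simp: complex_eigenvalue_def)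
  have "cmat (mat 1 :: real^'a^'a) = mat 1" by (auto simp: vec_eq_iff mat_def)
  then have "cmat h ** cmat g = mat 1" by (simp only: gh flip: cmat_mult)
  then have "w = cmat h *v (cmat g *v w)" by (simp add: matrix_vector_mul_assoc)
  also have "\<dots> = \<mu> *s (cmat h *v w)" by (simp only: w(2) vector_scalar_commute)
  finally have eq: "w = \<mu> *s (cmat h *v w)" .
  have \<mu>: "\<mu> \<noteq> 0"
  proof
    assume "\<mu> = 0" then have "w = 0" using eq by simp
    then show False using w(1) by simp
  qed
  have "inverse \<mu> *s w = inverse \<mu> *s (\<mu> *s (cmat h *v w))" using eq by simp
  then have "cmat h *v w = inverse \<mu> *s w" using \<mu> by (simp add: vector_smult_assoc)
  then show ?thesis using w(1) \<mu> by (auto simp: complex_eigenvalue_def)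
qed

text \<open>Inversion keeps the eigenlines and reverses the order of the moduli, so both
  descriptions admit exactly the same points.\<close>

lemma repelling_point_inverse:
  assumes gh: "g ** h = mat 1" "h ** g = mat 1"
  shows "repelling_point g = attracting_point h"
proof -
  have step: "\<exists>d. (\<forall>v\<in>Rep_proj p. h' *v v = d *\<^sub>R v) \<and> d \<noteq> 0 \<and> d = inverse c"
    if inv: "g' ** h' = mat 1" "h' ** g' = mat 1" and c: "\<forall>v\<in>Rep_proj p. g' *v v = c *\<^sub>R v"
    for p :: "'a proj" and g' h' c
  proof -
    obtain v where v: "v \<noteq> 0" "p = pline v" by (rule pline_cases)
    have hc: "x = c *\<^sub>R (h' *v x)" if "x \<in> Rep_proj p" for x
    proof -
      have "x = h' *v (g' *v x)" by (simp add: matrix_vector_mul_assoc inv)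
      then show ?thesis using c that by simp
    qed
    have "v \<in> Rep_proj p" using v by (auto simp: Rep_pline_iff intro: exI[of _ 1])
    then have "c \<noteq> 0" using hc v(1) by fastforce
    moreover have "h' *v x = inverse c *\<^sub>R x" if "x \<in> Rep_proj p" for x
    proof -
      have "inverse c *\<^sub>R x = inverse c *\<^sub>R (c *\<^sub>R (h' *v x))" using hc[OF that] by simp
      then show ?thesis using \<open>c \<noteq> 0\<close> by simp
    qed
    ultimately show ?thesis by auto
  qed
  have "(\<exists>c. (\<forall>v\<in>Rep_proj p. g *v v = c *\<^sub>R v) \<and> (\<forall>\<mu>. complex_eigenvalue g \<mu> \<longrightarrow> \<bar>c\<bar> \<le> cmod \<mu>)) \<longleftrightarrow>
    (\<exists>c. (\<forall>v\<in>Rep_proj p. h *v v = c *\<^sub>R v) \<and> (\<forall>\<mu>. complex_eigenvalue h \<mu> \<longrightarrow> cmod \<mu> \<le> \<bar>c\<bar>))" for p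
  proof
    assume "\<exists>c. (\<forall>v\<in>Rep_proj p. g *v v = c *\<^sub>R v) \<and> (\<forall>\<mu>. complex_eigenvalue g \<mu> \<longrightarrow> \<bar>c\<bar> \<le> cmod \<mu>)"
    then obtain c where c: "\<forall>v\<in>Rep_proj p. g *v v = c *\<^sub>R v" "\<And>\<mu>. complex_eigenvalue g \<mu> \<Longrightarrow> \<bar>c\<bar> \<le> cmod \<mu>" by blast
    have *: "\<forall>v\<in>Rep_proj p. h *v v = inverse c *\<^sub>R v" "c \<noteq> 0" using step[OF gh c(1)] by auto
    have "cmod \<mu> \<le> \<bar>inverse c\<bar>" if "complex_eigenvalue h \<mu>" for \<mu>
    proof -
      have "\<mu> \<noteq> 0" "\<bar>c\<bar> \<le> cmod (inverse \<mu>)" using complex_eigenvalue_inverse[OF gh(1) that] c(2) by auto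
      then have "\<bar>c\<bar> \<le> 1 / cmod \<mu>" unfolding norm_inverse by (simp only: inverse_eq_divide)
      then show ?thesis using *(2) \<open>\<mu> \<noteq> 0\<close> by (simp add: abs_inverse field_simps)
    qed
    with * show "\<exists>c. (\<forall>v\<in>Rep_proj p. h *v v = c *\<^sub>R v) \<and> (\<forall>\<mu>. complex_eigenvalue h \<mu> \<longrightarrow> cmod \<mu> \<le> \<bar>c\<bar>)" by blast
  next
    assume "\<exists>c. (\<forall>v\<in>Rep_proj p. h *v v = c *\<^sub>R v) \<and> (\<forall>\<mu>. complex_eigenvalue h \<mu> \<longrightarrow> cmod \<mu> \<le> \<bar>c\<bar>)"
    then obtain c where c: "\<forall>v\<in>Rep_proj p. h *v v = c *\<^sub>R v" "\<And>\<mu>. complex_eigenvalue h \<mu> \<Longrightarrow> cmod \<mu> \<le> \<bar>c\<bar>" by blast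
    have *: "\<forall>v\<in>Rep_proj p. g *v v = inverse c *\<^sub>R v" "c \<noteq> 0" using step[OF gh(2,1) c(1)] by auto
    have "\<bar>inverse c\<bar> \<le> cmod \<mu>" if "complex_eigenvalue g \<mu>" for \<mu>
    proof -
      have "\<mu> \<noteq> 0" "cmod (inverse \<mu>) \<le> \<bar>c\<bar>" using complex_eigenvalue_inverse[OF gh(2) that] c(2) by auto
      then have "1 / cmod \<mu> \<le> \<bar>c\<bar>" unfolding norm_inverse by (simp only: inverse_eq_divide)
      then show ?thesis using *(2) \<open>\<mu> \<noteq> 0\<close> by (simp add: abs_inverse field_simps)
    qed
    with * show "\<exists>c. (\<forall>v\<in>Rep_proj p. g *v v = c *\<^sub>R v) \<and> (\<forall>\<mu>. complex_eigenvalue g \<mu> \<longrightarrow> \<bar>c\<bar> \<le> cmod \<mu>)" by blast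
  qed
  then show ?thesis by (simp add: repelling_point_def attracting_point_def)
qed

text \<open>The scalar \<open>c\<close> passes from a cone automorphism back to the group element:
  it changes eigenvalues but neither eigenlines nor the order of moduli. For uniqueness, an
  eigenvector whose eigenvalue under \<open>g\<close> has modulus \<alpha> survives in the limit of
  normalised powers, hence lies on the line of \<open>a\<close>.\<close>

lemma attracting_point_limit:
  assumes lim: "(\<lambda>n. inverse \<alpha> ^ n *\<^sub>R mpow g n) \<longlonglongrightarrow> outer a f" and \<alpha>: "\<alpha> > 0" and a: "g *v a = \<alpha> *\<^sub>R a" "a \<noteq> 0"
    and c: "c \<noteq> 0" and g: "g = c *\<^sub>R \<gamma>"
  shows "attracting_point \<gamma> = pline a"
  unfolding attracting_point_def
proof (rule the_equality)
  have \<gamma>: "\<gamma> = inverse c *\<^sub>R g" using g c by simp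
  have bd: "\<bar>c\<bar> * cmod \<mu> \<le> \<alpha>" if "complex_eigenvalue \<gamma> \<mu>" for \<mu>
    using complex_eigenvalue_bound[OF lim \<alpha>, of "of_real c * \<mu>"] complex_eigenvalue_scaleR[OF that, of c] g
    by (simp add: norm_mult)
  have \<gamma>a: "\<gamma> *v a = (\<alpha> / c) *\<^sub>R a" using a by (simp add: \<gamma> divide_inverse mult.commute)
  show "\<exists>d. (\<forall>v\<in>Rep_proj (pline a). \<gamma> *v v = d *\<^sub>R v) \<and> (\<forall>\<mu>. complex_eigenvalue \<gamma> \<mu> \<longrightarrow> cmod \<mu> \<le> \<bar>d\<bar>)"
  proof (intro exI[of _ "\<alpha> / c"] conjI ballI allI impI)
    fix v assume "v \<in> Rep_proj (pline a)"
    then obtain k where "v = k *\<^sub>R a" using Rep_pline_iff[OF a(2)] by blast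
    then show "\<gamma> *v v = (\<alpha> / c) *\<^sub>R v" by (simp add: \<gamma>a)
  next
    fix \<mu> assume "complex_eigenvalue \<gamma> \<mu>"
    then show "cmod \<mu> \<le> \<bar>\<alpha> / c\<bar>" using bd[of \<mu>] \<alpha> c by (simp add: pos_le_divide_eq mult.commute)
  qed
  fix p assume "\<exists>d. (\<forall>v\<in>Rep_proj p. \<gamma> *v v = d *\<^sub>R v) \<and> (\<forall>\<mu>. complex_eigenvalue \<gamma> \<mu> \<longrightarrow> cmod \<mu> \<le> \<bar>d\<bar>)"
  then obtain d where d: "\<And>v. v \<in> Rep_proj p \<Longrightarrow> \<gamma> *v v = d *\<^sub>R v"
    "\<And>\<mu>. complex_eigenvalue \<gamma> \<mu> \<Longrightarrow> cmod \<mu> \<le> \<bar>d\<bar>" by blast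
  obtain v where v: "v \<noteq> 0" "p = pline v" by (rule pline_cases)
  have "v \<in> Rep_proj p" using v by (auto simp: Rep_pline_iff intro: exI[of _ 1])
  then have dv: "\<gamma> *v v = d *\<^sub>R v" by (rule d(1))
  have "\<bar>c\<bar> * \<bar>d\<bar> \<le> \<alpha>" using bd[OF real_eigenvalue_complex[OF dv v(1)]] by simp
  moreover have "\<alpha> \<le> \<bar>c\<bar> * \<bar>d\<bar>"
    using d(2)[OF real_eigenvalue_complex[OF \<gamma>a a(2)]] \<alpha> c by (simp add: norm_divide pos_divide_le_eq mult.commute)
  ultimately have "\<bar>c * d\<bar> = \<alpha>" by (simp add: abs_mult)
  then have cd: "(c * d)\<^sup>2 = \<alpha>\<^sup>2" by (metis power2_abs)
  have "g *v v = (c * d) *\<^sub>R v" by (simp add: g dv)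
  \<comment> \<open>Even exponents remove the unknown sign of \<open>c * d\<close>.\<close>
  have lim2: "(\<lambda>n. (inverse \<alpha> ^ (2 * n) *\<^sub>R mpow g (2 * n)) *v v) \<longlonglongrightarrow> outer a f *v v"
    using LIMSEQ_subseq_LIMSEQ[OF lim, of "\<lambda>n. 2 * n"]
    by (intro tendsto_matrix_vec tendsto_const) (simp add: o_def strict_mono_def)
  have fix2: "(inverse \<alpha> ^ (2 * n) *\<^sub>R mpow g (2 * n)) *v v = v" for n
  proof -
    have "mpow g (2 * n) *v v = (c * d) ^ (2 * n) *\<^sub>R v"
      by (rule mpow_eigen) fact
    also have "(c * d) ^ (2 * n) = \<alpha> ^ (2 * n)" by (simp only: power_mult cd)
    finally show ?thesis using \<alpha> by (simp add: power_inverse)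
  qed
  from LIMSEQ_eqI[OF lim2 tendsto_const fix2] have "v = (f \<bullet> v) *\<^sub>R a" by simp
  then show "p = pline a" using v a(2) pline_scaleR[of "f \<bullet> v" a] by (metis scale_zero_left)
qed

section \<open>The Hilbert metric\<close>

context convex_domain begin

lemma dom_rep_slice: "v \<in> K \<Longrightarrow> e \<bullet> v = 1 \<Longrightarrow> dom_rep \<Omega> (pline v) = v"
  using dom_rep_pline[of v] by (cases "v = 0") auto

lemma pline_slice_inj: "u \<in> K \<Longrightarrow> v \<in> K \<Longrightarrow> e \<bullet> u = 1 \<Longrightarrow> e \<bullet> v = 1 \<Longrightarrow> pline u = pline v \<Longrightarrow> u = v"
  using dom_rep_slice by metis

lemma slice_segment: "u \<in> K \<Longrightarrow> v \<in> K \<Longrightarrow> e \<bullet> u = 1 \<Longrightarrow> e \<bullet> v = 1 \<Longrightarrow> closed_segment u v \<subseteq> {x \<in> K. e \<bullet> x = 1}"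
  by (auto simp: closed_segment_def inner_add_right intro!: K_add[OF K_scale K_scale])

lemma pline_slice_segment:
  assumes "u \<in> K" "v \<in> K" "e \<bullet> u = 1" "e \<bullet> v = 1" "x \<in> K" "e \<bullet> x = 1"
  shows "pline x \<in> proj_seg \<Omega> (pline u) (pline v) \<longleftrightarrow> x \<in> closed_segment u v"
  using assms slice_segment[of u v] pline_slice_inj[of x] by (auto simp: proj_seg_slice)

lemma slice_rep:
  assumes "p \<in> closure \<Omega>"
  obtains v where "v \<in> K" "e \<bullet> v = 1" "p = pline v"
proof -
  obtain w where w: "w \<in> K" "w \<noteq> 0" "p = pline w" using assms by (auto simp: closure_dom)
  have "e \<bullet> w > 0" using w K_pos by blast
  then show ?thesis using w
    by (intro that[of "inverse (e \<bullet> w) *\<^sub>R w"]) (auto intro: K_scale simp: pline_scaleR)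
qed

lemma pline_in_closure_line:
  assumes x: "x \<in> K" "e \<bullet> x = 1" and y: "y \<in> K" "e \<bullet> y = 1" and v: "v \<in> K" "e \<bullet> v = 1"
  shows "pline v \<in> closure \<Omega> \<inter> proj_line (pline x) (pline y) \<longleftrightarrow> (\<exists>t. v = x + t *\<^sub>R (y - x))"
proof -
  have n0: "x \<noteq> 0" "y \<noteq> 0" "v \<noteq> 0" using assms by auto
  have sp: "span (Rep_proj (pline x) \<union> Rep_proj (pline y)) = span {x, y}"
  proof
    show "span {x, y} \<subseteq> span (Rep_proj (pline x) \<union> Rep_proj (pline y))"
      using n0 by (intro span_mono) (auto simp: Rep_pline span_base)
    show "span (Rep_proj (pline x) \<union> Rep_proj (pline y)) \<subseteq> span {x, y}"
      using n0 by (intro span_minimal) (auto simp: Rep_pline intro: subsetD[OF span_mono])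
  qed
  have "pline v \<in> closure \<Omega>" using v n0 by (auto simp: closure_dom)
  moreover have "pline v \<in> proj_line (pline x) (pline y) \<longleftrightarrow> v \<in> span {x, y}"
    unfolding proj_line_def sp using n0 by (intro pline_in_proj_sub) auto
  moreover have "v \<in> span {x, y} \<longleftrightarrow> (\<exists>t. v = x + t *\<^sub>R (y - x))"
  proof
    assume "v \<in> span {x, y}"
    then obtain s t where st: "v = s *\<^sub>R x + t *\<^sub>R y" by (auto simp: span_insert span_singleton algebra_simps)
    then have "e \<bullet> v = s + t" using x y by (simp add: inner_add_right)
    then have "s = 1 - t" using v by simp
    then have "v = (1 - t) *\<^sub>R x + t *\<^sub>R y" using st by (simp only:)
    then have "v = x + t *\<^sub>R (y - x)" by (simp add: algebra_simps)
    then show "\<exists>t. v = x + t *\<^sub>R (y - x)" ..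
  next
    assume "\<exists>t. v = x + t *\<^sub>R (y - x)"
    then show "v \<in> span {x, y}" by (auto intro!: span_add span_scale span_diff intro: span_base)
  qed
  ultimately show ?thesis by blast
qed

text \<open>A direction of height zero stays in one slice, which is bounded, so the parameters that
  remain in the closed cone form a compact set; its largest element gives a boundary point.\<close>

lemma chord_endpoint:
  assumes x: "x \<in> C" "e \<bullet> x = 1" and w: "w \<noteq> 0" "e \<bullet> w = 0"
  obtains T where "T > 0" "x + T *\<^sub>R w \<in> K" "x + T *\<^sub>R w \<notin> C" "\<And>t. x + t *\<^sub>R w \<in> K \<Longrightarrow> t \<le> T"
proof -
  define S where "S = {t. x + t *\<^sub>R w \<in> K}"
  have "S = (\<lambda>t. x + t *\<^sub>R w) -` K" by (auto simp: S_def)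
  then have "closed S" by (simp add: continuous_closed_vimage continuous_intros)
  moreover have "bounded S"
    unfolding bounded_iff
  proof (intro exI ballI)
    fix t assume "t \<in> S"
    then have "norm (x + t *\<^sub>R w) \<le> bnd * (e \<bullet> (x + t *\<^sub>R w))" by (auto simp: S_def intro: K_bound)
    then have "norm (x + t *\<^sub>R w) \<le> bnd" using x w by (simp add: inner_add_right)
    moreover have "norm (t *\<^sub>R w) \<le> norm (x + t *\<^sub>R w) + norm x"
      using norm_triangle_ineq4[of "x + t *\<^sub>R w" x] by simp
    ultimately have "\<bar>t\<bar> * norm w \<le> bnd + norm x" by simp
    then show "norm t \<le> (bnd + norm x) / norm w" using w by (simp add: pos_le_divide_eq)
  qed
  ultimately have "compact S" by (simp add: compact_eq_bounded_closed)
  moreover have "0 \<in> S" using x C_K by (simp add: S_def)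
  ultimately obtain T where T: "T \<in> S" "\<And>t. t \<in> S \<Longrightarrow> t \<le> T" using compact_attains_sup[of S] by blast
  have ext: "\<exists>d>0. x + (t + d) *\<^sub>R w \<in> K" if tC: "x + t *\<^sub>R w \<in> C" for t
  proof -
    obtain r where r: "r > 0" "cball (x + t *\<^sub>R w) r \<subseteq> C"
      using open_C tC open_contains_cball by blast
    have "x + (t + r / norm w) *\<^sub>R w \<in> cball (x + t *\<^sub>R w) r"
      using r w by (simp add: dist_norm scaleR_add_left)
    then have "x + (t + r / norm w) *\<^sub>R w \<in> K" using r(2) C_K by blast
    then show ?thesis using r w by (intro exI[of _ "r / norm w"]) simp
  qed
  have notC: "x + T *\<^sub>R w \<notin> C"
  proof
    assume "x + T *\<^sub>R w \<in> C"
    then obtain d where "d > 0" "T + d \<in> S" using ext by (auto simp: S_def)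
    with T(2) show False by fastforce
  qed
  have "T \<ge> 0" using T(2)[OF \<open>0 \<in> S\<close>] .
  moreover have "T \<noteq> 0" using notC x by auto
  ultimately show ?thesis using that[of T] T notC by (auto simp: S_def)
qed

text \<open>Parametrising the chord by its endpoints turns the cross ratio into an expression in the
  parameters of \<open>x\<close> and \<open>y\<close>. The endpoints in the definition have to be
  shown unique, so that its description denotes this value.\<close>

lemma hilbert_dist_chord:
  assumes x: "x \<in> C" "e \<bullet> x = 1" and y: "y \<in> C" "e \<bullet> y = 1" and xy: "x \<noteq> y"
  obtains p q s t where "p \<in> K" "q \<in> K" "x = (1 - s) *\<^sub>R p + s *\<^sub>R q" "y = (1 - t) *\<^sub>R p + t *\<^sub>R q"
    "0 < s" "s < t" "t < 1"
    "hilbert_dist \<Omega> (pline x) (pline y) = 1 / 2 * ln ((1 - s) * t / ((1 - t) * s))"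
proof -
  have xK: "x \<in> K" "y \<in> K" using x y C_K by auto
  define w where "w = y - x"
  have w: "w \<noteq> 0" "e \<bullet> w = 0" using x y xy by (auto simp: w_def inner_diff_right)
  have w': "- w \<noteq> 0" "e \<bullet> - w = 0" using w by auto
  obtain T where T: "T > 0" "y + T *\<^sub>R w \<in> K" "y + T *\<^sub>R w \<notin> C" "\<And>t. y + t *\<^sub>R w \<in> K \<Longrightarrow> t \<le> T"
    using chord_endpoint[OF y w] by blast
  obtain S where S: "S > 0" "x + S *\<^sub>R - w \<in> K" "x + S *\<^sub>R - w \<notin> C" "\<And>t. x + t *\<^sub>R - w \<in> K \<Longrightarrow> t \<le> S"
    using chord_endpoint[OF x w'] by blast
  define p where "p = x - S *\<^sub>R w"
  define q where "q = y + T *\<^sub>R w"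
  \<comment> \<open>The length of the chord in units of \<open>w\<close>; dividing by it normalises
    the parameters of \<open>x\<close> and \<open>y\<close> to the unit interval.\<close>
  define D where "D = S + 1 + T"
  define s where "s = S / D"
  define t where "t = (S + 1) / D"
  have D: "D > 0" using S T by (simp add: D_def)
  have st: "0 < s" "s < t" "t < 1" using S T D by (auto simp: s_def t_def divide_strict_right_mono) (simp add: D_def)
  have qp: "q - p = D *\<^sub>R w" by (simp add: p_def q_def D_def w_def algebra_simps)
  have "s *\<^sub>R (q - p) = S *\<^sub>R w" "t *\<^sub>R (q - p) = (S + 1) *\<^sub>R w"
    unfolding qp using D by (simp_all add: s_def t_def)
  then have xp: "x = p + s *\<^sub>R (q - p)" and yp: "y = p + t *\<^sub>R (q - p)"
    by (simp_all add: p_def w_def algebra_simps)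
  have pq: "p \<in> K" "p \<notin> C" "e \<bullet> p = 1" "q \<in> K" "q \<notin> C" "e \<bullet> q = 1"
    using S T x y w by (simp_all add: p_def q_def inner_diff_right inner_add_right)
  have N: "norm (q - p) > 0" using qp D w by simp
  have line: "closure \<Omega> \<inter> proj_line (pline x) (pline y) = proj_seg \<Omega> (pline p) (pline q)"
  proof (rule Set.set_eqI)
    fix z
    show "z \<in> closure \<Omega> \<inter> proj_line (pline x) (pline y) \<longleftrightarrow> z \<in> proj_seg \<Omega> (pline p) (pline q)"
    proof (cases "z \<in> closure \<Omega>")
      case True
      obtain v where v: "v \<in> K" "e \<bullet> v = 1" "z = pline v" using True by (rule slice_rep)
      have "(\<exists>r. v = x + r *\<^sub>R (y - x)) \<longleftrightarrow> v \<in> closed_segment p q"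
      proof
        assume "\<exists>r. v = x + r *\<^sub>R (y - x)"
        then obtain r where r: "v = x + r *\<^sub>R w" by (auto simp: w_def)
        have "- r \<le> S" using S(4)[of "- r"] v(1) r by simp
        moreover have "r - 1 \<le> T" using T(4)[of "r - 1"] v(1) r by (simp add: w_def algebra_simps)
        ultimately have "0 \<le> (S + r) / D" "(S + r) / D \<le> 1" using D by (auto simp: D_def)
        moreover have "((S + r) / D) *\<^sub>R (q - p) = (S + r) *\<^sub>R w" unfolding qp using D by simp
        then have "v = p + ((S + r) / D) *\<^sub>R (q - p)" using r by (simp add: p_def scaleR_add_left)
        then have "v = (1 - (S + r) / D) *\<^sub>R p + ((S + r) / D) *\<^sub>R q" by (simp add: algebra_simps)
        ultimately show "v \<in> closed_segment p q" unfolding closed_segment_def by blast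
      next
        assume "v \<in> closed_segment p q"
        then obtain r where "v = (1 - r) *\<^sub>R p + r *\<^sub>R q" by (auto simp: closed_segment_def)
        then have "v = p + r *\<^sub>R (q - p)" by (simp add: algebra_simps)
        moreover have "r *\<^sub>R (q - p) = (r * D) *\<^sub>R w" unfolding qp by simp
        ultimately have "v = x + (r * D - S) *\<^sub>R (y - x)" by (simp add: qp p_def w_def[symmetric] scaleR_diff_left)
        then show "\<exists>r. v = x + r *\<^sub>R (y - x)" ..
      qed
      then show ?thesis
        unfolding v(3) using pline_in_closure_line[OF xK(1) x(2) xK(2) y(2) v(1,2)]
          pline_slice_segment[OF pq(1,4,3,6) v(1,2)] by simp
    next
      case False
      moreover have "proj_seg \<Omega> (pline p) (pline q) \<subseteq> closure \<Omega>"
        using pq slice_segment[OF pq(1,4,3,6)] by (auto simp: proj_seg_slice closure_dom intro!: imageI)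
      ultimately show ?thesis by blast
    qed
  qed
  have xseg: "x \<in> closed_segment p y"
  proof -
    have "x = (1 - s / t) *\<^sub>R p + (s / t) *\<^sub>R y"
    proof -
      have "(s / t) *\<^sub>R (t *\<^sub>R (q - p)) = s *\<^sub>R (q - p)" using st by simp
      then have "p + (s / t) *\<^sub>R (y - p) = x" using xp yp by (metis add_diff_cancel_left')
      then show ?thesis by (simp add: algebra_simps)
    qed
    then show ?thesis unfolding closed_segment_def using st by (auto intro!: exI[of _ "s / t"])
  qed
  have yseg: "y \<in> closed_segment x q"
  proof -
    define r where "r = (t - s) / (1 - s)"
    have r: "0 \<le> r" "r \<le> 1" using st by (auto simp: r_def)
    have "q - x = (1 - s) *\<^sub>R (q - p)" using xp by (simp add: algebra_simps)
    then have "r *\<^sub>R (q - x) = (t - s) *\<^sub>R (q - p)" using st by (simp add: r_def)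
    moreover have "y - x = (t - s) *\<^sub>R (q - p)"
      by (subst yp, subst xp) (simp add: scaleR_diff_left)
    ultimately have "y = x + r *\<^sub>R (q - x)" by (metis add_diff_cancel_left' add_diff_eq)
    then have "y = (1 - r) *\<^sub>R x + r *\<^sub>R q" by (simp add: algebra_simps)
    then show ?thesis unfolding closed_segment_def using r by blast
  qed
  have pl_ne: "pline x \<noteq> pline y" using pline_slice_inj xK x y xy by blast
  define V where "V = 1 / 2 * ln ((1 - s) * t / ((1 - t) * s))"
  have val: "1 / 2 * ln (norm (dom_rep \<Omega> (pline q) - dom_rep \<Omega> (pline x)) * norm (dom_rep \<Omega> (pline y) - dom_rep \<Omega> (pline p)) /
      (norm (dom_rep \<Omega> (pline q) - dom_rep \<Omega> (pline y)) * norm (dom_rep \<Omega> (pline x) - dom_rep \<Omega> (pline p)))) = V"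
  proof -
    have "q - x = (1 - s) *\<^sub>R (q - p)" "q - y = (1 - t) *\<^sub>R (q - p)" "x - p = s *\<^sub>R (q - p)" "y - p = t *\<^sub>R (q - p)"
      using xp yp by (simp_all add: algebra_simps)
    then have nm: "norm (q - x) = (1 - s) * norm (q - p)" "norm (q - y) = (1 - t) * norm (q - p)"
      "norm (x - p) = s * norm (q - p)" "norm (y - p) = t * norm (q - p)"
      using st by simp_all
    have "norm (q - x) * norm (y - p) / (norm (q - y) * norm (x - p)) = (1 - s) * t / ((1 - t) * s)"
      unfolding nm using N by simp
    then show ?thesis unfolding V_def using pq xK x y by (simp add: dom_rep_slice)
  qed
  have uniq: "a = pline p \<and> b = pline q"
    if ab: "a \<in> frontier \<Omega>" "b \<in> frontier \<Omega>" "closure \<Omega> \<inter> proj_line (pline x) (pline y) = proj_seg \<Omega> a b"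
      "pline x \<in> proj_seg \<Omega> a (pline y)" "pline y \<in> proj_seg \<Omega> (pline x) b" for a b
  proof -
    have "a \<in> closure \<Omega>" "b \<in> closure \<Omega>" using ab by (auto simp: frontier_def)
    then obtain A B where A: "A \<in> K" "e \<bullet> A = 1" "a = pline A" and B: "B \<in> K" "e \<bullet> B = 1" "b = pline B"
      by (metis slice_rep)
    have "v \<in> closed_segment A B \<longleftrightarrow> v \<in> closed_segment p q" for v
    proof (cases "v \<in> K \<and> e \<bullet> v = 1")
      case True
      then show ?thesis
        using pline_slice_segment[OF A(1) B(1) A(2) B(2), of v] pline_slice_segment[OF pq(1,4,3,6), of v]
          ab(3) line A B by simp
    next
      case False
      then show ?thesis
        using slice_segment[OF A(1) B(1) A(2) B(2)] slice_segment[OF pq(1,4,3,6)] by blast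
    qed
    then have "closed_segment A B = closed_segment p q" by blast
    then have AB: "{A, B} = {p, q}" by (simp add: closed_segment_eq)
    \<comment> \<open>The chord determines its endpoints only as an unordered pair; the reversed
      order is excluded by the position of \<open>x\<close> before \<open>y\<close>.\<close>
    have "A \<noteq> q"
    proof
      assume "A = q"
      then have "x \<in> closed_segment q y"
        using ab(4) pline_slice_segment[OF A(1) xK(2) A(2) y(2) xK(1) x(2)] A(3) by simp
      then obtain r where r: "0 \<le> r" "r \<le> 1" "x = (1 - r) *\<^sub>R q + r *\<^sub>R y" by (auto simp: closed_segment_def)
      have "p + s *\<^sub>R (q - p) = (1 - r) *\<^sub>R q + r *\<^sub>R (p + t *\<^sub>R (q - p))" using r(3) xp yp by simp
      then have "(s - (1 - r) - r * t) *\<^sub>R (q - p) = 0" by (simp add: algebra_simps)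
      then have "s - (1 - r) - r * t = 0" using N by auto
      then have "t - s = - ((1 - r) * (1 - t))" by (simp add: algebra_simps)
      moreover have "0 \<le> (1 - r) * (1 - t)" using r st by simp
      ultimately show False using st by simp
    qed
    then show ?thesis using AB A B by (auto simp: doubleton_eq_iff)
  qed
  have "hilbert_dist \<Omega> (pline x) (pline y) = V"
    unfolding hilbert_dist_def if_not_P[OF pl_ne]
  proof (rule the_equality)
    show "\<exists>a b. a \<in> frontier \<Omega> \<and> b \<in> frontier \<Omega> \<and>
        closure \<Omega> \<inter> proj_line (pline x) (pline y) = proj_seg \<Omega> a b \<and>
        pline x \<in> proj_seg \<Omega> a (pline y) \<and> pline y \<in> proj_seg \<Omega> (pline x) b \<and>
        V = 1 / 2 * ln (norm (dom_rep \<Omega> b - dom_rep \<Omega> (pline x)) * norm (dom_rep \<Omega> (pline y) - dom_rep \<Omega> a) /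
              (norm (dom_rep \<Omega> b - dom_rep \<Omega> (pline y)) * norm (dom_rep \<Omega> (pline x) - dom_rep \<Omega> a)))"
    proof (rule exI[of _ "pline p"], rule exI[of _ "pline q"], intro conjI line val[symmetric])
      have "p \<noteq> 0" "q \<noteq> 0" using pq by auto
      then show "pline p \<in> frontier \<Omega>" "pline q \<in> frontier \<Omega>" using pq by (simp_all add: pline_frontier_iff)
      show "pline x \<in> proj_seg \<Omega> (pline p) (pline y)"
        using pline_slice_segment[OF pq(1) xK(2) pq(3) y(2) xK(1) x(2)] xseg by simp
      show "pline y \<in> proj_seg \<Omega> (pline x) (pline q)"
        using pline_slice_segment[OF xK(1) pq(4) x(2) pq(6) xK(2) y(2)] yseg by simp
    qed
  next
    fix r assume "\<exists>a b. a \<in> frontier \<Omega> \<and> b \<in> frontier \<Omega> \<and>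
        closure \<Omega> \<inter> proj_line (pline x) (pline y) = proj_seg \<Omega> a b \<and>
        pline x \<in> proj_seg \<Omega> a (pline y) \<and> pline y \<in> proj_seg \<Omega> (pline x) b \<and>
        r = 1 / 2 * ln (norm (dom_rep \<Omega> b - dom_rep \<Omega> (pline x)) * norm (dom_rep \<Omega> (pline y) - dom_rep \<Omega> a) /
              (norm (dom_rep \<Omega> b - dom_rep \<Omega> (pline y)) * norm (dom_rep \<Omega> (pline x) - dom_rep \<Omega> a)))"
    then obtain a b where ab: "a \<in> frontier \<Omega>" "b \<in> frontier \<Omega>"
        "closure \<Omega> \<inter> proj_line (pline x) (pline y) = proj_seg \<Omega> a b"
        "pline x \<in> proj_seg \<Omega> a (pline y)" "pline y \<in> proj_seg \<Omega> (pline x) b"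
        "r = 1 / 2 * ln (norm (dom_rep \<Omega> b - dom_rep \<Omega> (pline x)) * norm (dom_rep \<Omega> (pline y) - dom_rep \<Omega> a) /
              (norm (dom_rep \<Omega> b - dom_rep \<Omega> (pline y)) * norm (dom_rep \<Omega> (pline x) - dom_rep \<Omega> a)))"
      by (elim exE conjE)
    from uniq[OF ab(1-5)] ab(6) show "r = V" using val by simp
  qed
  moreover have "x = (1 - s) *\<^sub>R p + s *\<^sub>R q" "y = (1 - t) *\<^sub>R p + t *\<^sub>R q"
    using xp yp by (simp_all add: algebra_simps)
  ultimately show ?thesis using that[OF pq(1,4) _ _ st] by (simp add: V_def)
qed

lemma dom_rep_C:
  assumes "x \<in> \<Omega>" obtains v where "v \<in> C" "e \<bullet> v = 1" "x = pline v"
proof -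
  have "x \<in> closure \<Omega>" using assms closure_subset by blast
  then obtain v where v: "v \<in> K" "e \<bullet> v = 1" "x = pline v" by (rule slice_rep)
  then have "v \<in> C" using assms pline_in_iff[of v] by (cases "v = 0") auto
  with v that show ?thesis by blast
qed

lemma hilbert_dist_nonneg:
  assumes "x \<in> \<Omega>" "y \<in> \<Omega>"
  shows "0 \<le> hilbert_dist \<Omega> x y"
proof -
  obtain u where u: "u \<in> C" "e \<bullet> u = 1" "x = pline u" using assms(1) by (rule dom_rep_C)
  obtain v where v: "v \<in> C" "e \<bullet> v = 1" "y = pline v" using assms(2) by (rule dom_rep_C)
  show ?thesis
  proof (cases "u = v")
    case True then show ?thesis using u v by (simp add: hilbert_dist_def)
  next
    case False
    obtain p q s t where st: "0 < s" "s < t" "t < 1"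
      "hilbert_dist \<Omega> (pline u) (pline v) = 1 / 2 * ln ((1 - s) * t / ((1 - t) * s))"
      using hilbert_dist_chord[OF u(1,2) v(1,2) False] by metis
    have "1 \<le> (1 - s) * t / ((1 - t) * s)" using st by (simp add: pos_le_divide_eq algebra_simps)
    then have "0 \<le> ln ((1 - s) * t / ((1 - t) * s))" by (rule ln_ge_zero)
    then show ?thesis unfolding u(3) v(3) st(4) by simp
  qed
qed

text \<open>Both functionals are affine on the chord and nonnegative at its ends, which bounds the
  growth of \<open>f\<close> from \<open>x\<close> to \<open>y\<close> by \<open>t / s\<close> and
  the decrease of \<open>f'\<close> by \<open>(1 - s) / (1 - t)\<close>. This is one half of the
  description of the metric by ratios of positive functionals.\<close>

lemma hilbert_dist_ge:
  assumes f: "\<And>v. v \<in> K \<Longrightarrow> 0 \<le> f \<bullet> v" "\<And>v. v \<in> C \<Longrightarrow> 0 < f \<bullet> v"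
    and f': "\<And>v. v \<in> K \<Longrightarrow> 0 \<le> f' \<bullet> v" "\<And>v. v \<in> C \<Longrightarrow> 0 < f' \<bullet> v"
    and xy: "x \<in> C" "y \<in> C" "pline x \<noteq> pline y"
  shows "1 / 2 * ln (((f \<bullet> y) / (f \<bullet> x)) * ((f' \<bullet> x) / (f' \<bullet> y))) \<le> hilbert_dist \<Omega> (pline x) (pline y)"
proof -
  have ex: "e \<bullet> x > 0" "e \<bullet> y > 0" using xy pos by auto
  define u where "u = inverse (e \<bullet> x) *\<^sub>R x"
  define v where "v = inverse (e \<bullet> y) *\<^sub>R y"
  have n0: "x \<noteq> 0" "y \<noteq> 0" using ex by auto
  have u: "u \<in> C" "e \<bullet> u = 1" "pline u = pline x" and v: "v \<in> C" "e \<bullet> v = 1" "pline v = pline y"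
    using ex xy n0 by (auto simp: u_def v_def pline_scaleR intro: scale)
  have uv: "u \<noteq> v" using u v xy(3) by auto
  obtain p q s t where pq: "p \<in> K" "q \<in> K" "u = (1 - s) *\<^sub>R p + s *\<^sub>R q" "v = (1 - t) *\<^sub>R p + t *\<^sub>R q"
    and st: "0 < s" "s < t" "t < 1"
    and h: "hilbert_dist \<Omega> (pline u) (pline v) = 1 / 2 * ln ((1 - s) * t / ((1 - t) * s))"
    using hilbert_dist_chord[OF u(1,2) v(1,2) uv] by blast
  \<comment> \<open>The product of the two ratios does not see the scaling of \<open>x\<close> and
    \<open>y\<close>.\<close>
  have eq: "((f \<bullet> y) / (f \<bullet> x)) * ((f' \<bullet> x) / (f' \<bullet> y)) = ((f \<bullet> v) / (f \<bullet> u)) * ((f' \<bullet> u) / (f' \<bullet> v))"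
    using ex by (simp add: u_def v_def)
  have fu: "f \<bullet> u = (1 - s) * (f \<bullet> p) + s * (f \<bullet> q)" "f \<bullet> v = (1 - t) * (f \<bullet> p) + t * (f \<bullet> q)"
    "f' \<bullet> u = (1 - s) * (f' \<bullet> p) + s * (f' \<bullet> q)" "f' \<bullet> v = (1 - t) * (f' \<bullet> p) + t * (f' \<bullet> q)"
    by (simp_all add: pq inner_add_right)
  have p0: "f \<bullet> u > 0" "f \<bullet> v > 0" "f' \<bullet> u > 0" "f' \<bullet> v > 0" using f f' u v by auto
  have "s * (f \<bullet> v) \<le> t * (f \<bullet> u)"
  proof -
    have "t * (f \<bullet> u) - s * (f \<bullet> v) = (t - s) * (f \<bullet> p)" unfolding fu by (simp add: algebra_simps)
    then show ?thesis using st f(1)[OF pq(1)] by (metis diff_ge_0_iff_ge less_imp_le mult_nonneg_nonneg)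
  qed
  then have 1: "(f \<bullet> v) / (f \<bullet> u) \<le> t / s" using p0 st by (simp add: field_simps)
  have "(1 - t) * (f' \<bullet> u) \<le> (1 - s) * (f' \<bullet> v)"
  proof -
    have "(1 - s) * (f' \<bullet> v) - (1 - t) * (f' \<bullet> u) = (t - s) * (f' \<bullet> q)" unfolding fu by (simp add: algebra_simps)
    then show ?thesis using st f'(1)[OF pq(2)] by (metis diff_ge_0_iff_ge less_imp_le mult_nonneg_nonneg)
  qed
  then have 2: "(f' \<bullet> u) / (f' \<bullet> v) \<le> (1 - s) / (1 - t)" using p0 st by (simp add: field_simps)
  have "((f \<bullet> v) / (f \<bullet> u)) * ((f' \<bullet> u) / (f' \<bullet> v)) \<le> t / s * ((1 - s) / (1 - t))"
    using p0 st by (intro mult_mono 1 2) auto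
  also have "\<dots> = (1 - s) * t / ((1 - t) * s)" by (simp add: mult.commute)
  finally have "ln (((f \<bullet> v) / (f \<bullet> u)) * ((f' \<bullet> u) / (f' \<bullet> v))) \<le> ln ((1 - s) * t / ((1 - t) * s))"
    using p0 st by (intro ln_mono) auto
  then show ?thesis using h u v eq by simp
qed

end

section \<open>Rank one isometries\<close>

context convex_domain begin

lemma biprox_attracting_point:
  assumes "biprox g a b \<alpha> \<beta>" "g = c *\<^sub>R \<gamma>" "c \<noteq> 0"
  shows "attracting_point \<gamma> = pline a"
proof -
  obtain f where "(\<lambda>n. inverse \<alpha> ^ n *\<^sub>R mpow g n) \<longlonglongrightarrow> outer a f" using biprox_limit[OF assms(1)] .
  then show ?thesis using assms by (intro attracting_point_limit) (auto simp: biprox_def)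
qed

lemma biprox_repelling_point:
  assumes g: "biprox g a b \<alpha> \<beta>" "g = c *\<^sub>R \<gamma>" "c \<noteq> 0"
  shows "repelling_point \<gamma> = pline b"
proof -
  have "g \<in> auts" using g(1) by (simp add: biprox_def)
  then obtain h where h: "g ** h = mat 1" "h ** g = mat 1" using auts_inv unfolding invertible_def by blast
  have "\<gamma> ** (c *\<^sub>R h) = mat 1" "(c *\<^sub>R h) ** \<gamma> = mat 1" using h by (simp_all add: g(2))
  then have "repelling_point \<gamma> = attracting_point (c *\<^sub>R h)" by (rule repelling_point_inverse)
  also have "\<dots> = pline b"
    by (rule biprox_attracting_point[OF biprox_inverse[OF g(1) h], of "inverse c"]) (use g(3) in auto)
  finally show ?thesis .
qed

lemma pact_scaled:
  assumes "g = c *\<^sub>R \<gamma>" "c \<noteq> 0" "invertible \<gamma>" "v \<noteq> 0"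
  shows "pact \<gamma> (pline v) = pline (g *v v)"
proof -
  have "\<gamma> *v v \<noteq> 0" using assms(3,4) by (metis invertible_left_inverse matrix_left_invertible_ker)
  then show ?thesis using assms by (simp add: pact_pline pline_scaleR)
qed

text \<open>The dual eigenvectors \<open>f\<close> and \<open>f'\<close> are multiplied by \<alpha>
  and \<beta>, so the bound from \<open>hilbert_dist_ge\<close> is the same number
  \<open>1 / 2 * ln (\<alpha> / \<beta>)\<close> at every point of the domain.\<close>

lemma biprox_translation_length:
  assumes g: "biprox g a b \<alpha> \<beta>" "g = c *\<^sub>R \<gamma>" "c \<noteq> 0" and inv: "invertible \<gamma>"
  shows "0 < translation_length \<Omega> \<gamma>"
proof -
  have gA: "g \<in> auts" and ab: "0 < \<beta>" "\<beta> < \<alpha>" using g(1) by (simp_all add: biprox_def)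
  obtain h where h: "g ** h = mat 1" "h ** g = mat 1" using auts_inv[OF gA] unfolding invertible_def by blast
  obtain f where f: "\<And>x. f \<bullet> (g *v x) = \<alpha> * (f \<bullet> x)" "\<And>x. x \<in> C \<Longrightarrow> 0 < f \<bullet> x" "\<And>x. x \<in> K \<Longrightarrow> 0 \<le> f \<bullet> x"
    using biprox_limit[OF g(1)] by metis
  obtain f' where f': "\<And>x. f' \<bullet> (h *v x) = inverse \<beta> * (f' \<bullet> x)" "\<And>x. x \<in> C \<Longrightarrow> 0 < f' \<bullet> x" "\<And>x. x \<in> K \<Longrightarrow> 0 \<le> f' \<bullet> x"
    using biprox_limit[OF biprox_inverse[OF g(1) h]] by metis
  have f'g: "f' \<bullet> (g *v x) = \<beta> * (f' \<bullet> x)" for x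
  proof -
    have "f' \<bullet> x = inverse \<beta> * (f' \<bullet> (g *v x))"
      using f'(1)[of "g *v x"] by (simp add: matrix_vector_mul_assoc h)
    then show ?thesis using ab by simp
  qed
  have "1 / 2 * ln (\<alpha> / \<beta>) \<le> hilbert_dist \<Omega> x (pact \<gamma> x)" if x: "x \<in> \<Omega>" for x
  proof -
    obtain v where v: "v \<in> C" "x = pline v" using dom_rep_C[OF x] by metis
    have v0: "v \<noteq> 0" using v(1) zero_notin_C by auto
    have gv: "g *v v \<in> C" using auts_C[OF gA] v by blast
    have pv: "pact \<gamma> x = pline (g *v v)" unfolding v(2) by (rule pact_scaled[OF g(2,3) inv v0])
    have fv: "0 < f \<bullet> v" "0 < f' \<bullet> v" using f f' v by auto
    have ne: "pline v \<noteq> pline (g *v v)"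
    proof
      assume "pline v = pline (g *v v)"
      then obtain d where d: "g *v v = d *\<^sub>R v" using pline_eq_iff v0 auts_nonzero[OF gA v0] by metis
      have "d * (f \<bullet> v) = \<alpha> * (f \<bullet> v)" "d * (f' \<bullet> v) = \<beta> * (f' \<bullet> v)"
        using f(1)[of v] f'g[of v] by (simp_all only: d inner_scaleR_right)
      then show False using fv ab by simp
    qed
    have "1 / 2 * ln (((f \<bullet> (g *v v)) / (f \<bullet> v)) * ((f' \<bullet> v) / (f' \<bullet> (g *v v)))) \<le> hilbert_dist \<Omega> (pline v) (pline (g *v v))"
      by (rule hilbert_dist_ge[OF f(3,2) f'(3,2) v(1) gv ne])
    moreover have "((f \<bullet> (g *v v)) / (f \<bullet> v)) * ((f' \<bullet> v) / (f' \<bullet> (g *v v))) = \<alpha> / \<beta>"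
      using fv by (simp add: f(1) f'g)
    ultimately show ?thesis using v pv by simp
  qed
  then have "1 / 2 * ln (\<alpha> / \<beta>) \<le> translation_length \<Omega> \<gamma>"
    unfolding translation_length_def using chart(3) by (intro cINF_greatest)
  moreover have "0 < ln (\<alpha> / \<beta>)" using ab by simp
  ultimately show ?thesis by simp
qed

lemma span_pair: "v \<in> span {a, b} \<longleftrightarrow> (\<exists>s t. v = s *\<^sub>R a + t *\<^sub>R b)" for a b v :: "real^'n"
proof
  assume "v \<in> span {a, b}"
  then obtain s where "v - s *\<^sub>R a \<in> span {b}" by (auto simp: span_insert)
  then obtain t where "v - s *\<^sub>R a = t *\<^sub>R b" by (auto simp: span_singleton)
  then have "v = s *\<^sub>R a + t *\<^sub>R b" by (simp add: algebra_simps)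
  then show "\<exists>s t. v = s *\<^sub>R a + t *\<^sub>R b" by blast
next
  assume "\<exists>s t. v = s *\<^sub>R a + t *\<^sub>R b"
  then show "v \<in> span {a, b}" by (auto intro!: span_add span_scale intro: span_base)
qed

lemma dim_span_pair:
  fixes a b :: "real^'n"
  assumes "pline a \<noteq> pline b" "a \<noteq> 0" "b \<noteq> 0"
  shows "dim (span {a, b}) = 2"
proof -
  have ab: "a \<noteq> b" using assms by auto
  have "a \<notin> span {b}"
  proof
    assume "a \<in> span {b}"
    then obtain t where "a = t *\<^sub>R b" by (auto simp: span_singleton)
    then show False using assms pline_scaleR[of t b] by auto
  qed
  then have "independent {a, b}" using assms ab by (simp add: independent_insert)
  then have "dim (span {a, b}) = card {a, b}" using dim_span_eq_card_independent by blast
  then show ?thesis using ab by simp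
qed

text \<open>The plane of \<open>a\<close> and \<open>b\<close> gives an axis, on which the two dual
  eigenvectors are the coordinates. Any other invariant plane meeting \<open>C\<close> contains the
  limits of the powers of \<open>g\<close> and of its inverse, so it is the same plane; hence every
  axis ends at the rays of \<open>a\<close> and \<open>b\<close>, in some order, and inherits the
  half triangle condition.\<close>

lemma biprox_rank_one:
  assumes g: "biprox g a b \<alpha> \<beta>" "g = c *\<^sub>R \<gamma>" "c \<noteq> 0" and \<gamma>: "\<gamma> \<in> automorphisms \<Omega>"
  shows "rank_one_isometry \<Omega> \<gamma>"
proof -
  note gb = g(1)[unfolded biprox_def]
  have inv: "invertible \<gamma>" using \<gamma> by (simp add: automorphisms_def)
  have gA: "g \<in> auts" using gb by blast
  have nt: "no_half_triangle a b" and abK: "a \<in> K" "b \<in> K" "a \<noteq> 0" "b \<noteq> 0" using gb by auto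
  obtain h where h: "g ** h = mat 1" "h ** g = mat 1" using auts_inv[OF gA] unfolding invertible_def by blast
  note hb = biprox_inverse[OF g(1) h]
  obtain f where f: "(\<lambda>n. inverse \<alpha> ^ n *\<^sub>R mpow g n) \<longlonglongrightarrow> outer a f" "f \<bullet> a = 1" "f \<bullet> b = 0"
    "\<And>x. x \<in> C \<Longrightarrow> 0 < f \<bullet> x" "\<And>x. x \<in> K \<Longrightarrow> 0 \<le> f \<bullet> x" "a \<notin> C"
    by (rule biprox_limit[OF g(1)], rule that, assumption+)
  obtain f' where f': "(\<lambda>n. inverse (inverse \<beta>) ^ n *\<^sub>R mpow h n) \<longlonglongrightarrow> outer b f'" "f' \<bullet> b = 1" "f' \<bullet> a = 0"
    "\<And>x. x \<in> C \<Longrightarrow> 0 < f' \<bullet> x" "\<And>x. x \<in> K \<Longrightarrow> 0 \<le> f' \<bullet> x" "b \<notin> C"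
    by (rule biprox_limit[OF hb], rule that, assumption+)
  have ab: "a + b \<in> C" using no_half_triangle_sum nt abK by blast
  have pab: "pline a \<noteq> pline b"
  proof
    assume "pline a = pline b"
    then obtain d where "b = d *\<^sub>R a" "d \<noteq> 0" using pline_eq_iff abK by blast
    then show False using f(2,3) by simp
  qed
  define V where "V = span {a, b}"
  have sV: "subspace V" by (simp add: V_def)
  have dV: "dim V = 2" unfolding V_def by (rule dim_span_pair[OF pab abK(3,4)])
  have seg: "open_proj_seg \<Omega> (pline a) (pline b) = proj_sub V \<inter> \<Omega>"
  proof (rule Set.set_eqI, rule iffI)
    fix z assume "z \<in> open_proj_seg \<Omega> (pline a) (pline b)"
    then obtain s t where st: "0 < s" "0 < t" "z = pline (s *\<^sub>R a + t *\<^sub>R b)"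
      using open_proj_seg_pline[OF abK(1,3,2,4) pab] by blast
    have vC: "s *\<^sub>R a + t *\<^sub>R b \<in> C" using C_pos_comb ab abK st by blast
    then have "s *\<^sub>R a + t *\<^sub>R b \<noteq> 0" using zero_notin_C by auto
    moreover have "s *\<^sub>R a + t *\<^sub>R b \<in> V" unfolding V_def span_pair by blast
    ultimately show "z \<in> proj_sub V \<inter> \<Omega>"
      using vC pline_in_proj_sub[OF sV] by (simp add: st(3)) (simp add: dcone_def)
  next
    fix z assume z: "z \<in> proj_sub V \<inter> \<Omega>"
    then obtain v where v: "v \<in> C" "z = pline v" using dom_rep_C by blast
    have "v \<noteq> 0" using v zero_notin_C by auto
    then have "v \<in> V" using pline_in_proj_sub[OF sV] z v by blast
    then obtain s t where st: "v = s *\<^sub>R a + t *\<^sub>R b" unfolding V_def span_pair by blast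
    have "f \<bullet> v = s" "f' \<bullet> v = t" by (simp_all add: st inner_add_right f f')
    then have "0 < s" "0 < t" using f(4)[OF v(1)] f'(4)[OF v(1)] by auto
    then show "z \<in> open_proj_seg \<Omega> (pline a) (pline b)"
      unfolding open_proj_seg_pline[OF abK(1,3,2,4) pab] v(2) st by blast
  qed
  have axis: "is_axis \<Omega> \<gamma> (pline a) (pline b)"
    unfolding is_axis_def
  proof (intro conjI exI[of _ V] sV dV seg pab)
    show "pline a \<in> frontier \<Omega>" "pline b \<in> frontier \<Omega>" using abK f f' by (simp_all add: pline_frontier_iff)
    show "(*v) \<gamma> ` V \<subseteq> V"
    proof
      fix z assume "z \<in> (*v) \<gamma> ` V"
      then obtain v where v: "v \<in> V" "z = \<gamma> *v v" by blast
      then obtain s t where "v = s *\<^sub>R a + t *\<^sub>R b" unfolding V_def span_pair by blast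
      then have z: "z = \<gamma> *v (s *\<^sub>R a + t *\<^sub>R b)" using v by simp
      have "\<gamma> = inverse c *\<^sub>R g" using g by simp
      then have "z = (inverse c * s * \<alpha>) *\<^sub>R a + (inverse c * t * \<beta>) *\<^sub>R b"
        using gb by (simp add: z matrix_vec_add scaleR_add_right mult_ac)
      then show "z \<in> V" unfolding V_def span_pair by blast
    qed
  qed
  have no: "\<not> (\<exists>z\<in>frontier \<Omega>. proj_seg \<Omega> p z \<union> proj_seg \<Omega> z q \<subseteq> frontier \<Omega>)" if ax: "is_axis \<Omega> \<gamma> p q" for p q
  proof
    obtain W where pq: "p \<in> frontier \<Omega>" "q \<in> frontier \<Omega>" "p \<noteq> q"
      and W: "subspace W" "dim W = 2" "(*v) \<gamma> ` W \<subseteq> W" "open_proj_seg \<Omega> p q = proj_sub W \<inter> \<Omega>"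
      using ax unfolding is_axis_def by blast
    obtain u where u: "u \<in> K" "u \<noteq> 0" "u \<notin> C" "p = pline u" using pq(1) frontier_iff by blast
    obtain w where w: "w \<in> K" "w \<noteq> 0" "w \<notin> C" "q = pline w" using pq(2) frontier_iff by blast
    have uw: "pline u \<noteq> pline w" using pq u w by simp
    have segW: "pline (s *\<^sub>R u + t *\<^sub>R w) \<in> proj_sub W \<inter> \<Omega>" if "0 < s" "0 < t" for s t
      using open_proj_seg_pline[OF u(1,2) w(1,2) uw] W(4) u(4) w(4) that by blast
    have inW: "s *\<^sub>R u + t *\<^sub>R w \<in> C \<and> s *\<^sub>R u + t *\<^sub>R w \<in> W" if st: "0 < s" "0 < t" for s t
    proof -
      have "s *\<^sub>R u + t *\<^sub>R w \<in> K" using u w st by (intro K_add[OF K_scale K_scale]) auto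
      moreover have "e \<bullet> (s *\<^sub>R u + t *\<^sub>R w) > 0"
        using K_pos[OF u(1,2)] K_pos[OF w(1,2)] st by (simp add: inner_add_right add_pos_pos)
      then have "s *\<^sub>R u + t *\<^sub>R w \<noteq> 0" by auto
      ultimately show ?thesis using segW[OF st] pline_in_iff pline_in_proj_sub[OF W(1)] by blast
    qed
    \<comment> \<open>Only interior points of the segment are known to lie in \<open>W\<close>;
      differences of three of them recover the ends.\<close>
    have "2 *\<^sub>R u + 1 *\<^sub>R w \<in> W" "1 *\<^sub>R u + 1 *\<^sub>R w \<in> W" "1 *\<^sub>R u + 2 *\<^sub>R w \<in> W" using inW[of 2 1] inW[of 1 1] inW[of 1 2] by auto
    then have "(2 *\<^sub>R u + 1 *\<^sub>R w) - (1 *\<^sub>R u + 1 *\<^sub>R w) \<in> W" "(1 *\<^sub>R u + 2 *\<^sub>R w) - (1 *\<^sub>R u + 1 *\<^sub>R w) \<in> W"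
      using W(1) subspace_diff by blast+
    then have uwW: "u \<in> W" "w \<in> W" by (simp_all add: scaleR_2)
    define x where "x = u + w"
    have x: "x \<in> C" "x \<in> W" using inW[of 1 1] by (simp_all add: x_def)
    have gW: "g *v v \<in> W" if "v \<in> W" for v
      using W(1,3) that by (auto simp: g(2) intro!: subspace_scale)
    have hW: "h *v v \<in> W" if v: "v \<in> W" for v
    proof -
      have inj: "inj ((*v) g)" using h(2) by (metis inj_on_def matrix_vector_mul_assoc matrix_vector_mul_lid)
      have "dim ((*v) g ` W) = dim W"
        by (rule dim_image_eq) (use inj in \<open>auto simp: matrix_vector_mul_linear inj_on_def\<close>)
      moreover have "(*v) g ` W \<subseteq> W" using gW by blast
      moreover have "subspace ((*v) g ` W)" by (rule linear_subspace_image[OF matrix_vector_mul_linear W(1)])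
      ultimately have "(*v) g ` W = W" using subspace_dim_equal[OF _ W(1)] by simp
      then obtain y where "y \<in> W" "v = g *v y" using v by blast
      then show ?thesis by (simp add: matrix_vector_mul_assoc h)
    qed
    \<comment> \<open>Normalised powers move the point \<open>x\<close> of the plane towards the
      line of \<open>d\<close>, and a subspace is closed.\<close>
    have lim_in: "d \<in> W"
      if M: "\<And>v. v \<in> W \<Longrightarrow> m *v v \<in> W" "(\<lambda>n. k ^ n *\<^sub>R mpow m n) \<longlonglongrightarrow> outer d j" "0 < j \<bullet> x" for m k d j
    proof -
      have "mpow m n *v v \<in> W" if "v \<in> W" for n v
        using that by (induction n) (simp_all add: M(1) flip: matrix_vector_mul_assoc)
      then have in_W: "(k ^ n *\<^sub>R mpow m n) *v x \<in> W" for n using x W(1) by (simp add: subspace_scale)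
      have lim: "(\<lambda>n. (k ^ n *\<^sub>R mpow m n) *v x) \<longlonglongrightarrow> outer d j *v x" by (intro tendsto_intros M)
      have "outer d j *v x \<in> W"
        by (rule closed_sequentially[OF closed_subspace[OF W(1)] in_W lim])
      then have "(j \<bullet> x) *\<^sub>R d \<in> W" by simp
      then have "inverse (j \<bullet> x) *\<^sub>R ((j \<bullet> x) *\<^sub>R d) \<in> W" by (rule subspace_scale[OF W(1)])
      then show ?thesis using M(3) by simp
    qed
    have "a \<in> W" using lim_in[OF gW f(1) f(4)[OF x(1)]] .
    moreover have "b \<in> W" using lim_in[OF hW f'(1) f'(4)[OF x(1)]] .
    ultimately have "V \<subseteq> W" unfolding V_def using W(1) by (intro span_minimal) auto
    then have VW: "V = W" using subspace_dim_equal[OF sV W(1)] dV W(2) by simp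
    have on_axis: "\<exists>s>0. v = s *\<^sub>R a \<or> v = s *\<^sub>R b" if v: "v \<in> K" "v \<noteq> 0" "v \<notin> C" "v \<in> W" for v
    proof -
      obtain s t where st: "v = s *\<^sub>R a + t *\<^sub>R b" using v(4) unfolding VW[symmetric] V_def span_pair by blast
      have "f \<bullet> v = s" "f' \<bullet> v = t" by (simp_all add: st inner_add_right f f')
      then have st0: "0 \<le> s" "0 \<le> t" using f(5)[OF v(1)] f'(5)[OF v(1)] by auto
      have "\<not> (0 < s \<and> 0 < t)" using C_pos_comb[OF ab abK(1,2)] v(3) st by blast
      then consider "s = 0" "t > 0" | "t = 0" "s > 0" using st0 st v(2) by force
      then show ?thesis using st by cases auto
    qed
    obtain s where s: "s > 0" "u = s *\<^sub>R a \<or> u = s *\<^sub>R b" using on_axis[OF u(1-3) uwW(1)] by blast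
    obtain t where t: "t > 0" "w = t *\<^sub>R a \<or> w = t *\<^sub>R b" using on_axis[OF w(1-3) uwW(2)] by blast
    have uwab: "u = s *\<^sub>R a \<and> w = t *\<^sub>R b \<or> u = s *\<^sub>R b \<and> w = t *\<^sub>R a"
    proof -
      have "pline (s *\<^sub>R v) = pline (t *\<^sub>R v)" if "v \<noteq> 0" for v
        using pline_scaleR[of s v] pline_scaleR[of t v] s t that by simp
      then show ?thesis using s(2) t(2) uw abK by metis
    qed
    assume "\<exists>z\<in>frontier \<Omega>. proj_seg \<Omega> p z \<union> proj_seg \<Omega> z q \<subseteq> frontier \<Omega>"
    then obtain z where z: "z \<in> frontier \<Omega>" "proj_seg \<Omega> p z \<subseteq> frontier \<Omega>" "proj_seg \<Omega> z q \<subseteq> frontier \<Omega>" by blast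
    obtain \<zeta> where \<zeta>: "\<zeta> \<in> K" "\<zeta> \<noteq> 0" "z = pline \<zeta>" using z(1) frontier_iff by blast
    have e0: "e \<bullet> \<zeta> > 0" "e \<bullet> u > 0" "e \<bullet> w > 0" using K_pos \<zeta> u w by auto
    have sumK: "u + \<zeta> \<in> K" "w + \<zeta> \<in> K" "u + \<zeta> \<noteq> 0" "w + \<zeta> \<noteq> 0"
    proof -
      show "u + \<zeta> \<in> K" "w + \<zeta> \<in> K" using K_add \<zeta> u w by auto
      have "e \<bullet> (u + \<zeta>) > 0" "e \<bullet> (w + \<zeta>) > 0" using e0 by (simp_all add: inner_add_right)
      then show "u + \<zeta> \<noteq> 0" "w + \<zeta> \<noteq> 0" by auto
    qed
    have "pline (1 *\<^sub>R u + 1 *\<^sub>R \<zeta>) \<in> proj_seg \<Omega> p z"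
      unfolding u(4) \<zeta>(3) proj_seg_pline[OF u(1,2) \<zeta>(1,2)] by (rule CollectI, rule exI[of _ 1], rule exI[of _ 1]) simp
    then have uC: "u + \<zeta> \<notin> C" using z(2) pline_frontier_iff[OF sumK(1,3)] by auto
    have "pline (1 *\<^sub>R \<zeta> + 1 *\<^sub>R w) \<in> proj_seg \<Omega> z q"
      unfolding w(4) \<zeta>(3) proj_seg_pline[OF \<zeta>(1,2) w(1,2)] by (rule CollectI, rule exI[of _ 1], rule exI[of _ 1]) simp
    then have wC: "w + \<zeta> \<notin> C" using z(3) pline_frontier_iff[OF sumK(2,4)] by (auto simp: add.commute)
    \<comment> \<open>The two possible orders of the ends are treated together.\<close>
    have "a + \<zeta> \<notin> C" "b + \<zeta> \<notin> C"
      using C_pos_comb[of a \<zeta> s 1] C_pos_comb[of b \<zeta> s 1] C_pos_comb[of a \<zeta> t 1] C_pos_comb[of b \<zeta> t 1]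
        uwab s(1) t(1) uC wC abK \<zeta>(1) by auto
    then show False using nt \<zeta> unfolding no_half_triangle_def by blast
  qed
  show ?thesis
    unfolding rank_one_isometry_def
    using \<gamma> biprox_translation_length[OF g inv] axis no by blast
qed

lemma translation_length_fixed_point:
  assumes \<gamma>: "\<gamma> \<in> automorphisms \<Omega>" and x: "x \<in> \<Omega>" "pact \<gamma> x = x"
  shows "translation_length \<Omega> \<gamma> \<le> 0"
proof -
  have "bdd_below ((\<lambda>x. hilbert_dist \<Omega> x (pact \<gamma> x)) ` \<Omega>)"
  proof (rule bdd_belowI2)
    fix y assume y: "y \<in> \<Omega>"
    then have "pact \<gamma> y \<in> \<Omega>" using \<gamma> unfolding automorphisms_def by blast
    then show "0 \<le> hilbert_dist \<Omega> y (pact \<gamma> y)" using hilbert_dist_nonneg y by blast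
  qed
  then have "translation_length \<Omega> \<gamma> \<le> hilbert_dist \<Omega> x (pact \<gamma> x)"
    unfolding translation_length_def using x(1) by (intro cINF_lower)
  then show ?thesis using x(2) by (simp add: hilbert_dist_def)
qed

lemma nonneg_of_small_perturbation:
  fixes p r :: real
  assumes "\<And>d. 0 < d \<Longrightarrow> 0 < p + d * r"
  shows "0 \<le> p"
proof (rule tendsto_lowerbound)
  have "((\<lambda>n. p + inverse (real (Suc n)) * r) \<longlongrightarrow> p + 0 * r) sequentially"
    by (intro tendsto_intros LIMSEQ_inverse_real_of_nat)
  then show "((\<lambda>n. p + inverse (real (Suc n)) * r) \<longlongrightarrow> p) sequentially" by simp
  show "\<forall>\<^sub>F n in sequentially. 0 \<le> p + inverse (real (Suc n)) * r"
    by (intro always_eventually allI less_imp_le assms) simp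
qed simp

text \<open>On the plane of an axis \<open>g\<close> acts, in the basis \<open>a\<close>,
  \<open>b\<close> of boundary rays, by a nonnegative two by two matrix that maps boundary rays to
  boundary rays, so by a diagonal or an antidiagonal one. An antidiagonal matrix, or a diagonal one
  with equal entries, has an eigenvector in the open cone, that is a fixed point in the domain,
  against positive translation length.\<close>

lemma rank_one_biprox:
  assumes r1: "rank_one_isometry \<Omega> \<gamma>"
  obtains c a b \<alpha> \<beta> where "c \<noteq> 0" "biprox (c *\<^sub>R \<gamma>) a b \<alpha> \<beta>"
proof -
  have \<gamma>: "\<gamma> \<in> automorphisms \<Omega>" and tl: "0 < translation_length \<Omega> \<gamma>"
    using r1 by (simp_all add: rank_one_isometry_def)
  have inv: "invertible \<gamma>" using \<gamma> by (simp add: automorphisms_def)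
  obtain c where c: "c = 1 \<or> c = - 1" "\<And>v. (c *\<^sub>R \<gamma>) *v v \<in> C \<longleftrightarrow> v \<in> C"
    using automorphism_cone[OF \<gamma>] by blast
  have c0: "c \<noteq> 0" using c(1) by auto
  define g where "g = c *\<^sub>R \<gamma>"
  obtain \<gamma>' where "\<gamma> ** \<gamma>' = mat 1" "\<gamma>' ** \<gamma> = mat 1" using inv unfolding invertible_def by blast
  then have "invertible g" unfolding invertible_def g_def
    using c0 by (intro exI[of _ "inverse c *\<^sub>R \<gamma>'"]) simp
  then have gA: "g \<in> auts" using c(2) by (simp add: auts_def g_def)
  obtain p q where ax: "is_axis \<Omega> \<gamma> p q" using r1 unfolding rank_one_isometry_def by blast
  have no: "\<not> (\<exists>z\<in>frontier \<Omega>. proj_seg \<Omega> p z \<union> proj_seg \<Omega> z q \<subseteq> frontier \<Omega>)"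
    using r1 ax unfolding rank_one_isometry_def by blast
  obtain V where pq: "p \<in> frontier \<Omega>" "q \<in> frontier \<Omega>" "p \<noteq> q"
    and V: "subspace V" "dim V = 2" "(*v) \<gamma> ` V \<subseteq> V" "open_proj_seg \<Omega> p q = proj_sub V \<inter> \<Omega>"
    using ax unfolding is_axis_def by blast
  obtain a where a: "a \<in> K" "a \<noteq> 0" "a \<notin> C" "p = pline a" using pq(1) frontier_iff by blast
  obtain b where b: "b \<in> K" "b \<noteq> 0" "b \<notin> C" "q = pline b" using pq(2) frontier_iff by blast
  have ab: "pline a \<noteq> pline b" using pq a b by simp
  have segV: "proj_sub V \<inter> \<Omega> = {pline (s *\<^sub>R a + t *\<^sub>R b) | s t. 0 < s \<and> 0 < t}"
    using open_proj_seg_pline[OF a(1,2) b(1,2) ab] V(4) a(4) b(4) by simp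
  have inV: "s *\<^sub>R a + t *\<^sub>R b \<in> C \<and> s *\<^sub>R a + t *\<^sub>R b \<in> V" if st: "0 < s" "0 < t" for s t
  proof -
    have "s *\<^sub>R a + t *\<^sub>R b \<in> K" using a b st by (intro K_add[OF K_scale K_scale]) auto
    moreover have "e \<bullet> (s *\<^sub>R a + t *\<^sub>R b) > 0"
      using K_pos[OF a(1,2)] K_pos[OF b(1,2)] st by (simp add: inner_add_right add_pos_pos)
    then have "s *\<^sub>R a + t *\<^sub>R b \<noteq> 0" by auto
    moreover have "pline (s *\<^sub>R a + t *\<^sub>R b) \<in> proj_sub V \<inter> \<Omega>" using segV st by blast
    ultimately show ?thesis using pline_in_iff pline_in_proj_sub[OF V(1)] by blast
  qed
  have VC: "\<exists>s t. 0 < s \<and> 0 < t \<and> v = s *\<^sub>R a + t *\<^sub>R b" if v: "v \<in> V" "v \<in> C" for v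
  proof -
    have v0: "v \<noteq> 0" using v zero_notin_C by auto
    have "pline v \<in> proj_sub V \<inter> \<Omega>" using v pline_in_proj_sub[OF V(1) v0] by (simp add: dcone_def)
    then obtain s t where st: "0 < s" "0 < t" "pline v = pline (s *\<^sub>R a + t *\<^sub>R b)" using segV by blast
    have "s *\<^sub>R a + t *\<^sub>R b \<in> C" using inV st by blast
    moreover from this have "s *\<^sub>R a + t *\<^sub>R b \<noteq> 0" using zero_notin_C by metis
    ultimately obtain d where "d > 0" "v = d *\<^sub>R (s *\<^sub>R a + t *\<^sub>R b)"
      using pline_K_inj[of "s *\<^sub>R a + t *\<^sub>R b" v] C_K v v0 st(3) by metis
    then have "0 < d * s" "0 < d * t" "v = (d * s) *\<^sub>R a + (d * t) *\<^sub>R b" using st by (simp_all add: scaleR_add_right)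
    then show ?thesis by blast
  qed
  have coords: "s = s' \<and> t = t'" if "s *\<^sub>R a + t *\<^sub>R b = s' *\<^sub>R a + t' *\<^sub>R b" for s t s' t'
  proof -
    have eq: "(s - s') *\<^sub>R a = (t' - t) *\<^sub>R b" using that by (simp add: algebra_simps)
    have "s = s'"
    proof (rule ccontr)
      assume "s \<noteq> s'"
      then have "a = ((t' - t) / (s - s')) *\<^sub>R b"
        using eq by (metis (no_types, lifting) divide_inverse_commute left_inverse right_minus_eq scaleR_one scaleR_scaleR)
      then show False using ab a(2) b(2) pline_scaleR[of "(t' - t) / (s - s')" b] by auto
    qed
    moreover from this have "t' = t" using eq b(2) by simp
    ultimately show ?thesis by simp
  qed
  have "1 *\<^sub>R a + 1 *\<^sub>R b \<in> V" "2 *\<^sub>R a + 1 *\<^sub>R b \<in> V" "1 *\<^sub>R a + 2 *\<^sub>R b \<in> V" using inV[of 2 1] inV[of 1 1] inV[of 1 2] by auto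
  then have "(2 *\<^sub>R a + 1 *\<^sub>R b) - (1 *\<^sub>R a + 1 *\<^sub>R b) \<in> V" "(1 *\<^sub>R a + 2 *\<^sub>R b) - (1 *\<^sub>R a + 1 *\<^sub>R b) \<in> V"
    using V(1) subspace_diff by blast+
  then have abV: "a \<in> V" "b \<in> V" by (simp_all add: scaleR_2)
  have "span {a, b} \<subseteq> V" using abV V(1) by (intro span_minimal) auto
  moreover have "dim V \<le> dim (span {a, b})" unfolding dim_span_pair[OF ab a(2) b(2)] V(2) ..
  ultimately have Vs: "V = span {a, b}" using subspace_dim_equal[OF subspace_span V(1)] by blast
  have gV: "g *v v \<in> V" if "v \<in> V" for v
    using V(1,3) that by (auto simp: g_def intro!: subspace_scale)
  obtain p1 q1 where ga: "g *v a = p1 *\<^sub>R a + q1 *\<^sub>R b" using gV[OF abV(1)] unfolding Vs span_pair by blast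
  obtain r1 s1 where gb: "g *v b = r1 *\<^sub>R a + s1 *\<^sub>R b" using gV[OF abV(2)] unfolding Vs span_pair by blast
  have comb: "0 < x * p1 + y * r1 \<and> 0 < x * q1 + y * s1" if xy: "0 < x" "0 < y" for x y
  proof -
    have "x *\<^sub>R a + y *\<^sub>R b \<in> C" "x *\<^sub>R a + y *\<^sub>R b \<in> V" using inV[OF xy] by auto
    then have "g *v (x *\<^sub>R a + y *\<^sub>R b) \<in> C" "g *v (x *\<^sub>R a + y *\<^sub>R b) \<in> V" using auts_C[OF gA] gV by auto
    then obtain s t where st: "0 < s" "0 < t" "g *v (x *\<^sub>R a + y *\<^sub>R b) = s *\<^sub>R a + t *\<^sub>R b" using VC by blast
    have "g *v (x *\<^sub>R a + y *\<^sub>R b) = (x * p1 + y * r1) *\<^sub>R a + (x * q1 + y * s1) *\<^sub>R b"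
      by (simp add: matrix_vec_add ga gb algebra_simps)
    then show ?thesis using coords[of s t] st by metis
  qed
  \<comment> \<open>Only vectors with both weights positive are known to be interior; letting one
    weight tend to zero gives the signs of the entries.\<close>
  have nn: "0 \<le> p1" "0 \<le> q1" "0 \<le> r1" "0 \<le> s1"
    using nonneg_of_small_perturbation[of p1 r1] nonneg_of_small_perturbation[of q1 s1]
      nonneg_of_small_perturbation[of r1 p1] nonneg_of_small_perturbation[of s1 q1]
      comb[of 1] comb[of _ 1] by (simp_all add: add.commute)
  have gaC: "g *v a \<notin> C" "g *v b \<notin> C" using auts_C[OF gA] a b by auto
  have pq0: "p1 = 0 \<or> q1 = 0" "r1 = 0 \<or> s1 = 0"
    using inV[of p1 q1] inV[of r1 s1] gaC nn by (auto simp: ga gb less_le)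
  have det0: "(p1, r1) \<noteq> (0, 0)" "(q1, s1) \<noteq> (0, 0)" "(p1, q1) \<noteq> (0, 0)" "(r1, s1) \<noteq> (0, 0)"
    using comb[of 1 1] auts_nonzero[OF gA a(2)] auts_nonzero[OF gA b(2)] by (auto simp: ga gb)
  have nofix: False if v: "v \<in> C" "g *v v = d *\<^sub>R v" for v d
  proof -
    have v0: "v \<noteq> 0" using v zero_notin_C by auto
    have "d \<noteq> 0" using v auts_nonzero[OF gA v0] by auto
    then have "pact \<gamma> (pline v) = pline v" using pact_scaled[OF g_def c0 inv v0] v v0 by (simp add: pline_scaleR)
    moreover have "pline v \<in> \<Omega>" using v by (simp add: dcone_def)
    ultimately show False using translation_length_fixed_point[OF \<gamma>] tl by force
  qed
  have "q1 = 0 \<and> r1 = 0"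
  proof (rule ccontr)
    assume "\<not> (q1 = 0 \<and> r1 = 0)"
    then have ps: "p1 = 0" "s1 = 0" "0 < q1" "0 < r1" using pq0 det0 nn by auto
    \<comment> \<open>Balancing the two off-diagonal entries by square roots produces an interior
      ray fixed by the exchange of \<open>a\<close> and \<open>b\<close>.\<close>
    have "g *v (sqrt r1 *\<^sub>R a + sqrt q1 *\<^sub>R b) = (sqrt r1 * sqrt q1) *\<^sub>R (sqrt r1 *\<^sub>R a + sqrt q1 *\<^sub>R b)"
    proof -
      have "sqrt r1 * q1 = sqrt r1 * sqrt q1 * sqrt q1" "sqrt q1 * r1 = sqrt r1 * sqrt q1 * sqrt r1"
        using ps by (simp_all add: mult.assoc) 
      moreover have "g *v (sqrt r1 *\<^sub>R a + sqrt q1 *\<^sub>R b) = (sqrt q1 * r1) *\<^sub>R a + (sqrt r1 * q1) *\<^sub>R b"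
        by (simp add: matrix_vec_add ga gb ps add.commute)
      ultimately show ?thesis by (simp only: scaleR_add_right scaleR_scaleR)
    qed
    moreover have "sqrt r1 *\<^sub>R a + sqrt q1 *\<^sub>R b \<in> C" using inV ps by simp
    ultimately show False using nofix by blast
  qed
  then have ga': "g *v a = p1 *\<^sub>R a" and gb': "g *v b = s1 *\<^sub>R b" and ps: "0 < p1" "0 < s1"
    using ga gb det0 nn by auto
  have ps_ne: "p1 \<noteq> s1"
  proof
    assume "p1 = s1"
    then have "g *v (1 *\<^sub>R a + 1 *\<^sub>R b) = p1 *\<^sub>R (1 *\<^sub>R a + 1 *\<^sub>R b)"
      by (simp add: matrix_vec_add ga' gb' scaleR_add_right)
    then show False using nofix inV[of 1 1] by auto
  qed
  have nt: "no_half_triangle a b"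
    unfolding no_half_triangle_def
  proof (intro ballI impI, rule ccontr)
    fix \<zeta> assume \<zeta>: "\<zeta> \<in> K" "\<zeta> \<noteq> 0" and nC: "\<not> (a + \<zeta> \<in> C \<or> b + \<zeta> \<in> C)"
    have \<zeta>C: "\<zeta> \<notin> C" using K_add_C[OF a(1)] nC by blast
    \<comment> \<open>If the sum of two generators is not interior, no nonnegative combination of
      them is, so the whole closed segment lies in the boundary.\<close>
    have fr: "proj_seg \<Omega> (pline v) (pline \<zeta>) \<subseteq> frontier \<Omega>" if v: "v \<in> K" "v \<noteq> 0" "v + \<zeta> \<notin> C" for v
    proof
      fix z assume "z \<in> proj_seg \<Omega> (pline v) (pline \<zeta>)"
      then obtain s t where st: "0 \<le> s" "0 \<le> t" "0 < s + t" "z = pline (s *\<^sub>R v + t *\<^sub>R \<zeta>)"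
        unfolding proj_seg_pline[OF v(1,2) \<zeta>] by blast
      have e0: "e \<bullet> v > 0" "e \<bullet> \<zeta> > 0" using K_pos v \<zeta> by auto
      have "e \<bullet> (s *\<^sub>R v + t *\<^sub>R \<zeta>) > 0"
        using st e0 by (cases "s = 0") (auto simp: inner_add_right intro!: add_pos_nonneg mult_pos_pos)
      then have n0: "s *\<^sub>R v + t *\<^sub>R \<zeta> \<noteq> 0" by auto
      have K': "s *\<^sub>R v + t *\<^sub>R \<zeta> \<in> K" using v \<zeta> st by (intro K_add[OF K_scale K_scale]) auto
      have "s *\<^sub>R v + t *\<^sub>R \<zeta> \<notin> C" using C_comb_imp[of s v t \<zeta>] v \<zeta> st by blast
      then show "z \<in> frontier \<Omega>" using pline_frontier_iff[OF K' n0] st(4) by simp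
    qed
    have comm: "proj_seg \<Omega> (pline \<zeta>) (pline b) = proj_seg \<Omega> (pline b) (pline \<zeta>)"
      by (simp add: proj_seg_def closed_segment_commute)
    have "pline \<zeta> \<in> frontier \<Omega>" using pline_frontier_iff[OF \<zeta>] \<zeta>C by simp
    moreover have "proj_seg \<Omega> p (pline \<zeta>) \<union> proj_seg \<Omega> (pline \<zeta>) q \<subseteq> frontier \<Omega>"
      using fr[OF a(1,2)] fr[OF b(1,2)] nC comm a(4) b(4) by simp
    ultimately show False using no by blast
  qed
  have "biprox g a b p1 s1 \<or> biprox g b a s1 p1"
    using gA a b nt no_half_triangle_sym[OF nt] ga' gb' ps ps_ne by (auto simp: biprox_def)
  then show ?thesis using that[OF c0] unfolding g_def by blast
qed

end

section \<open>Polynomial recurrences along powers of a linear map\<close>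

interpretation fun_space: vector_space "\<lambda>(c::real) (f::'a \<Rightarrow> real) x. c * f x"
  by unfold_locales (auto simp: fun_eq_iff algebra_simps)

lemma sum_fun_at: "(\<Sum>b\<in>A. (g b :: 'a \<Rightarrow> real)) x = (\<Sum>b\<in>A. g b x)"
  by (induction A rule: infinite_finite_induct) simp_all

text \<open>By bilinearity, the pairwise products of generators span all products.\<close>

lemma fun_space_mult_span:
  assumes g: "g \<in> fun_space.span \<Phi>" and h: "h \<in> fun_space.span \<Psi>"
  shows "(\<lambda>x. g x * h x) \<in> fun_space.span ((\<lambda>(\<phi>, \<psi>) x. \<phi> x * \<psi> x) ` (\<Phi> \<times> \<Psi>))" (is "_ \<in> fun_space.span ?B")
proof -
  have 1: "(\<lambda>x. \<phi> x * h x) \<in> fun_space.span ?B" if \<phi>: "\<phi> \<in> \<Phi>" for \<phi>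
    using h
  proof (induction rule: fun_space.span_induct_alt)
    case base
    have "(\<lambda>x. \<phi> x * 0 x) = 0" by (simp add: fun_eq_iff)
    then show ?case by (simp only: fun_space.span_zero)
  next
    case (step c \<psi> k)
    have "(\<lambda>x. \<phi> x * \<psi> x) \<in> fun_space.span ?B"
      using \<phi> step(1) by (intro fun_space.span_base) (auto intro!: image_eqI[of _ _ "(\<phi>, \<psi>)"])
    then have "(\<lambda>x. c * (\<phi> x * \<psi> x)) + (\<lambda>x. \<phi> x * k x) \<in> fun_space.span ?B"
      using step by (intro fun_space.span_add fun_space.span_scale[of _ _ c, simplified]) auto
    moreover have "(\<lambda>x. c * (\<phi> x * \<psi> x)) + (\<lambda>x. \<phi> x * k x) = (\<lambda>x. \<phi> x * ((\<lambda>x. c * \<psi> x) + k) x)"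
      by (simp add: fun_eq_iff algebra_simps)
    ultimately show ?case by simp
  qed
  show ?thesis using g
  proof (induction rule: fun_space.span_induct_alt)
    case base
    have "(\<lambda>x. 0 x * h x) = 0" by (simp add: fun_eq_iff)
    then show ?case by (simp only: fun_space.span_zero)
  next
    case (step c \<phi> k)
    have "(\<lambda>x. c * (\<phi> x * h x)) + (\<lambda>x. k x * h x) \<in> fun_space.span ?B"
      using step 1 by (intro fun_space.span_add fun_space.span_scale[of _ _ c, simplified]) auto
    moreover have "(\<lambda>x. c * (\<phi> x * h x)) + (\<lambda>x. k x * h x) = (\<lambda>x. ((\<lambda>x. c * \<phi> x) + k) x * h x)"
      by (simp add: fun_eq_iff algebra_simps)
    ultimately show ?case by simp
  qed
qed

text \<open>Substituting a linear map does not raise the degree. The finite set must not depend on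
  \<open>T\<close>; the induction builds it from unions and pairwise products of the sets for
  smaller polynomials.\<close>

lemma polynomial_translates_finite_dim:
  fixes F :: "'a::euclidean_space \<Rightarrow> real"
  assumes "real_polynomial_function F"
  shows "\<exists>\<Phi>. finite \<Phi> \<and> (\<forall>T :: 'a \<Rightarrow> 'a. linear T \<longrightarrow> (\<lambda>x. F (T x)) \<in> fun_space.span \<Phi>)"
  using assms
proof induction
  case (linear f)
  define \<Phi> where "\<Phi> = (\<lambda>b x :: 'a. x \<bullet> b) ` Basis"
  have "(\<lambda>x. f (T x)) \<in> fun_space.span \<Phi>" if T: "linear T" for T :: "'a \<Rightarrow> 'a"
  proof -
    have lin: "linear (\<lambda>x. f (T x))" using linear_compose[OF T bounded_linear.linear[OF linear]] by (simp add: o_def)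
    have "(\<lambda>x. f (T x)) = (\<Sum>b\<in>Basis. (\<lambda>x. f (T b) * (x \<bullet> b)))"
    proof
      fix x
      have "f (T x) = f (T (\<Sum>b\<in>Basis. (x \<bullet> b) *\<^sub>R b))" by (simp add: euclidean_representation)
      also have "\<dots> = (\<Sum>b\<in>Basis. f (T b) * (x \<bullet> b))"
        using linear_sum[OF lin, of "\<lambda>b. (x \<bullet> b) *\<^sub>R b" Basis] linear_scale[OF lin] by (simp add: mult.commute)
      finally show "f (T x) = (\<Sum>b\<in>Basis. (\<lambda>x. f (T b) * (x \<bullet> b))) x" by (simp add: sum_fun_at)
    qed
    moreover have "(\<Sum>b\<in>Basis. (\<lambda>x. f (T b) * (x \<bullet> b))) \<in> fun_space.span \<Phi>"
      by (intro fun_space.span_sum fun_space.span_scale fun_space.span_base) (auto simp: \<Phi>_def)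
    ultimately show ?thesis by simp
  qed
  then show ?case by (intro exI[of _ \<Phi>]) (auto simp: \<Phi>_def)
next
  case (const c)
  have "(\<lambda>x :: 'a. c * (\<lambda>_. 1) x) \<in> fun_space.span {\<lambda>_. 1}"
    by (intro fun_space.span_scale fun_space.span_base) simp
  then show ?case by (intro exI[of _ "{\<lambda>_. 1}"]) simp
next
  case (add f g)
  then obtain \<Phi> \<Psi> where "finite \<Phi>" "finite \<Psi>" and f: "\<And>T :: 'a \<Rightarrow> 'a. linear T \<Longrightarrow> (\<lambda>x. f (T x)) \<in> fun_space.span \<Phi>"
    and g: "\<And>T :: 'a \<Rightarrow> 'a. linear T \<Longrightarrow> (\<lambda>x. g (T x)) \<in> fun_space.span \<Psi>" by blast
  have "(\<lambda>x. f (T x) + g (T x)) \<in> fun_space.span (\<Phi> \<union> \<Psi>)" if T: "linear T" for T :: "'a \<Rightarrow> 'a"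
  proof -
    have "(\<lambda>x. f (T x)) \<in> fun_space.span (\<Phi> \<union> \<Psi>)" "(\<lambda>x. g (T x)) \<in> fun_space.span (\<Phi> \<union> \<Psi>)"
      using f[OF T] g[OF T] fun_space.span_mono[of \<Phi> "\<Phi> \<union> \<Psi>"] fun_space.span_mono[of \<Psi> "\<Phi> \<union> \<Psi>"] by auto
    then have "(\<lambda>x. f (T x)) + (\<lambda>x. g (T x)) \<in> fun_space.span (\<Phi> \<union> \<Psi>)" by (rule fun_space.span_add)
    then show ?thesis by (simp add: plus_fun_def)
  qed
  then show ?case using \<open>finite \<Phi>\<close> \<open>finite \<Psi>\<close> by (intro exI[of _ "\<Phi> \<union> \<Psi>"]) simp
next
  case (mult f g)
  then obtain \<Phi> \<Psi> where "finite \<Phi>" "finite \<Psi>" and f: "\<And>T :: 'a \<Rightarrow> 'a. linear T \<Longrightarrow> (\<lambda>x. f (T x)) \<in> fun_space.span \<Phi>"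
    and g: "\<And>T :: 'a \<Rightarrow> 'a. linear T \<Longrightarrow> (\<lambda>x. g (T x)) \<in> fun_space.span \<Psi>" by blast
  then show ?case using fun_space_mult_span[OF f g]
    by (intro exI[of _ "(\<lambda>(\<phi>, \<psi>) x. \<phi> x * \<psi> x) ` (\<Phi> \<times> \<Psi>)"]) simp
qed

lemma linear_funpow: "linear T \<Longrightarrow> linear (T ^^ n)" for T :: "'a::real_vector \<Rightarrow> 'a"
  by (induction n) (auto intro: linear_compose simp: linear_id[unfolded id_def] id_def)

text \<open>The functions \<open>F \<circ> T\<^sup>k\<close> lie in a finite-dimensional space, so some \<open>F \<circ> T\<^sup>j\<close> is a
  combination of the later ones; since \<open>T\<close> is invertible this is a recurrence that can be run
  backwards.\<close>

lemma polynomial_vanishes_backwards: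
  fixes F :: "'a::euclidean_space \<Rightarrow> real"
  assumes F: "real_polynomial_function F" and T: "linear T" and TS: "\<And>x. T (S x) = x"
    and van: "\<And>n. n \<ge> N \<Longrightarrow> F ((T ^^ n) x) = 0"
  shows "F x = 0"
proof -
  define G where "G k = (\<lambda>x. F ((T ^^ k) x))" for k
  obtain \<Phi> where \<Phi>: "finite \<Phi>" "\<And>T :: 'a \<Rightarrow> 'a. linear T \<Longrightarrow> (\<lambda>x. F (T x)) \<in> fun_space.span \<Phi>"
    using polynomial_translates_finite_dim[OF F] by blast
  have G\<Phi>: "G k \<in> fun_space.span \<Phi>" for k unfolding G_def by (rule \<Phi>(2)[OF linear_funpow[OF T]])
  have "\<exists>j. G j \<in> fun_space.span (G ` {j<..})"
  proof (rule ccontr)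
    assume "\<not> ?thesis"
    then have no: "G j \<notin> fun_space.span (G ` {j<..})" for j by blast
    \<comment> \<open>Otherwise the functions \<open>G j\<close>, added from the last to the first,
      would give independent families of every size inside the span of a finite set.\<close>
    have ind: "\<not> fun_space.dependent (G ` {m..<m + d}) \<and> card (G ` {m..<m + d}) = d" for m d
    proof (induction d arbitrary: m)
      case 0 then show ?case by (simp add: fun_space.independent_empty)
    next
      case (Suc d)
      have eq: "{m..<m + Suc d} = insert m {Suc m..<Suc m + d}" by auto
      have nsp: "G m \<notin> fun_space.span (G ` {Suc m..<Suc m + d})"
      proof -
        have "G ` {Suc m..<Suc m + d} \<subseteq> G ` {m<..}" by (intro image_mono) auto
        then show ?thesis using no[of m] fun_space.span_mono by blast
      qed
      moreover have "G m \<notin> G ` {Suc m..<Suc m + d}"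
        using nsp by (rule contrapos_nn) (rule fun_space.span_base)
      ultimately show ?case using Suc[of "Suc m"] unfolding eq image_insert
        by (simp add: fun_space.independent_insert)
    qed
    have "card (G ` {0..<0 + Suc (card \<Phi>)}) \<le> card \<Phi>"
      using fun_space.independent_span_bound[OF \<Phi>(1), of "G ` {0..<0 + Suc (card \<Phi>)}"] ind[of 0 "Suc (card \<Phi>)"] G\<Phi> by auto
    then show False using ind[of 0 "Suc (card \<Phi>)"] by simp
  qed
  then obtain j where j: "G j \<in> fun_space.span (G ` {j<..})" by blast
  have step: "F ((T ^^ n) x) = 0" if later: "\<And>k. k > n \<Longrightarrow> F ((T ^^ k) x) = 0" for n
  proof -
    \<comment> \<open>Going back \<open>j\<close> steps from \<open>(T ^^ n) x\<close> makes the
      recurrence at \<open>y\<close> express the value at time \<open>n\<close> by later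
      values.\<close>
    define y where "y = (S ^^ j) ((T ^^ n) x)"
    have TSp: "(T ^^ i) ((S ^^ i) z) = z" for i z
      by (induction i arbitrary: z) (simp_all add: TS funpow_swap1)
    have Gy: "G (j + i) y = F ((T ^^ (n + i)) x)" for i
    proof -
      have "(T ^^ (j + i)) y = (T ^^ i) ((T ^^ j) y)" by (simp add: funpow_add add.commute[of j])
      also have "(T ^^ j) y = (T ^^ n) x" by (simp add: y_def TSp)
      also have "(T ^^ i) ((T ^^ n) x) = (T ^^ (n + i)) x" by (simp add: funpow_add add.commute[of n])
      finally show ?thesis by (simp add: G_def)
    qed
    have "H y = 0" if "H \<in> fun_space.span (G ` {j<..})" for H
      using that
    proof (induction rule: fun_space.span_induct_alt)
      case (step c \<phi> k)
      then obtain i where i: "\<phi> = G i" "i > j" by blast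
      then have "\<phi> y = F ((T ^^ (n + (i - j))) x)" using Gy[of "i - j"] by simp
      then have "\<phi> y = 0" using later i by simp
      then show ?case using step by simp
    qed simp
    from this[OF j] show ?thesis using Gy[of 0] by simp
  qed
  \<comment> \<open>The bound is lowered one step at a time; truncated subtraction ends the descent
    at zero.\<close>
  have "\<forall>m\<ge>N - i. F ((T ^^ m) x) = 0" for i
  proof (induction i)
    case 0 then show ?case using van by simp
  next
    case (Suc i)
    show ?case
    proof (intro allI impI)
      fix m assume m: "N - Suc i \<le> m"
      show "F ((T ^^ m) x) = 0"
      proof (cases "N - i \<le> m")
        case False
        show ?thesis by (rule step) (use m False Suc in auto)
      qed (use Suc in simp)
    qed
  qed
  from spec[OF this[of N], of 0] show ?thesis by simp
qed

section \<open>Generic elements of a Zariski dense subgroup\<close>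

text \<open>If the identity fails, a shear works: with \<open>f $ i\<close> and \<open>y $ j\<close>
  nonzero and \<open>i \<noteq> j\<close>, adding the \<open>j\<close>-th coordinate to the
  \<open>i\<close>-th changes the pairing from zero to a nonzero value.\<close>

lemma SL_ex_pairing_nonzero:
  fixes f y :: "real^'n"
  assumes "f \<noteq> 0" "y \<noteq> 0"
  shows "\<exists>X\<in>carrier SL. f \<bullet> (X *v y) \<noteq> 0"
proof (cases "f \<bullet> y = 0")
  case False
  then show ?thesis by (intro bexI[of _ "mat 1"]) (auto simp: SL_def)
next
  case True
  \<comment> \<open>Otherwise \<open>y\<close> would be supported on a single coordinate at which
    \<open>f\<close> is nonzero, and the pairing could not vanish.\<close>
  have "\<exists>i j. i \<noteq> j \<and> f $ i \<noteq> 0 \<and> y $ j \<noteq> 0"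
  proof (rule ccontr)
    assume no: "\<not> ?thesis"
    obtain i where i: "f $ i \<noteq> 0" using assms(1) by (auto simp: vec_eq_iff)
    have yj: "y $ j = 0" if "j \<noteq> i" for j
    proof (rule ccontr)
      assume "y $ j \<noteq> 0"
      then have "i \<noteq> j \<and> f $ i \<noteq> 0 \<and> y $ j \<noteq> 0" using i that by simp
      then show False using no by meson
    qed
    have "f \<bullet> y = (\<Sum>j\<in>UNIV. if j = i then f $ i * y $ i else 0)"
      unfolding inner_vec_def by (rule sum.cong) (auto simp: yj)
    then have "f $ i * y $ i = 0" using True by simp
    then have "y $ i = 0" using i by simp
    then have "y $ j = 0" for j using yj by (cases "j = i") auto
    then show False using assms(2) by (simp add: vec_eq_iff)
  qed
  then obtain i j where ij: "i \<noteq> j" "f $ i \<noteq> 0" "y $ j \<noteq> 0" by blast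
  define X :: "real^'n^'n" where "X = (\<chi> k. if k = i then row i (mat 1) + 1 *s row j (mat 1) else row k (mat 1))"
  have "det X = 1" unfolding X_def by (subst det_row_operation[OF ij(1)]) simp
  moreover have "X *v y = y + y $ j *\<^sub>R axis i 1"
  proof -
    have "X = mat 1 + outer (axis i 1) (axis j 1)"
      by (auto simp: X_def vec_eq_iff row_def mat_def outer_def axis_at)
    then show ?thesis by (simp add: matrix_vector_mult_add_rdistrib inner_axis')
  qed
  then have "f \<bullet> (X *v y) = y $ j * f $ i" using True by (simp add: inner_add_right inner_axis)
  ultimately show ?thesis using ij by (intro bexI[of _ X]) (auto simp: SL_def)
qed

lemma SL_inverse:
  fixes X :: "real^'n^'n"
  assumes "X \<in> carrier SL"
  obtains Y where "Y \<in> carrier SL" "X ** Y = mat 1" "Y ** X = mat 1"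
proof -
  have d: "det X = 1" using assms by (simp add: SL_def)
  then have "invertible X" by (simp add: invertible_det_nz)
  then obtain Y where Y: "X ** Y = mat 1" "Y ** X = mat 1" unfolding invertible_def by blast
  then have "det Y = 1" using d by (metis det_I det_mul mult_1)
  with Y that show ?thesis by (simp add: SL_def)
qed

text \<open>Each condition is the nonvanishing of a polynomial on the group and can be met on its
  own; irreducibility allows all three at once, and density then provides an element of \<Gamma>.
  Cramer's rule makes the pairing with the inverse polynomial in \<open>h\<close>.\<close>

lemma zariski_dense_generic:
  fixes \<Gamma> :: "(real^'n^'n) set"
  assumes \<Gamma>: "zariski_dense \<Gamma>" and p0: "real_polynomial_function p0" "X0 \<in> carrier SL" "p0 X0 \<noteq> 0"
    and f: "f \<noteq> 0" "y \<noteq> 0" and f': "f' \<noteq> 0" "x \<noteq> 0"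
  shows "\<exists>h h'. h \<in> \<Gamma> \<and> h ** h' = mat 1 \<and> h' ** h = mat 1 \<and> p0 h \<noteq> 0 \<and> f \<bullet> (h *v y) \<noteq> 0 \<and> f' \<bullet> (h' *v x) \<noteq> 0"
proof -
  define p1 where "p1 X = f \<bullet> (X *v y)" for X :: "real^'n^'n"
  \<comment> \<open>The matrices of Cramer's rule for the linear system with right hand side
    \<open>x\<close>.\<close>
  define D where "D X k = (\<chi> i j. if j = k then x $ i else X $ i $ j)" for X :: "real^'n^'n" and k
  define p2 where "p2 X = (\<Sum>k\<in>UNIV. f' $ k * det (D X k))" for X
  have poly1: "real_polynomial_function p1"
    unfolding p1_def inner_vec_def matrix_vector_mult_def inner_real_def vec_lambda_beta
    by (intro real_polynomial_function_sum real_polynomial_function.intros(2,4) real_polynomial_function_nth finite)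
  have "real_polynomial_function (\<lambda>X. D X k $ i $ j)" for k i j
    by (cases "j = k") (simp_all add: D_def real_polynomial_function.intros(2) real_polynomial_function_nth)
  then have poly2: "real_polynomial_function p2"
    unfolding p2_def
    by (intro real_polynomial_function_sum real_polynomial_function.intros(2,4) real_polynomial_function_det) auto
  have p2: "p2 X = f' \<bullet> (Y *v x)" if "det X = 1" "X ** Y = mat 1" for X Y :: "real^'n^'n"
  proof -
    have "X *v (Y *v x) = x" using that(2) by (simp add: matrix_vector_mul_assoc)
    then have "Y *v x = (\<chi> k. det (D X k) / det X)"
      using cramer[of X "Y *v x" x] that(1) by (simp add: D_def)
    then show ?thesis using that(1) by (simp add: p2_def inner_vec_def)
  qed
  obtain X1 where X1: "X1 \<in> carrier SL" "p1 X1 \<noteq> 0" using SL_ex_pairing_nonzero[OF f] by (auto simp: p1_def)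
  obtain Y2 where Y2: "Y2 \<in> carrier SL" "f' \<bullet> (Y2 *v x) \<noteq> 0" using SL_ex_pairing_nonzero[OF f'] by blast
  obtain X2 where X2: "X2 \<in> carrier SL" "X2 ** Y2 = mat 1" using SL_inverse[OF Y2(1)] by metis
  then have "p2 X2 \<noteq> 0" using p2[of X2 Y2] Y2 by (simp add: SL_def)
  then obtain X3 where X3: "X3 \<in> carrier SL" "p1 X3 \<noteq> 0" "p2 X3 \<noteq> 0"
    using SL_irreducible[OF poly1 poly2 X1 X2(1)] by blast
  have poly12: "real_polynomial_function (\<lambda>X. p1 X * p2 X)" by (intro real_polynomial_function.intros(4) poly1 poly2)
  obtain X4 where X4: "X4 \<in> carrier SL" "p0 X4 \<noteq> 0" "p1 X4 * p2 X4 \<noteq> 0"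
    using SL_irreducible[OF p0(1) poly12 p0(2,3) X3(1)] X3 by auto
  have poly: "real_polynomial_function (\<lambda>X. p0 X * (p1 X * p2 X))"
    by (intro real_polynomial_function.intros(4) p0(1) poly12)
  have "p0 X4 * (p1 X4 * p2 X4) \<noteq> 0" using X4 by simp
  from zariski_denseD[OF \<Gamma> poly X4(1) this]
  obtain h where h: "h \<in> \<Gamma>" "p0 h \<noteq> 0" "p1 h \<noteq> 0" "p2 h \<noteq> 0" by auto
  have hSL: "h \<in> carrier SL" using h(1) \<Gamma> by (auto simp: zariski_dense_def)
  obtain h' where h': "h ** h' = mat 1" "h' ** h = mat 1" using SL_inverse[OF hSL] by metis
  have "p2 h = f' \<bullet> (h' *v x)" using p2[OF _ h'(1)] hSL by (simp add: SL_def)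
  then show ?thesis using h h' by (auto simp: p1_def)
qed

section \<open>Combining proximal limits\<close>

context sharp_cone begin

text \<open>The inverses enter only through arbitrary limits \<open>A\<close> and \<open>B\<close>:
  the product and its inverse up to scale converge to matrices of rank at most one whatever these
  limits are. The two pairings say that the resulting functionals are nonzero.\<close>

lemma biprox_sandwich:
  assumes M: "\<And>n. M n \<in> auts" "\<And>n. M' n \<in> auts" "\<And>n. M n ** M' n = k n *\<^sub>R mat 1" "\<And>n. M' n ** M n = k n *\<^sub>R mat 1"
    and N: "\<And>n. N n \<in> auts" "\<And>n. N' n \<in> auts" "\<And>n. N n ** N' n = l n *\<^sub>R mat 1" "\<And>n. N' n ** N n = l n *\<^sub>R mat 1"
    and h: "h \<in> auts" "h' \<in> auts" "h ** h' = mat 1" "h' ** h = mat 1"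
    and lim: "M \<longlonglongrightarrow> outer u f" "M' \<longlonglongrightarrow> A" "N \<longlonglongrightarrow> outer w f'" "N' \<longlonglongrightarrow> B"
    and gen: "f \<bullet> (h *v (B *v y)) \<noteq> 0" "f' \<bullet> (h' *v (A *v x)) \<noteq> 0"
    and card: "CARD('n) \<ge> 2" and u: "u \<in> K" "u \<noteq> 0" and w: "w \<in> K" "w \<noteq> 0"
    and nt: "no_half_triangle u w" and d: "d > 0"
  shows "eventually (\<lambda>n. \<exists>a b \<alpha> \<beta>. biprox (M n ** h ** N' n) a b \<alpha> \<beta> \<and> norm (a - u) < d \<and> norm (b - w) < d) sequentially"
proof -
  have 1: "(\<lambda>n. M n ** h ** N' n) \<longlonglongrightarrow> outer u (f v* (h ** B))"
  proof -
    have "(\<lambda>n. M n ** h ** N' n) \<longlonglongrightarrow> outer u f ** h ** B" by (intro tendsto_intros lim)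
    then show ?thesis by (simp add: outer_matrix vector_matrix_mul_assoc)
  qed
  have 2: "(\<lambda>n. N n ** h' ** M' n) \<longlonglongrightarrow> outer w (f' v* (h' ** A))"
  proof -
    have "(\<lambda>n. N n ** h' ** M' n) \<longlonglongrightarrow> outer w f' ** h' ** A" by (intro tendsto_intros lim)
    then show ?thesis by (simp add: outer_matrix vector_matrix_mul_assoc)
  qed
  have n1: "f v* (h ** B) \<noteq> 0" using gen(1) by (metis dot_lmul_matrix inner_zero_left matrix_vector_mul_assoc)
  have n2: "f' v* (h' ** A) \<noteq> 0" using gen(2) by (metis dot_lmul_matrix inner_zero_left matrix_vector_mul_assoc)
  have "(M n ** h ** N' n) ** (N n ** h' ** M' n) = M n ** (h ** (N' n ** N n) ** h') ** M' n" for n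
    by (simp add: matrix_mul_assoc)
  then have i1: "(M n ** h ** N' n) ** (N n ** h' ** M' n) = (k n * l n) *\<^sub>R mat 1" for n
    by (simp add: N M h mult.commute)
  have "(N n ** h' ** M' n) ** (M n ** h ** N' n) = N n ** (h' ** (M' n ** M n) ** h) ** N' n" for n
    by (simp add: matrix_mul_assoc)
  then have i2: "(N n ** h' ** M' n) ** (M n ** h ** N' n) = (k n * l n) *\<^sub>R mat 1" for n
    by (simp add: N M h)
  show ?thesis
    by (rule biprox_perturbation[OF _ 1 _ 2 i1 i2 card u w n1 n2 nt d]) (intro auts_mult M N h)+
qed

lemma biprox_conjugate:
  assumes g: "biprox g a b \<alpha> \<beta>" and q: "q \<in> auts" "q ** q' = mat 1" "q' ** q = mat 1"
  shows "biprox (q ** g ** q') (q *v a) (q *v b) \<alpha> \<beta>"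
proof -
  note gb = g[unfolded biprox_def]
  have q': "q' \<in> auts" using auts_inverse[OF q(1,2)] .
  have "no_half_triangle (q *v a) (q *v b)"
    unfolding no_half_triangle_def
  proof (intro ballI impI)
    fix z assume z: "z \<in> K" "z \<noteq> 0"
    have "q' *v z \<in> K" "q' *v z \<noteq> 0" using auts_K[OF q' z(1)] auts_nonzero[OF q' z(2)] by auto
    then have "a + q' *v z \<in> C \<or> b + q' *v z \<in> C" using gb unfolding no_half_triangle_def by blast
    moreover have "q *v (c + q' *v z) = q *v c + z" for c
      by (simp add: matrix_vec_add matrix_vector_mul_assoc q)
    ultimately show "q *v a + z \<in> C \<or> q *v b + z \<in> C" using auts_C[OF q(1)] by metis
  qed
  moreover have "(q ** g ** q') *v (q *v v) = q *v (g *v v)" for v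
  proof -
    have "(q ** g ** q') *v (q *v v) = (q ** g ** (q' ** q)) *v v"
      by (simp add: matrix_vector_mul_assoc matrix_mul_assoc)
    then show ?thesis by (simp add: q matrix_vector_mul_assoc)
  qed
  ultimately show ?thesis
    using gb q q' by (auto simp: biprox_def auts_K auts_nonzero auts_mult)
qed

end

section \<open>Groups of automorphisms of a properly convex domain\<close>

locale convex_domain_group = convex_domain \<Omega> for \<Omega> :: "'n::finite proj set" +
  fixes \<Gamma> :: "(real^'n^'n) set"
  assumes subgrp: "subgroup \<Gamma> SL" and dense: "zariski_dense \<Gamma>"
    and preserves: "\<And>\<gamma>. \<gamma> \<in> \<Gamma> \<Longrightarrow> pact \<gamma> ` \<Omega> = \<Omega>" and card: "CARD('n) \<ge> 2"
begin

lemma \<Gamma>_SL: "\<Gamma> \<subseteq> carrier SL"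
  using subgroup.subset[OF subgrp] .

lemma \<Gamma>_mult: "g \<in> \<Gamma> \<Longrightarrow> h \<in> \<Gamma> \<Longrightarrow> g ** h \<in> \<Gamma>"
  using subgroup.m_closed[OF subgrp, of g h] by (simp add: SL_def)

lemma \<Gamma>_inverse:
  assumes "g \<in> \<Gamma>" obtains h where "h \<in> \<Gamma>" "g ** h = mat 1" "h ** g = mat 1"
proof -
  interpret SL: group "SL :: (real^'n^'n) monoid" by (rule group_SL)
  have "inv\<^bsub>SL\<^esub> g \<in> \<Gamma>" using subgroup.m_inv_closed[OF subgrp assms] .
  moreover have "g ** inv\<^bsub>SL\<^esub> g = mat 1" "inv\<^bsub>SL\<^esub> g ** g = mat 1"
    using SL.r_inv[of g] SL.l_inv[of g] assms \<Gamma>_SL by (auto simp: SL_def)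
  ultimately show ?thesis by (rule that)
qed

lemma \<Gamma>_one: "mat 1 \<in> \<Gamma>"
  using subgroup.one_closed[OF subgrp] by (simp add: SL_def)

lemma \<Gamma>_mpow: "g \<in> \<Gamma> \<Longrightarrow> mpow g n \<in> \<Gamma>"
  by (induction n) (simp_all add: \<Gamma>_one \<Gamma>_mult)

lemma \<Gamma>_automorphism: "g \<in> \<Gamma> \<Longrightarrow> g \<in> automorphisms \<Omega>"
  using \<Gamma>_SL preserves by (auto simp: automorphisms_def SL_def invertible_det_nz)

text \<open>The multiples of elements of \<open>\<Gamma>\<close> that preserve the cone itself, rather than exchanging it with
  its opposite.\<close>

definition P :: "(real^'n^'n) set" where
  "P = {g \<in> auts. \<exists>c \<gamma>. c \<noteq> 0 \<and> \<gamma> \<in> \<Gamma> \<and> g = c *\<^sub>R \<gamma>}"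

lemma P_auts: "g \<in> P \<Longrightarrow> g \<in> auts"
  by (simp add: P_def)

lemma \<Gamma>_P:
  assumes "\<gamma> \<in> \<Gamma>" "c \<noteq> 0"
  shows "c *\<^sub>R \<gamma> \<in> P \<or> - (c *\<^sub>R \<gamma>) \<in> P"
proof -
  obtain d :: real where d: "d = 1 \<or> d = - 1" "\<And>v. (d *\<^sub>R \<gamma>) *v v \<in> C \<longleftrightarrow> v \<in> C"
    using automorphism_cone[OF \<Gamma>_automorphism[OF assms(1)]] by blast
  obtain \<gamma>' where \<gamma>': "\<gamma> ** \<gamma>' = mat 1" "\<gamma>' ** \<gamma> = mat 1" using \<Gamma>_inverse[OF assms(1)] by metis
  have "invertible (d *\<^sub>R \<gamma>)" unfolding invertible_def
    using d(1) \<gamma>' by (intro exI[of _ "inverse d *\<^sub>R \<gamma>'"]) auto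
  then have "d *\<^sub>R \<gamma> \<in> auts" using d(2) by (simp add: auts_def)
  from auts_scaleR[OF this, of "\<bar>c\<bar>"] have "\<bar>c\<bar> *\<^sub>R (d *\<^sub>R \<gamma>) \<in> auts" using assms(2) by simp
  moreover have "\<exists>c' \<gamma>'. c' \<noteq> 0 \<and> \<gamma>' \<in> \<Gamma> \<and> \<bar>c\<bar> *\<^sub>R (d *\<^sub>R \<gamma>) = c' *\<^sub>R \<gamma>'"
    using assms d(1) by (intro exI[of _ "\<bar>c\<bar> * d"] exI[of _ \<gamma>]) auto
  ultimately have "\<bar>c\<bar> *\<^sub>R (d *\<^sub>R \<gamma>) \<in> P" unfolding P_def by blast
  moreover have "\<bar>c\<bar> *\<^sub>R (d *\<^sub>R \<gamma>) = c *\<^sub>R \<gamma> \<or> \<bar>c\<bar> *\<^sub>R (d *\<^sub>R \<gamma>) = - (c *\<^sub>R \<gamma>)"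
    using d(1) by (auto simp: abs_if)
  ultimately show ?thesis by metis
qed

lemma P_mult: "g \<in> P \<Longrightarrow> h \<in> P \<Longrightarrow> g ** h \<in> P"
proof -
  assume "g \<in> P" "h \<in> P"
  then obtain c \<gamma> d \<delta> where *: "g \<in> auts" "c \<noteq> 0" "\<gamma> \<in> \<Gamma>" "g = c *\<^sub>R \<gamma>" "h \<in> auts" "d \<noteq> 0" "\<delta> \<in> \<Gamma>" "h = d *\<^sub>R \<delta>"
    unfolding P_def by blast
  have "g ** h = (c * d) *\<^sub>R (\<gamma> ** \<delta>)" by (simp add: * mult.commute)
  moreover have "c * d \<noteq> 0" "\<gamma> ** \<delta> \<in> \<Gamma>" using * by (auto intro: \<Gamma>_mult)
  moreover have "g ** h \<in> auts" by (rule auts_mult[OF *(1,5)])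
  ultimately show "g ** h \<in> P" unfolding P_def by blast
qed

lemma P_scaleR: "g \<in> P \<Longrightarrow> 0 < t \<Longrightarrow> t *\<^sub>R g \<in> P"
proof -
  assume "g \<in> P" "0 < t"
  then obtain c \<gamma> where *: "g \<in> auts" "c \<noteq> 0" "\<gamma> \<in> \<Gamma>" "g = c *\<^sub>R \<gamma>" unfolding P_def by blast
  have "t *\<^sub>R g \<in> auts" by (rule auts_scaleR[OF *(1) \<open>0 < t\<close>])
  moreover have "t *\<^sub>R g = (t * c) *\<^sub>R \<gamma>" "t * c \<noteq> 0" using * \<open>0 < t\<close> by auto
  ultimately show "t *\<^sub>R g \<in> P" using *(3) unfolding P_def by blast
qed

lemma P_inverse:
  assumes "g \<in> P" obtains h where "h \<in> P" "g ** h = mat 1" "h ** g = mat 1"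
proof -
  obtain c \<gamma> where *: "g \<in> auts" "c \<noteq> 0" "\<gamma> \<in> \<Gamma>" "g = c *\<^sub>R \<gamma>" using assms unfolding P_def by blast
  obtain \<delta> where \<delta>: "\<delta> \<in> \<Gamma>" "\<gamma> ** \<delta> = mat 1" "\<delta> ** \<gamma> = mat 1" using \<Gamma>_inverse[OF *(3)] .
  define h where "h = inverse c *\<^sub>R \<delta>"
  have gh: "g ** h = mat 1" "h ** g = mat 1" using * \<delta> by (simp_all add: h_def)
  have "h \<in> P" unfolding P_def
    using auts_inverse[OF *(1) gh(1)] *(2) \<delta>(1) h_def nonzero_imp_inverse_nonzero by blast
  then show ?thesis using that gh by blast
qed

lemma P_mpow: "g \<in> P \<Longrightarrow> 0 < t \<Longrightarrow> t ^ n *\<^sub>R mpow g n \<in> P"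
proof -
  assume g: "g \<in> P" "0 < t"
  have "mpow g n \<in> P"
  proof (induction n)
    case 0
    have "mat 1 = (1::real) *\<^sub>R (mat 1 :: real^'n^'n)" by simp
    then show ?case using mat1_auts \<Gamma>_one unfolding P_def mpow.simps by (metis (mono_tags, lifting) mem_Collect_eq zero_neq_one)
  next
    case (Suc n) then show ?case using g by (simp add: P_mult)
  qed
  then show ?thesis using g by (intro P_scaleR) auto
qed

lemma P_biprox_rank_one:
  assumes "g \<in> P" "biprox g a b \<alpha> \<beta>"
  shows "\<exists>\<gamma>\<in>\<Gamma>. rank_one_isometry \<Omega> \<gamma> \<and> attracting_point \<gamma> = pline a \<and> repelling_point \<gamma> = pline b"
proof -
  obtain c \<gamma> where *: "c \<noteq> 0" "\<gamma> \<in> \<Gamma>" "g = c *\<^sub>R \<gamma>" using assms(1) unfolding P_def by blast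
  then show ?thesis
    using biprox_rank_one[OF assms(2) *(3,1) \<Gamma>_automorphism] biprox_attracting_point[OF assms(2) *(3,1)]
      biprox_repelling_point[OF assms(2) *(3,1)] by blast
qed

lemma rank_one_P:
  assumes "\<gamma> \<in> \<Gamma>" "rank_one_isometry \<Omega> \<gamma>"
  obtains c a b \<alpha> \<beta> where "c \<noteq> 0" "c *\<^sub>R \<gamma> \<in> P" "biprox (c *\<^sub>R \<gamma>) a b \<alpha> \<beta>" "attracting_point \<gamma> = pline a"
proof -
  obtain c a b \<alpha> \<beta> where *: "c \<noteq> 0" "biprox (c *\<^sub>R \<gamma>) a b \<alpha> \<beta>" using rank_one_biprox[OF assms(2)] .
  then have "c *\<^sub>R \<gamma> \<in> P" using assms(1) unfolding P_def biprox_def by blast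
  then show ?thesis using that * biprox_attracting_point[OF *(2) refl *(1)] by blast
qed

text \<open>A rescaled sequence in \<Gamma> can alternate between cone automorphisms and their
  negatives; a nonzero limit is approached by at least one of the two kinds.\<close>

lemma cone_closure_P:
  assumes "A \<in> cone_closure \<Gamma>" "A \<noteq> 0"
  shows "A \<in> closure P \<or> - A \<in> closure P"
proof -
  have "{c *\<^sub>R g | c g. g \<in> \<Gamma>} \<subseteq> {0} \<union> (P \<union> uminus ` P)"
  proof
    fix B assume "B \<in> {c *\<^sub>R g | c g. g \<in> \<Gamma>}"
    then obtain c g where B: "B = c *\<^sub>R g" "g \<in> \<Gamma>" by blast
    show "B \<in> {0} \<union> (P \<union> uminus ` P)"
    proof (cases "c = 0")
      case False
      then have "B \<in> P \<or> - B \<in> P" using \<Gamma>_P[OF B(2) False] B(1) by simp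
      then show ?thesis by (metis UnCI image_eqI minus_minus)
    qed (simp add: B)
  qed
  then have "A \<in> closure ({0} \<union> (P \<union> uminus ` P))"
    using assms(1) closure_mono unfolding cone_closure_def by blast
  then have "A \<in> closure P \<union> closure (uminus ` P)" using assms(2) by (simp add: closure_Un closure_insert)
  moreover have "- A \<in> closure P" if cl: "A \<in> closure (uminus ` P)"
  proof -
    obtain s where s: "\<forall>n. s n \<in> uminus ` P" "s \<longlonglongrightarrow> A" using cl unfolding closure_sequential by blast
    have "- s n \<in> P" for n using s(1) by (metis imageE minus_minus)
    then have "\<forall>n. - s n \<in> closure P" using closure_subset by blast
    then show ?thesis
      by (intro Lim_in_closed_set[OF closed_closure _ trivial_limit_sequentially tendsto_minus[OF s(2)]]) simp
  qed
  ultimately show ?thesis by blast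
qed

lemma proximal_limitE:
  assumes "p \<in> proximal_limit_set \<Gamma>"
  obtains u f where "u \<noteq> 0" "f \<noteq> 0" "p = pline u" "outer u f \<in> closure P"
proof -
  obtain u f where uf: "u \<noteq> 0" "f \<noteq> 0" "outer u f \<in> cone_closure \<Gamma>" "p = pline u"
    using proximal_limit_set_subset[OF \<Gamma>_SL card assms] by blast
  then have "outer u f \<noteq> 0" by simp
  from cone_closure_P[OF uf(3) this] show ?thesis
  proof
    assume "outer u f \<in> closure P" then show ?thesis using that uf by blast
  next
    assume "- outer u f \<in> closure P"
    then have "outer u (- f) \<in> closure P" using outer_scaleR(2)[of u "-1" f] by simp
    then show ?thesis using that[of u "- f"] uf by simp
  qed
qed

text \<open>The scalar between two representatives of \<open>p\<close> moves into \<open>f\<close>,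
  so the representative in the cone can be prescribed.\<close>

lemma proximal_limit_coneE:
  assumes "p \<in> proximal_limit_set \<Gamma>" "v \<in> K" "v \<noteq> 0" "p = pline v"
  obtains f where "f \<noteq> 0" "outer v f \<in> closure P"
proof -
  obtain u f where uf: "u \<noteq> 0" "f \<noteq> 0" "p = pline u" "outer u f \<in> closure P"
    using proximal_limitE[OF assms(1)] .
  obtain c where c: "c \<noteq> 0" "u = c *\<^sub>R v" using uf(1,3) assms(3,4) pline_eq_iff by metis
  have "outer u f = outer v (c *\<^sub>R f)" by (simp add: c(2) outer_scaleR)
  then show ?thesis using that[of "c *\<^sub>R f"] uf c by simp
qed

text \<open>The inverses of a sequence converging to a matrix of rank one need not converge, but
  divided by their norms they have a convergent subsequence with nonzero limit. The factors
  \<open>k n\<close> record this normalisation.\<close>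

lemma P_sequence_with_inverse:
  assumes "outer u f \<in> closure P"
  obtains M M' k A where "\<And>n. M n \<in> P" "\<And>n. M' n \<in> P" "\<And>n. M n ** M' n = k n *\<^sub>R mat 1"
    "\<And>n. M' n ** M n = k n *\<^sub>R mat 1" "M \<longlonglongrightarrow> outer u f" "M' \<longlonglongrightarrow> A" "A \<noteq> 0"
proof -
  obtain s where s: "\<And>n. s n \<in> P" "s \<longlonglongrightarrow> outer u f" using assms unfolding closure_sequential by blast
  have "\<forall>n. \<exists>t. t \<in> P \<and> s n ** t = mat 1 \<and> t ** s n = mat 1" using P_inverse[OF s(1)] by metis
  then obtain t where t: "\<And>n. t n \<in> P" "\<And>n. s n ** t n = mat 1" "\<And>n. t n ** s n = mat 1" by metis
  have t0: "t n \<noteq> 0" for n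
  proof
    assume "t n = 0"
    then have "(mat 1 :: real^'n^'n) = 0" using t(2)[of n] by simp
    then have "(mat 1 :: real^'n^'n) $ undefined $ undefined = 0" by (simp only: zero_index)
    then show False by (simp add: mat_def)
  qed
  define T where "T n = inverse (norm (t n)) *\<^sub>R t n" for n
  have TP: "T n \<in> P" for n unfolding T_def using t0 t(1) by (intro P_scaleR) auto
  have "T n \<in> sphere 0 1" for n using t0[of n] by (simp add: T_def)
  then obtain A r where A: "A \<in> sphere 0 1" "strict_mono (r :: nat \<Rightarrow> nat)" "(T \<circ> r) \<longlonglongrightarrow> A"
    using compact_sphere[of "0 :: real^'n^'n" 1] unfolding compact_def by meson
  show ?thesis
  proof (rule that[of "s \<circ> r" "T \<circ> r" "\<lambda>n. inverse (norm (t (r n)))" A])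
    show "(s \<circ> r) \<longlonglongrightarrow> outer u f" using LIMSEQ_subseq_LIMSEQ[OF s(2) A(2)] .
    show "A \<noteq> 0" using A(1) by auto
  qed (use s(1) TP t A(3) in \<open>simp_all add: T_def\<close>)
qed

text \<open>The generic element \<open>h\<close> is chosen after the limits \<open>A\<close> and
  \<open>B\<close>; these are nonzero, so there are vectors \<open>A *v x\<close> and
  \<open>B *v y\<close> to be paired. The element produced is \<open>M n ** q ** N' n\<close>, where
  \<open>q\<close> is \<open>h\<close> with the sign that preserves the cone.\<close>

lemma ex_biprox_near:
  assumes u: "u \<in> K" "u \<noteq> 0" "f \<noteq> 0" "outer u f \<in> closure P"
    and w: "w \<in> K" "w \<noteq> 0" "f' \<noteq> 0" "outer w f' \<in> closure P"
    and nt: "no_half_triangle u w" and d: "d > 0"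
  shows "\<exists>g\<in>P. \<exists>a b \<alpha> \<beta>. biprox g a b \<alpha> \<beta> \<and> norm (a - u) < d \<and> norm (b - w) < d"
proof -
  obtain M M' k A where M: "\<And>n. M n \<in> P" "\<And>n. M' n \<in> P" "\<And>n. M n ** M' n = k n *\<^sub>R mat 1"
    "\<And>n. M' n ** M n = k n *\<^sub>R mat 1" "M \<longlonglongrightarrow> outer u f" "M' \<longlonglongrightarrow> A" "A \<noteq> 0"
    using P_sequence_with_inverse[OF u(4)] by blast
  obtain N N' l B where N: "\<And>n. N n \<in> P" "\<And>n. N' n \<in> P" "\<And>n. N n ** N' n = l n *\<^sub>R mat 1"
    "\<And>n. N' n ** N n = l n *\<^sub>R mat 1" "N \<longlonglongrightarrow> outer w f'" "N' \<longlonglongrightarrow> B" "B \<noteq> 0"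
    using P_sequence_with_inverse[OF w(4)] by blast
  obtain x where x: "A *v x \<noteq> 0" using M(7) by (metis matrix_eq matrix_vector_mult_0)
  obtain y where y: "B *v y \<noteq> 0" using N(7) by (metis matrix_eq matrix_vector_mult_0)
  \<comment> \<open>The additional polynomial condition is left trivial here.\<close>
  have one: "real_polynomial_function (\<lambda>X :: real^'n^'n. 1)" by (rule real_polynomial_function.intros(2))
  have "mat 1 \<in> carrier (SL :: (real^'n^'n) monoid)" by (simp add: SL_def)
  from zariski_dense_generic[OF dense one this _ u(3) y w(3) x]
  obtain h h' where h: "h \<in> \<Gamma>" "h ** h' = mat 1" "h' ** h = mat 1"
    "f \<bullet> (h *v (B *v y)) \<noteq> 0" "f' \<bullet> (h' *v (A *v x)) \<noteq> 0" by auto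
  obtain c :: real where c: "c = 1 \<or> c = - 1" "c *\<^sub>R h \<in> P"
    using \<Gamma>_P[OF h(1), of 1] by (metis scaleR_minus_left scaleR_one zero_neq_one)
  define q q' where "q = c *\<^sub>R h" and "q' = c *\<^sub>R h'"
  have q: "q \<in> P" "q ** q' = mat 1" "q' ** q = mat 1" using c h by (auto simp: q_def q'_def)
  have q': "q' \<in> auts" using auts_inverse[OF P_auts[OF q(1)] q(2)] .
  have gen: "f \<bullet> (q *v (B *v y)) \<noteq> 0" "f' \<bullet> (q' *v (A *v x)) \<noteq> 0"
    using h(4,5) c(1) by (auto simp: q_def q'_def)
  have "eventually (\<lambda>n. \<exists>a b \<alpha> \<beta>. biprox (M n ** q ** N' n) a b \<alpha> \<beta> \<and> norm (a - u) < d \<and> norm (b - w) < d) sequentially"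
    by (rule biprox_sandwich[OF P_auts[OF M(1)] P_auts[OF M(2)] M(3,4) P_auts[OF N(1)] P_auts[OF N(2)] N(3,4)
          P_auts[OF q(1)] q' q(2,3) M(5,6) N(5,6) gen card u(1,2) w(1,2) nt d])
  then obtain n where "\<exists>a b \<alpha> \<beta>. biprox (M n ** q ** N' n) a b \<alpha> \<beta> \<and> norm (a - u) < d \<and> norm (b - w) < d"
    using eventually_happens'[OF sequentially_bot] by blast
  moreover have "M n ** q ** N' n \<in> P" by (intro P_mult M N q)
  ultimately show ?thesis by blast
qed

lemma ex_rank_one_sequence:
  assumes u: "u \<in> K" "u \<noteq> 0" "f \<noteq> 0" "outer u f \<in> closure P"
    and w: "w \<in> K" "w \<noteq> 0" "f' \<noteq> 0" "outer w f' \<in> closure P"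
    and nt: "no_half_triangle u w"
  shows "\<exists>g :: nat \<Rightarrow> real^'n^'n. (\<forall>n. g n \<in> \<Gamma> \<and> rank_one_isometry \<Omega> (g n)) \<and>
    (\<lambda>n. attracting_point (g n)) \<longlonglongrightarrow> pline u \<and> (\<lambda>n. repelling_point (g n)) \<longlonglongrightarrow> pline w"
proof -
  have "\<exists>\<gamma> a b. \<gamma> \<in> \<Gamma> \<and> rank_one_isometry \<Omega> \<gamma> \<and> attracting_point \<gamma> = pline a \<and> repelling_point \<gamma> = pline b \<and>
      norm (a - u) < inverse (real (Suc n)) \<and> norm (b - w) < inverse (real (Suc n))" for n
  proof -
    have "inverse (real (Suc n)) > 0" by simp
    from ex_biprox_near[OF u w nt this] show ?thesis using P_biprox_rank_one by blast
  qed
  then obtain g a b where g: "\<And>n. g n \<in> \<Gamma> \<and> rank_one_isometry \<Omega> (g n) \<and> attracting_point (g n) = pline (a n) \<and>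
      repelling_point (g n) = pline (b n) \<and> norm (a n - u) < inverse (real (Suc n)) \<and> norm (b n - w) < inverse (real (Suc n))"
    by metis
  have "a \<longlonglongrightarrow> u" "b \<longlonglongrightarrow> w"
    by (rule Lim_transform_bound[OF _ LIMSEQ_inverse_real_of_nat, THEN LIM_zero_cancel],
        use g in \<open>auto intro!: always_eventually less_imp_le\<close>)+
  then have "(\<lambda>n. pline (a n)) \<longlonglongrightarrow> pline u" "(\<lambda>n. pline (b n)) \<longlonglongrightarrow> pline w"
    using u(2) w(2) tendsto_pline by blast+
  then show ?thesis using g by (intro exI[of _ g]) simp
qed

text \<open>The sandwich construction is applied with normalised powers of \<open>g\<close> as first
  sequence and normalised powers of its inverse as second, so that \<gamma> occurs on both sides of
  \<open>h\<close> to the same power. If \<open>F\<close> did not vanish on the group, a generic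
  \<open>h\<close> with \<open>F h \<noteq> 0\<close> could be chosen; but \<open>F\<close> vanishes
  at the resulting group elements for large \<open>n\<close>, and the recurrence carries this back
  to \<open>h\<close>.\<close>

lemma rank_one_zariski_dense:
  assumes \<gamma>: "\<gamma> \<in> \<Gamma>" "rank_one_isometry \<Omega> \<gamma>"
  shows "zariski_dense {\<gamma>\<in>\<Gamma>. rank_one_isometry \<Omega> \<gamma>}"
  unfolding zariski_dense_iff
proof (intro conjI allI impI)
  show "{\<gamma>\<in>\<Gamma>. rank_one_isometry \<Omega> \<gamma>} \<subseteq> carrier SL" using \<Gamma>_SL by blast
next
  fix F assume F: "real_polynomial_function F" "\<forall>X\<in>{\<gamma>\<in>\<Gamma>. rank_one_isometry \<Omega> \<gamma>}. F X = 0"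
  obtain c a b \<alpha> \<beta> where g: "c \<noteq> 0" "c *\<^sub>R \<gamma> \<in> P" "biprox (c *\<^sub>R \<gamma>) a b \<alpha> \<beta>" using rank_one_P[OF \<gamma>] .
  define g where "g = c *\<^sub>R \<gamma>"
  have gP: "g \<in> P" and gb: "biprox g a b \<alpha> \<beta>" using g by (simp_all add: g_def)
  note gb' = gb[unfolded biprox_def]
  obtain g' where g': "g' \<in> P" "g ** g' = mat 1" "g' ** g = mat 1" using P_inverse[OF gP] .
  obtain f where f: "(\<lambda>n. inverse \<alpha> ^ n *\<^sub>R mpow g n) \<longlonglongrightarrow> outer a f" "f \<bullet> a = 1"
    using biprox_limit[OF gb] by metis
  obtain f' where f': "(\<lambda>n. inverse (inverse \<beta>) ^ n *\<^sub>R mpow g' n) \<longlonglongrightarrow> outer b f'" "f' \<bullet> b = 1"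
    using biprox_limit[OF biprox_inverse[OF gb g'(2,3)]] by metis
  define M where "M n = inverse \<alpha> ^ n *\<^sub>R mpow g n" for n
  define M' where "M' n = inverse (inverse \<beta>) ^ n *\<^sub>R mpow g' n" for n
  define k where "k n = inverse \<alpha> ^ n * inverse (inverse \<beta>) ^ n" for n
  have pos: "0 < inverse \<alpha>" "0 < inverse (inverse \<beta>)" using gb' by auto
  have MP: "M n \<in> P" "M' n \<in> P" for n unfolding M_def M'_def using P_mpow gP g'(1) pos by blast+
  have MM: "M n ** M' n = k n *\<^sub>R mat 1" "M' n ** M n = k n *\<^sub>R mat 1" for n
    using mpow_inverse[OF g'(2), of n] mpow_inverse[OF g'(3), of n] by (simp_all add: M_def M'_def k_def mult.commute)
  have lim: "M \<longlonglongrightarrow> outer a f" "M' \<longlonglongrightarrow> outer b f'" using f f' unfolding M_def M'_def by simp_all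
  have f0: "f \<noteq> 0" "f' \<noteq> 0" using f(2) f'(2) by auto
  show "\<forall>X\<in>carrier SL. F X = 0"
  proof (rule ccontr)
    assume "\<not> (\<forall>X\<in>carrier SL. F X = 0)"
    then obtain X0 where X0: "X0 \<in> carrier SL" "F X0 \<noteq> 0" by blast
    have ab0: "a \<noteq> 0" "b \<noteq> 0" using gb' by auto
    from zariski_dense_generic[OF dense F(1) X0 f0(1) ab0(1) f0(2) ab0(2)]
    obtain h h' where h: "h \<in> \<Gamma>" "h ** h' = mat 1" "h' ** h = mat 1" "F h \<noteq> 0"
      "f \<bullet> (h *v a) \<noteq> 0" "f' \<bullet> (h' *v b) \<noteq> 0" by blast
    obtain d :: real where d: "d = 1 \<or> d = - 1" "d *\<^sub>R h \<in> P"
      using \<Gamma>_P[OF h(1), of 1] by (metis scaleR_minus_left scaleR_one zero_neq_one)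
    define q q' where "q = d *\<^sub>R h" and "q' = d *\<^sub>R h'"
    have q: "q \<in> P" "q ** q' = mat 1" "q' ** q = mat 1" using d h by (auto simp: q_def q'_def)
    have q': "q' \<in> auts" using auts_inverse[OF P_auts[OF q(1)] q(2)] .
    have gen: "f \<bullet> (q *v (outer a f *v a)) \<noteq> 0" "f' \<bullet> (q' *v (outer b f' *v b)) \<noteq> 0"
      using h(5,6) d(1) f(2) f'(2) by (auto simp: q_def q'_def)
    have "eventually (\<lambda>n. \<exists>a' b' \<alpha> \<beta>. biprox (M n ** q ** M n) a' b' \<alpha> \<beta> \<and> norm (a' - a) < 1 \<and> norm (b' - b) < 1) sequentially"
      by (rule biprox_sandwich[OF P_auts[OF MP(1)] P_auts[OF MP(2)] MM P_auts[OF MP(2)] P_auts[OF MP(1)] MM(2,1)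
            P_auts[OF q(1)] q' q(2,3) lim lim(2,1) gen card]) (use gb' in auto)
    then obtain N where N: "\<And>n. n \<ge> N \<Longrightarrow> \<exists>a' b' \<alpha> \<beta>. biprox (M n ** q ** M n) a' b' \<alpha> \<beta>"
      unfolding eventually_sequentially by blast
    \<comment> \<open>An invertible linear map of the matrix space whose iterates at
      \<open>h\<close> are the two-sided products.\<close>
    define T where "T X = \<gamma> ** X ** \<gamma>" for X
    obtain \<delta> where \<delta>: "\<gamma> ** \<delta> = mat 1" "\<delta> ** \<gamma> = mat 1" using \<Gamma>_inverse[OF \<gamma>(1)] by metis
    have Tn: "(T ^^ n) X = mpow \<gamma> n ** X ** mpow \<gamma> n" for n X
    proof (induction n)
      case (Suc n)
      have "(T ^^ Suc n) X = \<gamma> ** (mpow \<gamma> n ** X ** mpow \<gamma> n) ** \<gamma>" by (simp add: T_def Suc)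
      also have "\<dots> = (\<gamma> ** mpow \<gamma> n) ** X ** (mpow \<gamma> n ** \<gamma>)" by (simp add: matrix_mul_assoc)
      also have "mpow \<gamma> n ** \<gamma> = mpow \<gamma> (Suc n)" by (rule mpow_Suc_right[symmetric])
      finally show ?case by simp
    qed simp
    have "F h = 0"
    proof (rule polynomial_vanishes_backwards[OF F(1), of T "\<lambda>X. \<delta> ** X ** \<delta>" N])
      show "linear T"
        by (rule linearI) (simp_all add: T_def matrix_add_ldistrib matrix_mult_add_rdistrib)
      show "T (\<delta> ** X ** \<delta>) = X" for X
      proof -
        have "T (\<delta> ** X ** \<delta>) = (\<gamma> ** \<delta>) ** X ** (\<delta> ** \<gamma>)" by (simp add: T_def matrix_mul_assoc)
        then show ?thesis by (simp add: \<delta>)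
      qed
      fix n assume "N \<le> n"
      then obtain a' b' \<alpha>' \<beta>' where bp: "biprox (M n ** q ** M n) a' b' \<alpha>' \<beta>'" using N by blast
      \<comment> \<open>Collects the powers of \<alpha> and \<open>c\<close> and the sign
        \<open>d\<close> that separate the cone automorphism from the group element.\<close>
      define s where "s = (inverse \<alpha> ^ n * c ^ n) * d * (inverse \<alpha> ^ n * c ^ n)"
      have "M n ** q ** M n = s *\<^sub>R (T ^^ n) h"
        unfolding Tn by (simp add: M_def g_def mpow_scaleR q_def s_def mult_ac)
      moreover have "s \<noteq> 0" using g(1) d(1) pos by (auto simp: s_def)
      moreover have "(T ^^ n) h \<in> \<Gamma>" unfolding Tn by (intro \<Gamma>_mult \<Gamma>_mpow \<gamma> h)
      ultimately have "rank_one_isometry \<Omega> ((T ^^ n) h)" using biprox_rank_one[OF bp] \<Gamma>_automorphism by blast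
      then show "F ((T ^^ n) h) = 0" using F(2) \<open>(T ^^ n) h \<in> \<Gamma>\<close> by blast
    qed
    then show False using h(4) by simp
  qed
qed

lemma attracting_point_proximal:
  assumes \<gamma>: "\<gamma> \<in> \<Gamma>" "rank_one_isometry \<Omega> \<gamma>"
  shows "attracting_point \<gamma> \<in> proximal_limit_set \<Gamma>"
proof -
  obtain c a b \<alpha> \<beta> where g: "biprox (c *\<^sub>R \<gamma>) a b \<alpha> \<beta>" "attracting_point \<gamma> = pline a"
    using rank_one_P[OF \<gamma>] by metis
  obtain f where f: "(\<lambda>n. inverse \<alpha> ^ n *\<^sub>R mpow (c *\<^sub>R \<gamma>) n) \<longlonglongrightarrow> outer a f" "f \<bullet> a = 1"
    using biprox_limit[OF g(1)] by metis
  have "(\<lambda>n. (inverse \<alpha> ^ n * c ^ n) *\<^sub>R mpow \<gamma> n) \<longlonglongrightarrow> outer a f" using f(1) by (simp add: mpow_scaleR)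
  then have "outer a f \<in> cone_closure \<Gamma>" by (rule cone_closureI[OF \<Gamma>_mpow[OF \<gamma>(1)]])
  then show ?thesis
    unfolding g(2) using g(1) f(2) by (intro rank_one_limit_in_proximal_limit_set[OF \<Gamma>_SL card]) (auto simp: biprox_def)
qed

text \<open>If \<open>M n\<close> tends to \<open>outer u f\<close> and \<open>f\<close> does not
  vanish at \<open>h *v a\<close>, the elements \<open>M n ** h\<close> send the attracting point of
  a fixed rank one isometry to points converging to \<open>pline u\<close>, and these are the
  attracting points of the conjugates. The other inclusion needs the limit set to be closed.\<close>

lemma proximal_limit_set_eq_closure:
  assumes \<gamma>: "\<gamma> \<in> \<Gamma>" "rank_one_isometry \<Omega> \<gamma>"
  shows "proximal_limit_set \<Gamma> = closure {attracting_point \<gamma> | \<gamma>. \<gamma> \<in> \<Gamma> \<and> rank_one_isometry \<Omega> \<gamma>}" (is "_ = closure ?A")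
proof
  have "?A \<subseteq> proximal_limit_set \<Gamma>" using attracting_point_proximal by blast
  then show "closure ?A \<subseteq> proximal_limit_set \<Gamma>"
    by (rule closure_minimal[OF _ closed_proximal_limit_set[OF \<Gamma>_SL card]])
  show "proximal_limit_set \<Gamma> \<subseteq> closure ?A"
  proof
    fix p assume "p \<in> proximal_limit_set \<Gamma>"
    then obtain u f where uf: "u \<noteq> 0" "f \<noteq> 0" "p = pline u" "outer u f \<in> closure P" by (rule proximal_limitE)
    obtain c a b \<alpha> \<beta> where g: "c *\<^sub>R \<gamma> \<in> P" "biprox (c *\<^sub>R \<gamma>) a b \<alpha> \<beta>" using rank_one_P[OF \<gamma>] by metis
    obtain M where M: "\<And>n. M n \<in> P" "M \<longlonglongrightarrow> outer u f" using uf(4) unfolding closure_sequential by blast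
    have a0: "a \<noteq> 0" using g(2) by (simp add: biprox_def)
    have one: "real_polynomial_function (\<lambda>X :: real^'n^'n. 1)" by (rule real_polynomial_function.intros(2))
    have "mat 1 \<in> carrier (SL :: (real^'n^'n) monoid)" by (simp add: SL_def)
    \<comment> \<open>Only the first pairing is wanted; the second is filled with the same
      data.\<close>
    from zariski_dense_generic[OF dense one this _ uf(2) a0 uf(2) a0]
    obtain h where h: "h \<in> \<Gamma>" "f \<bullet> (h *v a) \<noteq> 0" by auto
    obtain d :: real where d: "d = 1 \<or> d = - 1" "d *\<^sub>R h \<in> P"
      using \<Gamma>_P[OF h(1), of 1] by (metis scaleR_minus_left scaleR_one zero_neq_one)
    define q where "q n = M n ** (d *\<^sub>R h)" for n
    have qP: "q n \<in> P" for n unfolding q_def by (intro P_mult M d)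
    have "(\<lambda>n. q n *v a) \<longlonglongrightarrow> (outer u f ** (d *\<^sub>R h)) *v a" unfolding q_def by (intro tendsto_intros M)
    then have "(\<lambda>n. q n *v a) \<longlonglongrightarrow> (d * (f \<bullet> (h *v a))) *\<^sub>R u" by (simp flip: matrix_vector_mul_assoc)
    moreover have nz: "d * (f \<bullet> (h *v a)) \<noteq> 0" using h d by auto
    ultimately have "(\<lambda>n. pline (q n *v a)) \<longlonglongrightarrow> pline ((d * (f \<bullet> (h *v a))) *\<^sub>R u)"
      using uf(1) by (intro tendsto_pline) auto
    then have "(\<lambda>n. pline (q n *v a)) \<longlonglongrightarrow> p" using nz uf pline_scaleR[of "d * (f \<bullet> (h *v a))" u] by simp
    moreover have "pline (q n *v a) \<in> closure ?A" for n
    proof -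
      obtain q' where q': "q' \<in> P" "q n ** q' = mat 1" "q' ** q n = mat 1" using P_inverse[OF qP] .
      have "biprox (q n ** (c *\<^sub>R \<gamma>) ** q') (q n *v a) (q n *v b) \<alpha> \<beta>"
        by (rule biprox_conjugate[OF g(2) P_auts[OF qP] q'(2,3)])
      moreover have "q n ** (c *\<^sub>R \<gamma>) ** q' \<in> P" by (intro P_mult qP g q')
      ultimately obtain \<gamma>' where "\<gamma>' \<in> \<Gamma>" "rank_one_isometry \<Omega> \<gamma>'" "attracting_point \<gamma>' = pline (q n *v a)"
        using P_biprox_rank_one by metis
      then have "pline (q n *v a) \<in> ?A" by (intro CollectI exI[of _ \<gamma>']) simp
      then show ?thesis by (rule subsetD[OF closure_subset])
    qed
    ultimately show "p \<in> closure ?A"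
      by (intro Lim_in_closed_set[OF closed_closure _ trivial_limit_sequentially]) auto
  qed
qed

end

text \<open>With one coordinate the projective space is a single point.\<close>

lemma card_ge_2_of_distinct_points:
  fixes a b :: "'n::finite proj"
  assumes "a \<noteq> b"
  shows "CARD('n) \<ge> 2"
proof (rule ccontr)
  assume "\<not> ?thesis"
  then have "CARD('n) = 1" using zero_less_card_finite[where 'a='n] by linarith
  then obtain i :: 'n where i: "UNIV = {i}" using card_1_singletonE by blast
  obtain u where u: "u \<noteq> 0" "a = pline u" by (rule pline_cases)
  obtain v where v: "v \<noteq> 0" "b = pline v" by (rule pline_cases)
  have ex: "x = y \<longleftrightarrow> x $ i = y $ i" for x y :: "real^'n" using i by (metis UNIV_I singletonD vec_eq_iff)
  have "u $ i \<noteq> 0" "v $ i \<noteq> 0" using u v ex[of u 0] ex[of v 0] by auto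
  then have "v = (v $ i / u $ i) *\<^sub>R u" "v $ i / u $ i \<noteq> 0" by (simp_all add: ex)
  then have "pline u = pline v" using pline_eq_iff u v by blast
  then show False using assms u v by simp
qed

theorem lemma8p10:
  fixes \<Gamma> :: "(real^'n^'n) set" and \<Omega> :: "'n::finite proj set" and a' b' :: "'n proj"
  assumes "subgroup \<Gamma> SL" and "discrete \<Gamma>" and "zariski_dense \<Gamma>"
    and "properly_convex_domain \<Omega>"
    and "\<forall>\<gamma>\<in>\<Gamma>. pact \<gamma> ` \<Omega> = \<Omega>"
    and "a' \<in> proximal_limit_set \<Gamma> \<inter> frontier \<Omega>"
    and "b' \<in> proximal_limit_set \<Gamma> \<inter> frontier \<Omega>"
    and "open_proj_seg \<Omega> a' b' \<subseteq> \<Omega>"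
    and "rank_one_geodesic \<Omega> a' b'"
  shows "(\<exists>g :: nat \<Rightarrow> real^'n^'n.
            (\<forall>n. g n \<in> \<Gamma> \<and> rank_one_isometry \<Omega> (g n)) \<and>
            (\<lambda>n. attracting_point (g n)) \<longlonglongrightarrow> a' \<and>
            (\<lambda>n. repelling_point (g n)) \<longlonglongrightarrow> b')
       \<and> rank_one_hilbert_geometry \<Omega> \<Gamma>
       \<and> zariski_dense {\<gamma>\<in>\<Gamma>. rank_one_isometry \<Omega> \<gamma>}
       \<and> proximal_limit_set \<Gamma> = closure {attracting_point \<gamma> | \<gamma>. \<gamma> \<in> \<Gamma> \<and> rank_one_isometry \<Omega> \<gamma>}"
proof -
  have ab_ne: "a' \<noteq> b'" using assms(9) by (simp add: rank_one_geodesic_def)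
  interpret convex_domain_group \<Omega> \<Gamma>
    using assms(1,3,4,5) card_ge_2_of_distinct_points[OF ab_ne]
    by (intro convex_domain_group.intro convex_domain.intro convex_domain_group_axioms.intro) auto
  obtain u where u: "u \<in> K" "u \<noteq> 0" "u \<notin> C" "a' = pline u" using assms(6) frontier_iff by blast
  obtain w where w: "w \<in> K" "w \<noteq> 0" "w \<notin> C" "b' = pline w" using assms(7) frontier_iff by blast
  \<comment> \<open>The sum represents a point of the open segment, and its positive height decides
    between the two cones.\<close>
  have seg: "v1 + v2 \<in> C"
    if v: "v1 \<in> K" "v1 \<noteq> 0" "v2 \<in> K" "v2 \<noteq> 0" "pline v1 \<noteq> pline v2" "open_proj_seg \<Omega> (pline v1) (pline v2) \<subseteq> \<Omega>"
    for v1 v2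
  proof -
    have "pline (1 *\<^sub>R v1 + 1 *\<^sub>R v2) \<in> open_proj_seg \<Omega> (pline v1) (pline v2)"
      unfolding open_proj_seg_pline[OF v(1-5)] by (rule CollectI, rule exI[of _ 1], rule exI[of _ 1]) simp
    then have "pline (v1 + v2) \<in> \<Omega>" using v(6) by auto
    moreover have "0 < e \<bullet> v1 + e \<bullet> v2" using K_pos v by (simp add: add_pos_pos)
    ultimately show ?thesis by (simp add: dcone_def inner_add_right)
  qed
  have uw: "u + w \<in> C" using seg[OF u(1,2) w(1,2)] u(4) w(4) ab_ne assms(8) by simp
  have nt: "no_half_triangle u w"
    unfolding no_half_triangle_def
  proof (intro ballI impI)
    fix z assume z: "z \<in> K" "z \<noteq> 0"
    have par: "v' + z \<in> C" if v: "pline v = pline z" "v \<in> K" "v \<noteq> 0" "v' + v \<in> C" "v' \<in> K" for v v'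
    proof -
      obtain t where "t > 0" "z = t *\<^sub>R v" using pline_K_inj[OF v(2,3) z v(1)] by blast
      then show ?thesis using C_pos_comb[OF v(4,5,2), of 1 t] by simp
    qed
    show "u + z \<in> C \<or> w + z \<in> C"
    proof (cases "z \<in> C")
      case True then show ?thesis using K_add_C u by blast
    next
      case False
      then have "pline z \<in> frontier \<Omega>" using pline_frontier_iff z by blast
      then consider "open_proj_seg \<Omega> a' (pline z) \<subseteq> \<Omega>" | "open_proj_seg \<Omega> (pline z) b' \<subseteq> \<Omega>"
        using assms(9) unfolding rank_one_geodesic_def by blast
      then show ?thesis
      proof cases
        case 1
        show ?thesis
        \<comment> \<open>If \<open>z\<close> lies on the ray of \<open>u\<close>, the open segment
          is empty and the hypothesis says nothing; then \<open>u + w\<close> in the open cone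
          already gives the other alternative.\<close>
        proof (cases "pline u = pline z")
          case True then show ?thesis using par[of u w] u w uw by (simp add: add.commute)
        next
          case False then show ?thesis using seg[OF u(1,2) z] 1 u(4) by simp
        qed
      next
        case 2
        show ?thesis
        proof (cases "pline w = pline z")
          case True then show ?thesis using par[of w u] u w uw by simp
        next
          case False then show ?thesis using seg[OF z w(1,2)] 2 w(4) by (simp add: add.commute)
        qed
      qed
    qed
  qed
  obtain f where f: "f \<noteq> 0" "outer u f \<in> closure P" using proximal_limit_coneE[OF _ u(1,2,4)] assms(6) by blast
  obtain f' where f': "f' \<noteq> 0" "outer w f' \<in> closure P" using proximal_limit_coneE[OF _ w(1,2,4)] assms(7) by blast
  have 1: "\<exists>g :: nat \<Rightarrow> real^'n^'n. (\<forall>n. g n \<in> \<Gamma> \<and> rank_one_isometry \<Omega> (g n)) \<and>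
      (\<lambda>n. attracting_point (g n)) \<longlonglongrightarrow> a' \<and> (\<lambda>n. repelling_point (g n)) \<longlonglongrightarrow> b'"
    using ex_rank_one_sequence[OF u(1,2) f w(1,2) f' nt] u(4) w(4) by simp
  then obtain \<gamma> where \<gamma>: "\<gamma> \<in> \<Gamma>" "rank_one_isometry \<Omega> \<gamma>" by blast
  have "rank_one_hilbert_geometry \<Omega> \<Gamma>" using \<gamma> unfolding rank_one_hilbert_geometry_def by blast
  with 1 rank_one_zariski_dense[OF \<gamma>] proximal_limit_set_eq_closure[OF \<gamma>] show ?thesis by blast
qed

end
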